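(* Let $(\gamma_i)_{i\in\mathbb{N}}$ be a sequence of (real or complex) subgaussian random variables such that $s=\sup_i\mathrm{sg}(\gamma_i)<\infty$ and $M=\sup_i\|\gamma_i\|_\infty<\infty$. Suppose that $\mathcal{F}$ is an exact interpolation functor with the $\infty$-property with constant $\delta$. Then there exists a constant $C=C(s,M)>0$, depending only on $s$ and $M$, such that for all $N,K\in\mathbb{N}$ and every scalar $N\times K$ matrix $(a_{i,j})$ (with $1\le i\le K$, $1\le j\le N$), $$\Big\|\sup_{1\le j\le N}\Big|\sum_{i=1}^K\gamma_ia_{i,j}\Big|\Big\|_{\mathcal{F}(L_\infty,L_{\varphi_2})}\le\delta\,C\,\phi_{\mathcal{F}}\big(1,\sqrt{1+\log N}\big)\sup_{1\le j\le N}\big\|(a_{i,j})_{i=1}^K\big\|_{\mathcal{F}(\ell_1,\ell_2)},$$ where $\phi_{\mathcal{F}}$ is the fundamental function of $\mathcal{F}$. In particular, $C=\sqrt{8/3}$ whenever $(\gamma_i)=(\varepsilon_i)$ is a sequence of independent Rademacher random variables.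
   Context: A real random variable $f$ is subgaussian if there is $s\ge0$ with $\mathbb{E}\exp(xf)\le\exp(s^2x^2/2)$ for all $x\in\mathbb{R}$; a complex random variable $f$ is subgaussian if there is $s\ge0$ with $\mathbb{E}\exp(\mathrm{Re}(zf))\le\exp(s^2|z|^2/2)$ for all $z\in\mathbb{C}$. The best such $s$ is denoted $\mathrm{sg}(f)$. Rademacher variables take values $\pm1$ with probability $1/2$. All $\gamma_i$ live on a probability space $(\Omega,\mathcal{A},\mathbb{P})$; $L_\infty=L_\infty(\mathbb{P})$ and $\|f\|_{L_{\varphi_2}}=\inf\{\varepsilon>0:\int_\Omega(e^{|f|^2/\varepsilon^2}-1)\,d\mathbb{P}\le1\}$. A Banach couple $\vec X=(X_0,X_1)$ is a pair of Banach spaces continuously embedded in a common Hausdorff topological vector space. $T\colon\vec X\to\vec Y$ means that $T\colon X_0+X_1\to Y_0+Y_1$ is linear and restricts to bounded operators $X_j\to Y_j$, $j=0,1$. An exact interpolation functor $\mathcal{F}$ assigns to each Banach couple $\vec X$ a Banach space $\mathcal{F}(\vec X)=\mathcal{F}(X_0,X_1)$ with continuous inclusions $X_0\cap X_1\subset\mathcal{F}(\vec X)\subset X_0+X_1$ such that every $T\colon\vec X\to\vec Y$ maps $\mathcal{F}(\vec X)$ to $\mathcal{F}(\vec Y)$ with norm at most $\max_{j=0,1}\|T\colon X_j\to Y_j\|$. Its fundamental function is $\phi_{\mathcal{F}}(s,t)=\sup\|T\colon\mathcal{F}(\vec X)\to\mathcal{F}(\vec Y)\|$, $s,t>0$, the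 supremum over all Banach couples $\vec X,\vec Y$ and all $T\colon\vec X\to\vec Y$ with $\|T\colon X_0\to Y_0\|\le s$, $\|T\colon X_1\to Y_1\|\le t$. $\mathcal{F}$ has the $\infty$-property with constant $\delta>0$ if for every Banach couple $(X_0,X_1)$, $\sup_{N\ge1}\|\mathrm{id}\colon\ell_\infty^N(\mathcal{F}(X_0,X_1))\to\mathcal{F}(\ell_\infty^N(X_0),\ell_\infty^N(X_1))\|\le\delta$, where $\ell_\infty^N(X)=X^N$ with the norm $\max_j\|x_j\|_X$. A finite sequence $(x_i)_{i=1}^K$ is identified with the sequence $\sum_{i=1}^Kx_ie_i$ when its norm in a sequence space is taken.
   Formalization: The variables γ_i are assumed independent (the claim fails if all equal one Rademacher); log is natural in the general bound but base 2 for C=√(8/3), which fails with natural log; C is chosen for fixed scalar field and carrier types. *)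

theory Defs
  imports "HOL-Algebra.Algebraic_Closure_Type" "HOL-Probability.Probability"
begin

section \<open>Scalars\<close>

text \<open>
  Scalars are a type of class \<open>{real_normed_field, euclidean_space}\<close>. Both \<open>real\<close> and \<open>complex\<close>
  are instances and, by Frobenius' theorem, up to isomorphism the only ones, so that statements
  polymorphic in the scalar type cover exactly the real and the complex case.
\<close>

definition re_part :: "'k::{real_normed_field, euclidean_space} \<Rightarrow> real" where
  "re_part z = inner z 1"

lemma re_part_real: "re_part (x::real) = x"
  by (simp add: re_part_def)

lemma re_part_complex: "re_part (z::complex) = Re z"
  by (simp add: re_part_def inner_complex_def)


section \<open>Points\<close>

text \<open>
  HOL cannot quantify over all Banach spaces, of all types, inside one formula. Banach spaces are
  therefore carried by subsets of one type of points, which contains the scalar sequences, the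
  almost-everywhere classes of random variables on \<open>'p\<close>, all finite tuples of points, and
  the atoms \<open>'x\<close>. Since \<open>'x\<close> is arbitrary, every set of Banach spaces has isometric copies in
  some such type. The operations of a space belong to the space, not to the points.
\<close>

datatype ('x, 'p, 'k) point =
    Atom 'x
  | Sequence (entries: "nat \<Rightarrow> 'k")
  | AE_class (representatives: "('p \<Rightarrow> 'k) set")
  | Tuple (coords: "('x, 'p, 'k) point list")


section \<open>Banach couples\<close>

text \<open>A linear subspace of an ambient vector space, with its own norm.\<close>

record 'u nspace =
  pts :: "'u set"
  nrm :: "'u \<Rightarrow> real"

definition vector_sp :: "('k::field, 'u) module \<Rightarrow> bool" where
  "vector_sp V \<longleftrightarrow> Module.module (ring_of_type_algebra :: 'k ring) V"

text \<open>The value 0 off the space is needed because the axioms \<open>nonneg\<close> and \<open>commute\<close> of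
  \<open>Metric_space\<close> are not relativised to the carrier.\<close>

definition ndist :: "('k, 'u) module \<Rightarrow> 'u nspace \<Rightarrow> 'u \<Rightarrow> 'u \<Rightarrow> real" where
  "ndist V A x y = (if x \<in> pts A \<and> y \<in> pts A then nrm A (a_minus V x y) else 0)"

definition normed_in :: "('k::real_normed_field, 'u) module \<Rightarrow> 'u nspace \<Rightarrow> bool" where
  "normed_in V A \<longleftrightarrow>
     submodule (pts A) (ring_of_type_algebra :: 'k ring) V \<and>
     (\<forall>x\<in>pts A. 0 \<le> nrm A x \<and> (nrm A x = 0 \<longleftrightarrow> x = \<zero>\<^bsub>V\<^esub>)) \<and>
     (\<forall>c. \<forall>x\<in>pts A. nrm A (c \<odot>\<^bsub>V\<^esub> x) = norm c * nrm A x) \<and>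
     (\<forall>x\<in>pts A. \<forall>y\<in>pts A. nrm A (x \<oplus>\<^bsub>V\<^esub> y) \<le> nrm A x + nrm A y)"

definition banach_in :: "('k::real_normed_field, 'u) module \<Rightarrow> 'u nspace \<Rightarrow> bool" where
  "banach_in V A \<longleftrightarrow> normed_in V A \<and> Metric_space.mcomplete (pts A) (ndist V A)"

definition hausdorff_tvs :: "('k::real_normed_field, 'u) module \<Rightarrow> 'u topology \<Rightarrow> bool" where
  "hausdorff_tvs V \<tau> \<longleftrightarrow>
     vector_sp V \<and> topspace \<tau> = carrier V \<and> Hausdorff_space \<tau> \<and>
     continuous_map (prod_topology \<tau> \<tau>) \<tau> (\<lambda>(x, y). x \<oplus>\<^bsub>V\<^esub> y) \<and>
     continuous_map (prod_topology euclidean \<tau>) \<tau> (\<lambda>(c::'k, x). c \<odot>\<^bsub>V\<^esub> x)"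

definition cont_embedded :: "('k::real_normed_field, 'u) module \<Rightarrow> 'u topology \<Rightarrow> 'u nspace \<Rightarrow> bool" where
  "cont_embedded V \<tau> A \<longleftrightarrow> continuous_map (Metric_space.mtopology (pts A) (ndist V A)) \<tau> id"

record ('k, 'u) couple =
  amb :: "('k, 'u) module"
  sp0 :: "'u nspace"
  sp1 :: "'u nspace"

definition banach_couple :: "('k::real_normed_field, 'u) couple \<Rightarrow> bool" where
  "banach_couple A \<longleftrightarrow>
     banach_in (amb A) (sp0 A) \<and> banach_in (amb A) (sp1 A) \<and>
     (\<exists>\<tau>. hausdorff_tvs (amb A) \<tau> \<and>
          cont_embedded (amb A) \<tau> (sp0 A) \<and> cont_embedded (amb A) \<tau> (sp1 A))"

definition inter_space :: "('k, 'u) couple \<Rightarrow> 'u nspace" where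
  "inter_space A =
     \<lparr>pts = pts (sp0 A) \<inter> pts (sp1 A), nrm = (\<lambda>x. max (nrm (sp0 A) x) (nrm (sp1 A) x))\<rparr>"

definition sum_space :: "('k, 'u) couple \<Rightarrow> 'u nspace" where
  "sum_space A =
     \<lparr>pts = {x \<oplus>\<^bsub>amb A\<^esub> y | x y. x \<in> pts (sp0 A) \<and> y \<in> pts (sp1 A)},
      nrm = (\<lambda>z. Inf {nrm (sp0 A) x + nrm (sp1 A) y | x y.
                        x \<in> pts (sp0 A) \<and> y \<in> pts (sp1 A) \<and> z = x \<oplus>\<^bsub>amb A\<^esub> y})\<rparr>"


section \<open>Operators\<close>

text \<open>Boundedness only; linearity is imposed once, on the sum space, in \<open>couple_op\<close>.\<close>

definition bounded_op :: "'u nspace \<Rightarrow> 'u nspace \<Rightarrow> ('u \<Rightarrow> 'u) \<Rightarrow> bool" where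
  "bounded_op A B T \<longleftrightarrow>
     T \<in> pts A \<rightarrow> pts B \<and> (\<exists>c. \<forall>x\<in>pts A. nrm B (T x) \<le> c * nrm A x)"

definition op_norm :: "'u nspace \<Rightarrow> 'u nspace \<Rightarrow> ('u \<Rightarrow> 'u) \<Rightarrow> real" where
  "op_norm A B T = Sup {nrm B (T x) | x. x \<in> pts A \<and> nrm A x \<le> 1}"

definition linear_op :: "('k, 'u) module \<Rightarrow> 'u set \<Rightarrow> ('k, 'u) module \<Rightarrow> ('u \<Rightarrow> 'u) \<Rightarrow> bool" where
  "linear_op V D W T \<longleftrightarrow>
     (\<forall>x\<in>D. \<forall>y\<in>D. T (x \<oplus>\<^bsub>V\<^esub> y) = T x \<oplus>\<^bsub>W\<^esub> T y) \<and>
     (\<forall>c. \<forall>x\<in>D. T (c \<odot>\<^bsub>V\<^esub> x) = c \<odot>\<^bsub>W\<^esub> T x)"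

definition couple_op :: "('k, 'u) couple \<Rightarrow> ('k, 'u) couple \<Rightarrow> ('u \<Rightarrow> 'u) \<Rightarrow> bool" where
  "couple_op A B T \<longleftrightarrow>
     T \<in> pts (sum_space A) \<rightarrow> pts (sum_space B) \<and>
     linear_op (amb A) (pts (sum_space A)) (amb B) T \<and>
     bounded_op (sp0 A) (sp0 B) T \<and> bounded_op (sp1 A) (sp1 B) T"


section \<open>Exact interpolation functors\<close>

definition exact_interpolation_functor ::
  "(('k::real_normed_field, 'u) couple \<Rightarrow> 'u nspace) \<Rightarrow> bool" where
  "exact_interpolation_functor F \<longleftrightarrow>
     (\<forall>A. banach_couple A \<longrightarrow>
        banach_in (amb A) (F A) \<and>
        bounded_op (inter_space A) (F A) id \<and> bounded_op (F A) (sum_space A) id) \<and>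
     (\<forall>A B T. banach_couple A \<longrightarrow> banach_couple B \<longrightarrow> couple_op A B T \<longrightarrow>
        bounded_op (F A) (F B) T \<and>
        op_norm (F A) (F B) T \<le> max (op_norm (sp0 A) (sp0 B) T) (op_norm (sp1 A) (sp1 B) T))"

text \<open>For an exact interpolation functor and \<open>s, t > 0\<close> the set below is nonempty and bounded by
  \<open>max s t\<close>, so that its real supremum is the genuine one.\<close>

definition fundamental_function ::
  "(('k::real_normed_field, 'u) couple \<Rightarrow> 'u nspace) \<Rightarrow> real \<Rightarrow> real \<Rightarrow> real" where
  "fundamental_function F s t =
     Sup {op_norm (F A) (F B) T | A B T.
            banach_couple A \<and> banach_couple B \<and> couple_op A B T \<and>
            op_norm (sp0 A) (sp0 B) T \<le> s \<and> op_norm (sp1 A) (sp1 B) T \<le> t}"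

definition tuple_module ::
  "nat \<Rightarrow> ('k, ('x, 'p, 'k) point) module \<Rightarrow> ('k, ('x, 'p, 'k) point) module" where
  "tuple_module N V =
     \<lparr>carrier = Tuple ` {xs. length xs = N \<and> set xs \<subseteq> carrier V},
      monoid.mult = undefined, monoid.one = undefined,
      zero = Tuple (replicate N \<zero>\<^bsub>V\<^esub>),
      add = (\<lambda>u v. Tuple (map2 (add V) (coords u) (coords v))),
      module.smult = (\<lambda>c u. Tuple (map (module.smult V c) (coords u)))\<rparr>"

definition linf_space :: "nat \<Rightarrow> ('x, 'p, 'k) point nspace \<Rightarrow> ('x, 'p, 'k) point nspace" where
  "linf_space N A =
     \<lparr>pts = Tuple ` {xs. length xs = N \<and> set xs \<subseteq> pts A},
      nrm = (\<lambda>u. MAX x\<in>set (coords u). nrm A x)\<rparr>"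

definition linf_couple ::
  "nat \<Rightarrow> ('k, ('x, 'p, 'k) point) couple \<Rightarrow> ('k, ('x, 'p, 'k) point) couple" where
  "linf_couple N A =
     \<lparr>amb = tuple_module N (amb A), sp0 = linf_space N (sp0 A), sp1 = linf_space N (sp1 A)\<rparr>"

definition infty_property ::
  "(('k::real_normed_field, ('x, 'p, 'k) point) couple \<Rightarrow> ('x, 'p, 'k) point nspace) \<Rightarrow> real \<Rightarrow> bool" where
  "infty_property F \<delta> \<longleftrightarrow>
     \<delta> > 0 \<and>
     (\<forall>A. banach_couple A \<longrightarrow>
        (\<forall>N\<ge>1. bounded_op (linf_space N (F A)) (F (linf_couple N A)) id \<and>
                op_norm (linf_space N (F A)) (F (linf_couple N A)) id \<le> \<delta>))"


section \<open>The couple of $\ell_1$ and $\ell_2$\<close>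

definition seq_module :: "('k::real_normed_field, ('x, 'p, 'k) point) module" where
  "seq_module =
     \<lparr>carrier = range Sequence, monoid.mult = undefined, monoid.one = undefined,
      zero = Sequence (\<lambda>_. 0),
      add = (\<lambda>u v. Sequence (\<lambda>n. entries u n + entries v n)),
      module.smult = (\<lambda>c u. Sequence (\<lambda>n. c * entries u n))\<rparr>"

definition lp_space :: "real \<Rightarrow> ('x, 'p, 'k::real_normed_field) point nspace" where
  "lp_space p =
     \<lparr>pts = Sequence ` {x. summable (\<lambda>n. norm (x n) powr p)},
      nrm = (\<lambda>u. (\<Sum>n. norm (entries u n) powr p) powr (1 / p))\<rparr>"

definition l1_l2 :: "('k::real_normed_field, ('x, 'p, 'k) point) couple" where
  "l1_l2 = \<lparr>amb = seq_module, sp0 = lp_space 1, sp1 = lp_space 2\<rparr>"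


section \<open>The couple of $L_\infty$ and $L_{\varphi_2}$\<close>

definition rv_class :: "'p measure \<Rightarrow> ('p \<Rightarrow> 'k::real_normed_field) \<Rightarrow> ('x, 'p, 'k) point" where
  "rv_class P f = AE_class {g \<in> borel_measurable P. AE \<omega> in P. g \<omega> = f \<omega>}"

definition rv_rep :: "('x, 'p, 'k) point \<Rightarrow> 'p \<Rightarrow> 'k" where
  "rv_rep u = (SOME f. f \<in> representatives u)"

definition L0_module :: "'p measure \<Rightarrow> ('k::real_normed_field, ('x, 'p, 'k) point) module" where
  "L0_module P =
     \<lparr>carrier = rv_class P ` borel_measurable P, monoid.mult = undefined, monoid.one = undefined,
      zero = rv_class P (\<lambda>_. 0),
      add = (\<lambda>u v. rv_class P (\<lambda>\<omega>. rv_rep u \<omega> + rv_rep v \<omega>)),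
      module.smult = (\<lambda>c u. rv_class P (\<lambda>\<omega>. c * rv_rep u \<omega>))\<rparr>"

definition Linfty_norm :: "'p measure \<Rightarrow> ('p \<Rightarrow> 'k::real_normed_field) \<Rightarrow> ereal" where
  "Linfty_norm P f = esssup P (\<lambda>\<omega>. ereal (norm (f \<omega>)))"

definition Linfty_space :: "'p measure \<Rightarrow> ('x, 'p, 'k::real_normed_field) point nspace" where
  "Linfty_space P =
     \<lparr>pts = rv_class P ` {f \<in> borel_measurable P. Linfty_norm P f < \<infinity>},
      nrm = (\<lambda>u. real_of_ereal (Linfty_norm P (rv_rep u)))\<rparr>"

definition phi2_admissible :: "'p measure \<Rightarrow> ('p \<Rightarrow> 'k::real_normed_field) \<Rightarrow> real set" where
  "phi2_admissible P f =
     {\<epsilon>. \<epsilon> > 0 \<and> (\<integral>\<^sup>+\<omega>. ennreal (exp ((norm (f \<omega>))\<^sup>2 / \<epsilon>\<^sup>2) - 1) \<partial>P) \<le> 1}"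

definition Lphi2_space :: "'p measure \<Rightarrow> ('x, 'p, 'k::real_normed_field) point nspace" where
  "Lphi2_space P =
     \<lparr>pts = rv_class P ` {f \<in> borel_measurable P. phi2_admissible P f \<noteq> {}},
      nrm = (\<lambda>u. Inf (phi2_admissible P (rv_rep u)))\<rparr>"

definition Linfty_Lphi2 :: "'p measure \<Rightarrow> ('k::real_normed_field, ('x, 'p, 'k) point) couple" where
  "Linfty_Lphi2 P = \<lparr>amb = L0_module P, sp0 = Linfty_space P, sp1 = Lphi2_space P\<rparr>"


section \<open>Subgaussian and Rademacher random variables\<close>

text \<open>Expectations are nonnegative integrals, since the Bochner integral of a non-integrable
  function is 0.\<close>

definition sg_admissible ::
  "'p measure \<Rightarrow> ('p \<Rightarrow> 'k::{real_normed_field, euclidean_space}) \<Rightarrow> real set" where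
  "sg_admissible P f =
     {s. s \<ge> 0 \<and> (\<forall>z. (\<integral>\<^sup>+\<omega>. ennreal (exp (re_part (z * f \<omega>))) \<partial>P)
                        \<le> ennreal (exp (s\<^sup>2 * (norm z)\<^sup>2 / 2)))}"

definition subgaussian ::
  "'p measure \<Rightarrow> ('p \<Rightarrow> 'k::{real_normed_field, euclidean_space}) \<Rightarrow> bool" where
  "subgaussian P f \<longleftrightarrow> f \<in> borel_measurable P \<and> sg_admissible P f \<noteq> {}"

definition sg :: "'p measure \<Rightarrow> ('p \<Rightarrow> 'k::{real_normed_field, euclidean_space}) \<Rightarrow> real" where
  "sg P f = Inf (sg_admissible P f)"

text \<open>
  Two conventions are forced by the case of the functor \<open>F = sp1\<close>, with \<open>\<delta> = 1\<close>. The estimate is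
  for independent variables: if all of them equal one Rademacher variable, \<open>N = 1\<close> and
  \<open>a i j = 1 / sqrt K\<close>, then the left-hand side grows like \<open>sqrt K\<close>. The constant \<open>sqrt (8 / 3)\<close>
  goes with the binary logarithm: for \<open>N\<close> normalised sums over disjoint long blocks of
  Rademacher variables the left-hand side behaves like \<open>sqrt (2 / ln 2 * ln N)\<close>, and \<open>2 / ln 2 > 8 / 3\<close>.
\<close>

definition rademacher :: "'p measure \<Rightarrow> ('p \<Rightarrow> 'k::real_normed_field) \<Rightarrow> bool" where
  "rademacher P f \<longleftrightarrow>
     f \<in> borel_measurable P \<and>
     measure P {\<omega> \<in> space P. f \<omega> = 1} = 1 / 2 \<and> measure P {\<omega> \<in> space P. f \<omega> = -1} = 1 / 2"

end

theory Submission
  imports Defs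
begin

text \<open>
  For a fixed matrix, multiply each sum \<open>\<Sum>i. \<gamma> i * a i j\<close> by its conjugate phase and average, at each
  point, over the indices \<open>j\<close> of maximal modulus. This is a linear operation, so the maximal function is
  the image of the tuple of columns under a linear operator on \<open>N\<close>-tuples of sequences. This operator is
  bounded from \<open>\<ell>\<^sub>\<infinity>\<^sup>N(\<ell>\<^sub>1)\<close> to \<open>L\<^sub>\<infinity>\<close> with a constant independent of \<open>N\<close>, trivially, and from
  \<open>\<ell>\<^sub>\<infinity>\<^sup>N(\<ell>\<^sub>2)\<close> to \<open>L\<^bsub>\<phi>2\<^esub>\<close> with norm of order \<open>sqrt (1 + log N)\<close>, by the maximal inequality for
  subgaussian variables. Interpolating it, and embedding the tuple of columns into the interpolation space
  by means of the \<open>\<infinity>\<close>-property, gives the estimate.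

  All spaces involved are spaces of measurable functions on a probability space whose norm dominates the
  \<open>L\<^sub>1\<close> norm and has the Fatou property. Sequences are functions on the natural numbers with a geometric
  distribution, and tuples of sequences are functions on a product. Completeness and the ambient Hausdorff
  vector topology, that of convergence in measure, are therefore obtained once and for all.
\<close>

section \<open>Ambient spaces of measurable functions\<close>

text \<open>A functor is accessible only through its axioms, which speak of linear operators between
  Banach couples. This creates two obstacles. The maximum is not linear, so the weights that
  linearise it are computed once, from the given matrix. And every couple met on the way must first
  be shown to be a Banach couple; the gauges reduce this to six elementary properties, the last of
  which is the Fatou property. The base measures are auxiliary: the geometric distribution charges
  every point, so equality almost everywhere is equality of sequences, and the norms do not depend
  on it.

  The constant \<open>8 / 3\<close> comes from a standard Gaussian \<open>g\<close>, for which
  \<open>exp (3 / 8 * g\<^sup>2)\<close> has expectation 2, just the value that the Orlicz norm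
  allows. The binary logarithm comes from \<open>(2 * N) powr (1 / (1 + log 2 N)) = 2\<close>: a
  maximum of \<open>N\<close> exponentials of mean at most 2 has mean at most \<open>2 * N\<close>,
  and this power brings it back to 2. General subgaussian variables cost the dimension of the
  scalars inside the square of the constant; Rademacher variables avoid it.\<close>

lemma min_1_subadd:
  fixes a b r :: real
  assumes "r \<le> a + b" "0 \<le> a" "0 \<le> b"
  shows "min 1 r \<le> min 1 a + min 1 b"
  using assms by linarith

text \<open>An abstract copy of the measurable functions modulo null sets. Representatives such as
  \<open>rv_rep\<close> are chosen by \<open>SOME\<close> and are not linear on the nose, so every
  identity is required almost everywhere only; \<open>rep_inj\<close> turns it back into an equality
  of points.\<close>

locale L0_model = prob_space Q
  for Q :: "'a measure" +
  fixes V :: "('k::{real_normed_field, euclidean_space}, 'u) module" (structure)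
    and rep :: "'u \<Rightarrow> 'a \<Rightarrow> 'k"
  assumes rep_measurable [measurable]: "u \<in> carrier V \<Longrightarrow> rep u \<in> borel_measurable Q"
    and rep_inj: "u \<in> carrier V \<Longrightarrow> v \<in> carrier V \<Longrightarrow> AE x in Q. rep u x = rep v x \<Longrightarrow> u = v"
    and rep_surj: "f \<in> borel_measurable Q \<Longrightarrow> \<exists>u\<in>carrier V. AE x in Q. rep u x = f x"
    and zero_carrier: "\<zero> \<in> carrier V"
    and rep_zero: "AE x in Q. rep \<zero> x = 0"
    and add_carrier: "u \<in> carrier V \<Longrightarrow> v \<in> carrier V \<Longrightarrow> u \<oplus> v \<in> carrier V"
    and rep_add: "u \<in> carrier V \<Longrightarrow> v \<in> carrier V \<Longrightarrow> AE x in Q. rep (u \<oplus> v) x = rep u x + rep v x"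
    and smult_carrier: "u \<in> carrier V \<Longrightarrow> c \<odot> u \<in> carrier V"
    and rep_smult: "u \<in> carrier V \<Longrightarrow> AE x in Q. rep (c \<odot> u) x = c * rep u x"
begin

section \<open>Vector space structure\<close>

lemma add_inverse_exists:
  assumes u: "u \<in> carrier V"
  shows "\<exists>v\<in>carrier V. v \<oplus> u = \<zero>"
proof
  show c: "(-1) \<odot> u \<in> carrier V" using u by (rule smult_carrier)
  show "(-1) \<odot> u \<oplus> u = \<zero>"
  proof (rule rep_inj)
    show "AE x in Q. rep ((-1) \<odot> u \<oplus> u) x = rep \<zero> x"
      using rep_add[OF c u] rep_smult[OF u, of "-1"] rep_zero by eventually_elim simp
  qed (use c u add_carrier zero_carrier in auto)
qed

lemma abelian_group: "abelian_group V"
proof (rule abelian_groupI)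
  fix u v w assume uvw: "u \<in> carrier V" "v \<in> carrier V" "w \<in> carrier V"
  show "u \<oplus> v \<oplus> w = u \<oplus> (v \<oplus> w)"
  proof (rule rep_inj)
    show "AE x in Q. rep (u \<oplus> v \<oplus> w) x = rep (u \<oplus> (v \<oplus> w)) x"
      using rep_add[OF add_carrier[OF uvw(1,2)] uvw(3)] rep_add[OF uvw(1) add_carrier[OF uvw(2,3)]]
        rep_add[OF uvw(1,2)] rep_add[OF uvw(2,3)]
      by eventually_elim simp
  qed (use uvw add_carrier in auto)
next
  fix u v assume uv: "u \<in> carrier V" "v \<in> carrier V"
  show "u \<oplus> v = v \<oplus> u"
  proof (rule rep_inj)
    show "AE x in Q. rep (u \<oplus> v) x = rep (v \<oplus> u) x"
      using rep_add[OF uv] rep_add[OF uv(2,1)] by eventually_elim simp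
  qed (use uv add_carrier in auto)
next
  fix u assume u: "u \<in> carrier V"
  show "\<zero> \<oplus> u = u"
  proof (rule rep_inj)
    show "AE x in Q. rep (\<zero> \<oplus> u) x = rep u x"
      using rep_add[OF zero_carrier u] rep_zero by eventually_elim simp
  qed (use u add_carrier zero_carrier in auto)
qed (use zero_carrier add_carrier add_inverse_exists in auto)

lemma module: "Module.module (ring_of_type_algebra :: 'k ring) V"
proof (rule moduleI)
  show "cring (ring_of_type_algebra :: 'k ring)" by (rule cring_from_type_algebra)
  show "abelian_group V" by (rule abelian_group)
next
  fix a b :: 'k and u assume u: "u \<in> carrier V"
  have "(a + b) \<odot> u = a \<odot> u \<oplus> b \<odot> u"
  proof (rule rep_inj)
    show "AE x in Q. rep ((a + b) \<odot> u) x = rep (a \<odot> u \<oplus> b \<odot> u) x"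
      using rep_add[OF smult_carrier[OF u, of a] smult_carrier[OF u, of b]]
        rep_smult[OF u, of "a + b"] rep_smult[OF u, of a] rep_smult[OF u, of b]
      by eventually_elim (simp add: distrib_right)
  qed (use u smult_carrier add_carrier in auto)
  then show "(a \<oplus>\<^bsub>ring_of_type_algebra\<^esub> b) \<odot> u = a \<odot> u \<oplus> b \<odot> u"
    by (simp add: ring_of_type_algebra_def)
  have "(a * b) \<odot> u = a \<odot> (b \<odot> u)"
  proof (rule rep_inj)
    show "AE x in Q. rep ((a * b) \<odot> u) x = rep (a \<odot> (b \<odot> u)) x"
      using rep_smult[OF smult_carrier[OF u], of a b] rep_smult[OF u, of "a * b"]
        rep_smult[OF u, of b]
      by eventually_elim simp
  qed (use u smult_carrier in auto)
  then show "(a \<otimes>\<^bsub>ring_of_type_algebra\<^esub> b) \<odot> u = a \<odot> (b \<odot> u)"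
    by (simp add: ring_of_type_algebra_def)
next
  fix a :: 'k and u v assume uv: "u \<in> carrier V" "v \<in> carrier V"
  show "a \<odot> (u \<oplus> v) = a \<odot> u \<oplus> a \<odot> v"
  proof (rule rep_inj)
    show "AE x in Q. rep (a \<odot> (u \<oplus> v)) x = rep (a \<odot> u \<oplus> a \<odot> v) x"
      using rep_smult[OF add_carrier[OF uv], of a]
        rep_add[OF smult_carrier[OF uv(1), of a] smult_carrier[OF uv(2), of a]]
        rep_add[OF uv] rep_smult[OF uv(1), of a] rep_smult[OF uv(2), of a]
      by eventually_elim (simp add: distrib_left)
  qed (use uv smult_carrier add_carrier in auto)
next
  fix u assume u: "u \<in> carrier V"
  have "1 \<odot> u = u"
    by (rule rep_inj) (use u smult_carrier rep_smult[OF u, of 1] in auto)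
  then show "\<one>\<^bsub>ring_of_type_algebra\<^esub> \<odot> u = u"
    by (simp add: ring_of_type_algebra_def)
qed (use smult_carrier in auto)

sublocale V: Module.module "ring_of_type_algebra :: 'k ring" V
  by (rule module)

lemma vector_sp: "vector_sp V"
  unfolding vector_sp_def by (rule module)

lemma rep_diff:
  assumes u: "u \<in> carrier V" and v: "v \<in> carrier V"
  shows "AE x in Q. rep (u \<ominus> v) x = rep u x - rep v x"
proof -
  \<comment> \<open>\<open>\<ominus>\<close> comes from the abstract group inverse, about which
    \<open>rep\<close> says nothing; the difference is read off from this identity.\<close>
  have "u \<ominus> v \<oplus> v = u"
    using u v by (simp add: V.M.minus_eq V.M.a_assoc V.M.l_neg)
  with rep_add[OF V.M.minus_closed[OF u v] v] have "AE x in Q. rep u x = rep (u \<ominus> v) x + rep v x"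
    by simp
  then show ?thesis by eventually_elim simp
qed

text \<open>This metrises convergence in measure; the truncation keeps it finite for functions that
  are not integrable.\<close>

definition trunc_dist :: "'u \<Rightarrow> 'u \<Rightarrow> real" where
  "trunc_dist u v = (\<integral>x. min 1 (norm (rep u x - rep v x)) \<partial>Q)"

lemma integrable_trunc [simp, intro]:
  fixes f :: "'a \<Rightarrow> 'k"
  assumes "f \<in> borel_measurable Q"
  shows "integrable Q (\<lambda>x. min 1 (norm (f x)))"
  by (rule integrable_const_bound[where B = 1]) (use assms in auto)

lemma trunc_dist_metric: "Metric_space (carrier V) trunc_dist"
proof
  fix u v
  show "0 \<le> trunc_dist u v"
    by (simp add: trunc_dist_def)
  show "trunc_dist u v = trunc_dist v u"
    unfolding trunc_dist_def by (subst norm_minus_commute) (rule refl)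
next
  fix u v assume uv [measurable]: "u \<in> carrier V" "v \<in> carrier V"
  have "trunc_dist u v = 0 \<longleftrightarrow> (AE x in Q. min 1 (norm (rep u x - rep v x)) = 0)"
    unfolding trunc_dist_def by (rule integral_nonneg_eq_0_iff_AE) auto
  also have "\<dots> \<longleftrightarrow> (AE x in Q. rep u x = rep v x)"
    by (intro AE_cong) (auto simp: min_def)
  also have "\<dots> \<longleftrightarrow> u = v"
    using rep_inj uv by auto
  finally show "trunc_dist u v = 0 \<longleftrightarrow> u = v" .
next
  fix u v w assume [measurable]: "u \<in> carrier V" "v \<in> carrier V" "w \<in> carrier V"
  have "trunc_dist u w
      \<le> (\<integral>x. min 1 (norm (rep u x - rep v x)) + min 1 (norm (rep v x - rep w x)) \<partial>Q)"
    unfolding trunc_dist_def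
  proof (rule integral_mono)
    fix x
    have "norm (rep u x - rep w x) \<le> norm (rep u x - rep v x) + norm (rep v x - rep w x)"
      using norm_triangle_ineq[of "rep u x - rep v x" "rep v x - rep w x"] by simp
    then show "min 1 (norm (rep u x - rep w x))
        \<le> min 1 (norm (rep u x - rep v x)) + min 1 (norm (rep v x - rep w x))"
      by (rule min_1_subadd) auto
  qed auto
  also have "\<dots> = trunc_dist u v + trunc_dist v w"
    unfolding trunc_dist_def by (rule Bochner_Integration.integral_add) auto
  finally show "trunc_dist u w \<le> trunc_dist u v + trunc_dist v w" .
qed

sublocale td: Metric_space "carrier V" trunc_dist
  by (rule trunc_dist_metric)

lemma trunc_dist_add:
  assumes [measurable]: "u \<in> carrier V" "v \<in> carrier V" "u' \<in> carrier V" "v' \<in> carrier V"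
  shows "trunc_dist (u \<oplus> v) (u' \<oplus> v') \<le> trunc_dist u u' + trunc_dist v v'"
proof -
  note [measurable] = add_carrier[OF assms(1,2)] add_carrier[OF assms(3,4)]
  have "trunc_dist (u \<oplus> v) (u' \<oplus> v')
      \<le> (\<integral>x. min 1 (norm (rep u x - rep u' x)) + min 1 (norm (rep v x - rep v' x)) \<partial>Q)"
    unfolding trunc_dist_def
  proof (rule integral_mono_AE)
    show "AE x in Q. min 1 (norm (rep (u \<oplus> v) x - rep (u' \<oplus> v') x))
        \<le> min 1 (norm (rep u x - rep u' x)) + min 1 (norm (rep v x - rep v' x))"
      using rep_add[OF assms(1,2)] rep_add[OF assms(3,4)]
    proof eventually_elim
      case (elim x)
      have "norm (rep (u \<oplus> v) x - rep (u' \<oplus> v') x)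
          \<le> norm (rep u x - rep u' x) + norm (rep v x - rep v' x)"
        unfolding elim by (rule norm_diff_triangle_ineq)
      then show ?case by (rule min_1_subadd) auto
    qed
  qed auto
  also have "\<dots> = trunc_dist u u' + trunc_dist v v'"
    unfolding trunc_dist_def by (rule Bochner_Integration.integral_add) auto
  finally show ?thesis .
qed

text \<open>Split \<open>c * u - d * v = d * (u - v) + (c - d) * u\<close>. The factor is
  \<open>max 1 (norm d)\<close> because \<open>min 1 (k * r) \<le> k * min 1 r\<close> asks for
  \<open>k \<ge> 1\<close>. The last term stays an integral: \<open>rep u\<close> is merely
  measurable, so there is in general no bound linear in \<open>norm (c - d)\<close>, and
  \<open>trunc_small\<close> takes care of it.\<close>

lemma trunc_dist_smult:
  assumes [measurable]: "u \<in> carrier V" "v \<in> carrier V"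
  shows "trunc_dist (c \<odot> u) (d \<odot> v)
      \<le> max 1 (norm d) * trunc_dist u v + (\<integral>x. min 1 (norm ((c - d) * rep u x)) \<partial>Q)"
proof -
  note [measurable] = smult_carrier[OF assms(1)] smult_carrier[OF assms(2)]
  have "trunc_dist (c \<odot> u) (d \<odot> v)
      \<le> (\<integral>x. max 1 (norm d) * min 1 (norm (rep u x - rep v x))
            + min 1 (norm ((c - d) * rep u x)) \<partial>Q)"
    unfolding trunc_dist_def
  proof (rule integral_mono_AE)
    show "AE x in Q. min 1 (norm (rep (c \<odot> u) x - rep (d \<odot> v) x))
        \<le> max 1 (norm d) * min 1 (norm (rep u x - rep v x)) + min 1 (norm ((c - d) * rep u x))"
      using rep_smult[OF assms(1), of c] rep_smult[OF assms(2), of d]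
    proof eventually_elim
      case (elim x)
      define r where "r = norm (rep u x - rep v x)"
      have "norm (c * rep u x - d * rep v x) = norm (d * (rep u x - rep v x) + (c - d) * rep u x)"
        by (simp add: algebra_simps)
      also have "\<dots> \<le> norm d * r + norm ((c - d) * rep u x)"
        unfolding r_def by (rule norm_triangle_le) (simp add: norm_mult)
      also have "norm d * r \<le> max 1 (norm d) * r"
        by (rule mult_right_mono) (auto simp: r_def)
      finally have *: "norm (c * rep u x - d * rep v x)
          \<le> max 1 (norm d) * r + norm ((c - d) * rep u x)" by simp
      have "min 1 (norm (c * rep u x - d * rep v x))
          \<le> min 1 (max 1 (norm d) * r) + min 1 (norm ((c - d) * rep u x))"
        by (rule min_1_subadd[OF *]) (auto simp: r_def)
      moreover have "min 1 (max 1 (norm d) * r) \<le> max 1 (norm d) * min 1 r"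
        by (cases "r \<le> 1") (auto simp: min_def)
      ultimately show ?case
        unfolding elim r_def[symmetric] by linarith
    qed
  qed auto
  also have "\<dots> = max 1 (norm d) * trunc_dist u v + (\<integral>x. min 1 (norm ((c - d) * rep u x)) \<partial>Q)"
    unfolding trunc_dist_def by (subst Bochner_Integration.integral_add) auto
  finally show ?thesis .
qed

text \<open>Dominated convergence along the multipliers \<open>1 / (n + 1)\<close>; the integrand
  grows with \<open>norm c\<close>, so one small multiplier settles all smaller scalars.\<close>

lemma trunc_small:
  fixes f :: "'a \<Rightarrow> 'k"
  assumes [measurable]: "f \<in> borel_measurable Q" and "e > 0"
  shows "\<exists>\<eta>>0. \<forall>c::'k. norm c < \<eta> \<longrightarrow> (\<integral>x. min 1 (norm (c * f x)) \<partial>Q) < e"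
proof -
  have "(\<lambda>n. \<integral>x. min 1 (inverse (real (Suc n)) * norm (f x)) \<partial>Q) \<longlonglongrightarrow> (\<integral>x. 0 \<partial>Q)"
  proof (rule integral_dominated_convergence[where w = "\<lambda>_. 1"])
    show "AE x in Q. (\<lambda>n. min 1 (inverse (real (Suc n)) * norm (f x))) \<longlonglongrightarrow> 0"
    proof (rule AE_I2)
      fix x
      have "(\<lambda>n. min 1 (inverse (real (Suc n)) * norm (f x))) \<longlonglongrightarrow> min 1 (0 * norm (f x))"
        by (intro tendsto_intros LIMSEQ_inverse_real_of_nat)
      then show "(\<lambda>n. min 1 (inverse (real (Suc n)) * norm (f x))) \<longlonglongrightarrow> 0" by simp
    qed
  qed auto
  then have "\<forall>\<^sub>F n in sequentially. (\<integral>x. min 1 (inverse (real (Suc n)) * norm (f x)) \<partial>Q) < e"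
    using \<open>e > 0\<close> by (simp add: order_tendstoD(2))
  then obtain n where n: "(\<integral>x. min 1 (inverse (real (Suc n)) * norm (f x)) \<partial>Q) < e"
    by (auto simp: eventually_sequentially)
  have "(\<integral>x. min 1 (norm (c * f x)) \<partial>Q) < e" if "norm c < inverse (real (Suc n))" for c
  proof -
    have "(\<integral>x. min 1 (norm (c * f x)) \<partial>Q)
        \<le> (\<integral>x. min 1 (inverse (real (Suc n)) * norm (f x)) \<partial>Q)"
    proof (rule integral_mono)
      show "integrable Q (\<lambda>x. min 1 (inverse (real (Suc n)) * norm (f x)))"
        by (rule integrable_const_bound[where B = 1]) auto
      show "min 1 (norm (c * f x)) \<le> min 1 (inverse (real (Suc n)) * norm (f x))" for x
        by (rule min.mono) (use that in \<open>auto simp: norm_mult intro!: mult_right_mono\<close>)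
    qed auto
    with n show ?thesis by linarith
  qed
  then show ?thesis by (intro exI[of _ "inverse (real (Suc n))"]) auto
qed

lemma hausdorff_tvs: "hausdorff_tvs V td.mtopology"
  unfolding hausdorff_tvs_def
proof (intro conjI)
  show "vector_sp V" by (rule vector_sp)
  show "Hausdorff_space td.mtopology" by (rule td.Hausdorff_space_mtopology)
  show "continuous_map (prod_topology td.mtopology td.mtopology) td.mtopology (\<lambda>(x, y). x \<oplus> y)"
    unfolding td.continuous_map_to_metric
  proof (intro ballI allI impI)
    fix p and e :: real
    assume "p \<in> topspace (prod_topology td.mtopology td.mtopology)" and e: "e > 0"
    then obtain u v where p: "p = (u, v)" and uv: "u \<in> carrier V" "v \<in> carrier V" by auto
    show "\<exists>U. openin (prod_topology td.mtopology td.mtopology) U \<and> p \<in> U \<and>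
        (\<forall>q\<in>U. (case q of (x, y) \<Rightarrow> x \<oplus> y) \<in> td.mball (case p of (x, y) \<Rightarrow> x \<oplus> y) e)"
    proof (intro exI conjI)
      show "openin (prod_topology td.mtopology td.mtopology) (td.mball u (e/2) \<times> td.mball v (e/2))"
        by (simp add: openin_prod_Times_iff)
      show "p \<in> td.mball u (e/2) \<times> td.mball v (e/2)"
        using uv e by (simp add: p)
      show "\<forall>q\<in>td.mball u (e/2) \<times> td.mball v (e/2).
          (case q of (x, y) \<Rightarrow> x \<oplus> y) \<in> td.mball (case p of (x, y) \<Rightarrow> x \<oplus> y) e"
      proof (rule ballI)
        fix q assume "q \<in> td.mball u (e/2) \<times> td.mball v (e/2)"
        then obtain x y where q: "q = (x, y)" and x: "x \<in> carrier V" "trunc_dist u x < e/2"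
          and y: "y \<in> carrier V" "trunc_dist v y < e/2" by auto
        have "trunc_dist (u \<oplus> v) (x \<oplus> y) < e"
          using trunc_dist_add[OF uv x(1) y(1)] x(2) y(2) by linarith
        then show "(case q of (x, y) \<Rightarrow> x \<oplus> y) \<in> td.mball (case p of (x, y) \<Rightarrow> x \<oplus> y) e"
          unfolding p q using uv x(1) y(1) by (simp add: add_carrier)
      qed
    qed
  qed
  show "continuous_map (prod_topology euclidean td.mtopology) td.mtopology (\<lambda>(c, x). c \<odot> x)"
    unfolding td.continuous_map_to_metric
  proof (intro ballI allI impI)
    fix p and e :: real
    assume "p \<in> topspace (prod_topology (euclidean :: 'k topology) td.mtopology)" and e: "e > 0"
    then obtain c u where p: "p = (c, u)" and u: "u \<in> carrier V" by auto
    obtain \<eta> where \<eta>: "\<eta> > 0" "\<And>b::'k. norm b < \<eta> \<Longrightarrow> (\<integral>x. min 1 (norm (b * rep u x)) \<partial>Q) < e / 2"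
      using trunc_small[OF rep_measurable[OF u], of "e/2"] e by auto
    \<comment> \<open>\<open>z\<close> bounds \<open>max 1 (norm d)\<close> for every
      \<open>d\<close> within \<open>\<eta>\<close> of \<open>c\<close>. The radius \<open>r\<close>
      thus spends half of \<open>e\<close>, and the choice of \<open>\<eta>\<close> the other
      half.\<close>
    define z where "z = 1 + norm c + \<eta>"
    define r where "r = e / 2 / z"
    have pos: "z > 0" unfolding z_def using \<eta>(1) norm_ge_zero[of c] by linarith
    have r: "r > 0" unfolding r_def using e pos by simp
    show "\<exists>U. openin (prod_topology euclidean td.mtopology) U \<and> p \<in> U \<and>
        (\<forall>q\<in>U. (case q of (d, x) \<Rightarrow> d \<odot> x) \<in> td.mball (case p of (d, x) \<Rightarrow> d \<odot> x) e)"
    proof (intro exI conjI)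
      show "openin (prod_topology euclidean td.mtopology) (ball c \<eta> \<times> td.mball u r)"
        by (simp add: openin_prod_Times_iff)
      show "p \<in> ball c \<eta> \<times> td.mball u r"
        using u \<eta> r by (simp add: p)
      show "\<forall>q\<in>ball c \<eta> \<times> td.mball u r.
          (case q of (d, x) \<Rightarrow> d \<odot> x) \<in> td.mball (case p of (d, x) \<Rightarrow> d \<odot> x) e"
      proof (rule ballI)
        fix q assume "q \<in> ball c \<eta> \<times> td.mball u r"
        then obtain d x where q: "q = (d, x)" and d: "dist c d < \<eta>"
          and x: "x \<in> carrier V" "trunc_dist u x < r" by auto
        have nd: "max 1 (norm d) \<le> z"
          unfolding z_def using d norm_triangle_ineq3[of c d] norm_ge_zero[of c] \<eta>(1) by (simp add: dist_norm)
        have "max 1 (norm d) * trunc_dist u x \<le> z * r"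
          using nd x(2) by (intro mult_mono) (auto simp: trunc_dist_def less_imp_le pos)
        also have "\<dots> = e / 2" using pos by (simp add: r_def)
        finally have "max 1 (norm d) * trunc_dist u x \<le> e / 2" .
        moreover have "(\<integral>y. min 1 (norm ((c - d) * rep u y)) \<partial>Q) < e / 2"
          by (rule \<eta>(2)) (use d in \<open>simp add: dist_norm\<close>)
        ultimately have "trunc_dist (c \<odot> u) (d \<odot> x) < e"
          using trunc_dist_smult[OF u x(1), of c d] by linarith
        then show "(case q of (d, x) \<Rightarrow> d \<odot> x) \<in> td.mball (case p of (d, x) \<Rightarrow> d \<odot> x) e"
          unfolding p q using smult_carrier[OF x(1)] smult_carrier[OF u] by simp
      qed
    qed
  qed
qed simp

end

section \<open>Banach spaces given by gauges\<close>

text \<open>\<open>Adm f c\<close> plays the role of \<open>\<parallel>f\<parallel> \<le> c\<close>; only strict upper bounds of the norm need to be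
  admissible.\<close>

locale gauge = prob_space Q
  for Q :: "'a measure" +
  fixes Adm :: "('a \<Rightarrow> 'k::{real_normed_field, euclidean_space}) \<Rightarrow> real \<Rightarrow> bool"
  assumes adm_zero: "0 < c \<Longrightarrow> Adm (\<lambda>_. 0) c"
    and adm_mono: "Adm f c \<Longrightarrow> 0 < c \<Longrightarrow> c \<le> d \<Longrightarrow> Adm f d"
    and adm_smult: "Adm f c \<Longrightarrow> 0 < c \<Longrightarrow> a \<noteq> 0 \<Longrightarrow> Adm (\<lambda>x. a * f x) (norm a * c)"
    and adm_add: "f \<in> borel_measurable Q \<Longrightarrow> g \<in> borel_measurable Q \<Longrightarrow> Adm f c \<Longrightarrow> Adm g d \<Longrightarrow>
      0 < c \<Longrightarrow> 0 < d \<Longrightarrow> Adm (\<lambda>x. f x + g x) (c + d)"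
    and adm_L1: "f \<in> borel_measurable Q \<Longrightarrow> Adm f c \<Longrightarrow> 0 < c \<Longrightarrow>
      (\<integral>\<^sup>+x. ennreal (norm (f x)) \<partial>Q) \<le> ennreal c"
    and adm_Fatou: "(\<And>n. h n \<in> borel_measurable Q) \<Longrightarrow> g \<in> borel_measurable Q \<Longrightarrow>
      AE x in Q. (\<lambda>n. h n x) \<longlonglongrightarrow> g x \<Longrightarrow> (\<And>n. Adm (h n) c) \<Longrightarrow> 0 < c \<Longrightarrow> Adm g c"
begin

text \<open>Invariance under almost everywhere equality is the Fatou property of a constant
  sequence.\<close>

lemma adm_cong:
  assumes "f \<in> borel_measurable Q" "g \<in> borel_measurable Q" "AE x in Q. f x = g x" "Adm f c" "0 < c"
  shows "Adm g c"
  by (rule adm_Fatou[of "\<lambda>_. f"]) (use assms in auto)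

end

locale gauge_space = L0_model Q V rep + gauge Q Adm
  for Q :: "'a measure"
    and V :: "('k::{real_normed_field, euclidean_space}, 'u) module" (structure)
    and rep :: "'u \<Rightarrow> 'a \<Rightarrow> 'k"
    and Adm :: "('a \<Rightarrow> 'k) \<Rightarrow> real \<Rightarrow> bool" +
  fixes A :: "'u nspace"
  assumes pts_eq: "pts A = {u \<in> carrier V. \<exists>c>0. Adm (rep u) c}"
    and nrm_eq: "u \<in> pts A \<Longrightarrow> nrm A u = Inf {c. 0 < c \<and> Adm (rep u) c}"
begin

section \<open>Norm axioms\<close>

lemma pts_carrier: "u \<in> pts A \<Longrightarrow> u \<in> carrier V"
  by (simp add: pts_eq)

lemma adm_if_nrm_less:
  assumes "u \<in> pts A" "nrm A u < c"
  shows "Adm (rep u) c"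
proof -
  have "{c. 0 < c \<and> Adm (rep u) c} \<noteq> {}" using assms(1) by (auto simp: pts_eq)
  then obtain d where "0 < d" "Adm (rep u) d" "d < c"
    using cInf_lessD[of "{c. 0 < c \<and> Adm (rep u) c}" c] assms nrm_eq by auto
  then show ?thesis using adm_mono by simp
qed

lemma nrm_nonneg: "u \<in> pts A \<Longrightarrow> 0 \<le> nrm A u"
  by (subst nrm_eq) (auto simp: pts_eq intro!: cInf_greatest)

lemma pts_nrm_le_if_adm:
  assumes "u \<in> carrier V" "0 < c" "Adm (rep u) c"
  shows "u \<in> pts A" "nrm A u \<le> c"
proof -
  show u: "u \<in> pts A" using assms by (auto simp: pts_eq)
  show "nrm A u \<le> c"
    unfolding nrm_eq[OF u] by (rule cInf_lower) (use assms in \<open>auto intro!: bdd_belowI[of _ 0]\<close>)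
qed

lemma pts_nrm_leI:
  assumes u: "u \<in> carrier V" and "0 \<le> c" and *: "\<And>d. c < d \<Longrightarrow> Adm (rep u) d"
  shows "u \<in> pts A" "nrm A u \<le> c"
proof -
  show "u \<in> pts A" by (rule pts_nrm_le_if_adm(1)[of u "c + 1"]) (use assms in auto)
  show "nrm A u \<le> c"
    by (rule dense_ge) (use pts_nrm_le_if_adm(2)[OF u] * \<open>0 \<le> c\<close> in auto)
qed

lemma adm_rep_cong:
  assumes "u \<in> carrier V" "f \<in> borel_measurable Q" "AE x in Q. rep u x = f x" "Adm f c" "0 < c"
  shows "Adm (rep u) c"
  by (rule adm_cong[of f]) (use assms in \<open>auto simp: eq_commute\<close>)

lemma pts_zero: "\<zero> \<in> pts A" and nrm_zero: "nrm A \<zero> = 0"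
proof -
  have *: "Adm (rep \<zero>) c" if "0 < c" for c
    by (rule adm_rep_cong[OF zero_carrier]) (use that rep_zero adm_zero in auto)
  show 0: "\<zero> \<in> pts A" by (rule pts_nrm_leI(1)[of _ 0]) (use * zero_carrier in auto)
  show "nrm A \<zero> = 0"
    using pts_nrm_leI(2)[of \<zero> 0] * zero_carrier nrm_nonneg[OF 0] by force
qed

lemma pts_add:
  assumes u: "u \<in> pts A" and v: "v \<in> pts A"
  shows "u \<oplus> v \<in> pts A" "nrm A (u \<oplus> v) \<le> nrm A u + nrm A v"
proof -
  note c [measurable] = pts_carrier[OF u] pts_carrier[OF v]
  have *: "Adm (rep (u \<oplus> v)) d" if d: "nrm A u + nrm A v < d" for d
  proof -
    define e where "e = (d - nrm A u - nrm A v) / 2"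
    have e: "0 < e" using d by (simp add: e_def)
    have "Adm (\<lambda>x. rep u x + rep v x) ((nrm A u + e) + (nrm A v + e))"
      by (rule adm_add) (use e u v nrm_nonneg[OF u] nrm_nonneg[OF v] adm_if_nrm_less in auto)
    also have "(nrm A u + e) + (nrm A v + e) = d" by (simp add: e_def field_simps)
    finally show ?thesis
      by (intro adm_rep_cong[OF add_carrier[OF c] _ rep_add[OF c]])
        (use d nrm_nonneg[OF u] nrm_nonneg[OF v] in auto)
  qed
  show "u \<oplus> v \<in> pts A" "nrm A (u \<oplus> v) \<le> nrm A u + nrm A v"
    by (rule pts_nrm_leI; use * c add_carrier nrm_nonneg[OF u] nrm_nonneg[OF v] in auto)+
qed

lemma pts_smult_le:
  assumes u: "u \<in> pts A"
  shows "a \<odot> u \<in> pts A \<and> nrm A (a \<odot> u) \<le> norm a * nrm A u"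
proof (cases "a = 0")
  case True
  have "a \<odot> u = \<zero>"
    using V.smult_l_null[OF pts_carrier[OF u]] by (simp add: True ring_of_type_algebra_def)
  then show ?thesis by (simp add: pts_zero nrm_zero True)
next
  case False
  note c [measurable] = pts_carrier[OF u]
  have "Adm (rep (a \<odot> u)) d" if d: "norm a * nrm A u < d" for d
  proof -
    have "nrm A u < d / norm a" using d False by (simp add: field_simps)
    then have "Adm (\<lambda>x. a * rep u x) (norm a * (d / norm a))"
      by (intro adm_smult adm_if_nrm_less u) (use False nrm_nonneg[OF u] in auto)
    then have "Adm (\<lambda>x. a * rep u x) d" using False by simp
    then show ?thesis
      by (intro adm_rep_cong[OF smult_carrier[OF c] _ rep_smult[OF c]])
        (use d nrm_nonneg[OF u] in \<open>auto intro: le_less_trans[rotated]\<close>)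
  qed
  then show ?thesis
    using pts_nrm_leI[OF smult_carrier[OF c], of "norm a * nrm A u" a] nrm_nonneg[OF u] by auto
qed

lemma nrm_smult:
  assumes u: "u \<in> pts A"
  shows "nrm A (a \<odot> u) = norm a * nrm A u"
proof (cases "a = 0")
  case True
  then show ?thesis using pts_smult_le[OF u, of a] nrm_nonneg[of "a \<odot> u"] by auto
next
  case False
  \<comment> \<open>The inequality for the inverse scalar yields the reverse inequality for
    \<open>a\<close>.\<close>
  have "inverse a \<odot> (a \<odot> u) = u"
    using V.smult_assoc1[of "inverse a" a u] V.smult_one[of u] pts_carrier[OF u] False
    by (simp add: ring_of_type_algebra_def)
  then have "nrm A u \<le> norm (inverse a) * nrm A (a \<odot> u)"
    using pts_smult_le[of "a \<odot> u" "inverse a"] pts_smult_le[OF u, of a] by simp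
  then have "norm a * nrm A u \<le> nrm A (a \<odot> u)"
    using False by (simp add: norm_inverse pos_le_divide_eq mult.commute flip: divide_inverse_commute)
  then show ?thesis using pts_smult_le[OF u, of a] by simp
qed

lemma nn_integral_rep_le:
  assumes u: "u \<in> pts A"
  shows "(\<integral>\<^sup>+x. ennreal (norm (rep u x)) \<partial>Q) \<le> ennreal (nrm A u)"
proof (rule ennreal_le_epsilon)
  fix e :: real assume "0 < e"
  then have "(\<integral>\<^sup>+x. ennreal (norm (rep u x)) \<partial>Q) \<le> ennreal (nrm A u + e)"
    by (intro adm_L1 adm_if_nrm_less u rep_measurable pts_carrier)
      (use nrm_nonneg[OF u] in auto)
  then show "(\<integral>\<^sup>+x. ennreal (norm (rep u x)) \<partial>Q) \<le> ennreal (nrm A u) + ennreal e"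
    using nrm_nonneg[OF u] \<open>0 < e\<close> by simp
qed

lemma integrable_rep [simp, intro]: "u \<in> pts A \<Longrightarrow> integrable Q (rep u)"
  using nn_integral_rep_le[of u]
  by (intro integrableI_bounded rep_measurable pts_carrier) (auto intro: le_less_trans)

lemma integral_rep_le:
  assumes u: "u \<in> pts A"
  shows "(\<integral>x. norm (rep u x) \<partial>Q) \<le> nrm A u"
proof -
  have "ennreal (\<integral>x. norm (rep u x) \<partial>Q) \<le> ennreal (nrm A u)"
    using nn_integral_rep_le[OF u] u by (subst nn_integral_eq_integral[symmetric]) auto
  then show ?thesis using nrm_nonneg[OF u] by simp
qed

text \<open>Definiteness is inherited from the dominated \<open>L\<^sub>1\<close> integral, and
  \<open>rep_inj\<close> turns vanishing almost everywhere into equality of points.\<close>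

lemma nrm_eq_0_iff:
  assumes u: "u \<in> pts A"
  shows "nrm A u = 0 \<longleftrightarrow> u = \<zero>"
proof
  assume "nrm A u = 0"
  then have "(\<integral>\<^sup>+x. ennreal (norm (rep u x)) \<partial>Q) = 0"
    using nn_integral_rep_le[OF u] by simp
  then have "AE x in Q. ennreal (norm (rep u x)) = 0"
    using rep_measurable[OF pts_carrier[OF u]] by (subst (asm) nn_integral_0_iff_AE) auto
  then have "AE x in Q. rep u x = rep \<zero> x"
    using rep_zero by eventually_elim simp
  then show "u = \<zero>" using u zero_carrier by (intro rep_inj) (auto simp: pts_carrier)
qed (simp add: nrm_zero)

lemma minus_eq_smult: "u \<in> carrier V \<Longrightarrow> \<ominus> u = (-1) \<odot> u"
proof -
  assume u: "u \<in> carrier V"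
  have "\<ominus>\<^bsub>ring_of_type_algebra\<^esub> (1::'k) = -1"
    by (rule V.R.minus_equality[of "-1" 1]) (auto simp: ring_of_type_algebra_def)
  then show ?thesis
    using V.smult_l_minus[of 1 u] V.smult_one[OF u] u by (simp add: ring_of_type_algebra_def)
qed

lemma pts_minus: "u \<in> pts A \<Longrightarrow> \<ominus> u \<in> pts A"
  using minus_eq_smult[OF pts_carrier] pts_smult_le by simp

lemma pts_diff: "u \<in> pts A \<Longrightarrow> v \<in> pts A \<Longrightarrow> u \<ominus> v \<in> pts A"
  by (simp add: V.M.minus_eq pts_add pts_minus)

lemma normed_in: "normed_in V A"
  unfolding normed_in_def
  using pts_carrier pts_zero pts_minus pts_add pts_smult_le nrm_nonneg nrm_eq_0_iff nrm_smult
  by (auto intro!: V.submoduleI)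

lemma ndist_metric: "Metric_space (pts A) (ndist V A)"
proof
  fix u v
  show "0 \<le> ndist V A u v" by (simp add: ndist_def nrm_nonneg pts_diff)
  show "ndist V A u v = ndist V A v u"
  proof (cases "u \<in> pts A \<and> v \<in> pts A")
    case True
    then have "v \<ominus> u = \<ominus> (u \<ominus> v)"
      using pts_carrier[of u] pts_carrier[of v]
      by (simp add: V.M.minus_eq V.M.minus_add V.M.minus_minus V.M.a_comm)
    also have "\<dots> = (-1) \<odot> (u \<ominus> v)"
      using True by (intro minus_eq_smult pts_carrier pts_diff) auto
    finally show ?thesis
      using True nrm_smult[OF pts_diff, of u v "-1"] by (simp add: ndist_def)
  qed (auto simp: ndist_def)
next
  fix u v assume uv: "u \<in> pts A" "v \<in> pts A"
  note c = uv[THEN pts_carrier]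
  have "u = v" if "u \<ominus> v = \<zero>"
  proof (rule rep_inj[OF c])
    show "AE x in Q. rep u x = rep v x"
      using rep_diff[OF c] rep_zero unfolding that by eventually_elim simp
  qed
  then have "u \<ominus> v = \<zero> \<longleftrightarrow> u = v"
    using c by (auto simp: V.M.minus_eq V.M.r_neg)
  then show "ndist V A u v = 0 \<longleftrightarrow> u = v"
    using uv by (simp add: ndist_def nrm_eq_0_iff pts_diff)
next
  fix u v w assume uvw: "u \<in> pts A" "v \<in> pts A" "w \<in> pts A"
  note c = uvw[THEN pts_carrier]
  have "u \<ominus> w = (u \<ominus> v) \<oplus> (v \<ominus> w)"
  proof (rule rep_inj)
    show "AE x in Q. rep (u \<ominus> w) x = rep ((u \<ominus> v) \<oplus> (v \<ominus> w)) x"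
      using rep_add[OF V.M.minus_closed[OF c(1,2)] V.M.minus_closed[OF c(2,3)]]
        rep_diff[OF c(1,2)] rep_diff[OF c(2,3)] rep_diff[OF c(1,3)]
      by eventually_elim simp
  qed (use c in auto)
  then show "ndist V A u w \<le> ndist V A u v + ndist V A v w"
    using uvw pts_add(2)[OF pts_diff pts_diff] by (simp add: ndist_def)
qed

section \<open>Completeness and continuous embedding\<close>

sublocale nd: Metric_space "pts A" "ndist V A"
  by (rule ndist_metric)

text \<open>A Cauchy sequence has an almost everywhere convergent subsequence, because the norm dominates
  the \<open>L\<^sub>1\<close> norm; the Fatou property turns its limit into a limit in norm.\<close>

lemma mcomplete: "nd.mcomplete"
  unfolding nd.mcomplete_def
proof (intro allI impI)
  fix u assume "nd.MCauchy u"
  then have u: "\<And>n. u n \<in> pts A"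
    and cauchy: "\<And>e. e > 0 \<Longrightarrow> \<exists>N. \<forall>n m. N \<le> n \<longrightarrow> N \<le> m \<longrightarrow> ndist V A (u n) (u m) < e"
    unfolding nd.MCauchy_def by auto
  note c = u[THEN pts_carrier]
  note [measurable] = rep_measurable[OF c]
  have L1: "\<exists>N. \<forall>i\<ge>N. \<forall>j\<ge>N. (\<integral>x. norm (rep (u i) x - rep (u j) x) \<partial>Q) < e" if e: "e > 0" for e
  proof -
    obtain N where N: "\<And>n m. N \<le> n \<Longrightarrow> N \<le> m \<Longrightarrow> ndist V A (u n) (u m) < e"
      using cauchy[OF e] by blast
    have "(\<integral>x. norm (rep (u i) x - rep (u j) x) \<partial>Q) < e" if "i \<ge> N" "j \<ge> N" for i j
    proof -
      have "(\<integral>x. norm (rep (u i) x - rep (u j) x) \<partial>Q) = (\<integral>x. norm (rep (u i \<ominus> u j) x) \<partial>Q)"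
        using rep_diff[OF c c, of i j] rep_measurable[OF V.M.minus_closed[OF c c], of i j]
        by (intro integral_cong_AE) auto
      also have "\<dots> \<le> nrm A (u i \<ominus> u j)"
        by (intro integral_rep_le pts_diff u)
      also have "\<dots> < e" using N[OF that] u by (simp add: ndist_def)
      finally show ?thesis .
    qed
    then show ?thesis by blast
  qed
  obtain r where r: "strict_mono r" and "AE x in Q. Cauchy (\<lambda>i. rep (u (r i)) x)"
    by (rule cauchy_L1_AE_cauchy_subseq[of Q "\<lambda>n. rep (u n)"]) (use L1 u in auto)
  then have lim: "AE x in Q. (\<lambda>i. rep (u (r i)) x) \<longlonglongrightarrow> lim (\<lambda>i. rep (u (r i)) x)"
    by (auto simp: Cauchy_convergent_iff convergent_LIMSEQ_iff)
  \<comment> \<open>On the null set without convergence \<open>lim\<close> has an unspecified value,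
    which does not affect measurability.\<close>
  have [measurable]: "(\<lambda>x. lim (\<lambda>i. rep (u (r i)) x)) \<in> borel_measurable Q"
    by (rule borel_measurable_lim_metric) auto
  obtain w where w: "w \<in> carrier V" and rep_w: "AE x in Q. rep w x = lim (\<lambda>i. rep (u (r i)) x)"
    using rep_surj[of "\<lambda>x. lim (\<lambda>i. rep (u (r i)) x)"] by auto
  \<comment> \<open>\<open>w\<close> is not yet known to lie in the space, so membership of the
    differences is proved together with the bound;
    \<open>w = u n \<ominus> (u n \<ominus> w)\<close> then places it there.\<close>
  have tail: "\<exists>N. \<forall>n\<ge>N. u n \<ominus> w \<in> pts A \<and> nrm A (u n \<ominus> w) \<le> e" if "e > 0" for e
  proof -
    obtain N where N: "\<And>n m. N \<le> n \<Longrightarrow> N \<le> m \<Longrightarrow> ndist V A (u n) (u m) < e"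
      using cauchy[OF \<open>e > 0\<close>] by blast
    \<comment> \<open>The shift by \<open>N\<close> puts every index \<open>r (k + N)\<close> into
      the Cauchy tail, so that all terms of the sequence fed to the Fatou property are admissible
      for \<open>e\<close>.\<close>
    have "Adm (rep (u n \<ominus> w)) e" if "n \<ge> N" for n
    proof (rule adm_Fatou[where h = "\<lambda>k. rep (u n \<ominus> u (r (k + N)))"])
      show "rep (u n \<ominus> u (r (k + N))) \<in> borel_measurable Q" for k
        by (intro rep_measurable V.M.minus_closed c)
      show "rep (u n \<ominus> w) \<in> borel_measurable Q"
        by (intro rep_measurable V.M.minus_closed c w)
      have "AE x in Q. \<forall>k. rep (u n \<ominus> u (r (k + N))) x = rep (u n) x - rep (u (r (k + N))) x"
        using rep_diff[OF c c] by (simp add: AE_all_countable)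
      then show "AE x in Q. (\<lambda>k. rep (u n \<ominus> u (r (k + N))) x) \<longlonglongrightarrow> rep (u n \<ominus> w) x"
        using lim rep_w rep_diff[OF c w, of n]
      proof eventually_elim
        case (elim x)
        have "(\<lambda>k. rep (u n) x - rep (u (r (k + N))) x) \<longlonglongrightarrow> rep (u n) x - rep w x"
          using LIMSEQ_ignore_initial_segment[OF elim(2), of N]
          by (intro tendsto_intros) (simp add: elim(3))
        then show ?case by (simp add: elim(1,4))
      qed
      show "Adm (rep (u n \<ominus> u (r (k + N)))) e" for k
      proof (rule adm_if_nrm_less)
        have "N \<le> r (k + N)" using seq_suble[OF r, of "k + N"] by linarith
        then show "nrm A (u n \<ominus> u (r (k + N))) < e"
          using N[OF that] u by (simp add: ndist_def)
      qed (intro pts_diff u)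
    qed (rule \<open>e > 0\<close>)
    then show ?thesis
      using pts_nrm_le_if_adm[OF V.M.minus_closed[OF c w] \<open>e > 0\<close>] by blast
  qed
  have w_pts: "w \<in> pts A"
  proof -
    obtain n where n: "u n \<ominus> w \<in> pts A" using tail[of 1] by auto
    have "u n \<ominus> (u n \<ominus> w) = w"
    proof (rule rep_inj)
      show "AE x in Q. rep (u n \<ominus> (u n \<ominus> w)) x = rep w x"
        using rep_diff[OF c V.M.minus_closed[OF c w], of n n] rep_diff[OF c w, of n]
        by eventually_elim simp
    qed (use c w in auto)
    then show ?thesis using pts_diff[OF u[of n] n] by simp
  qed
  have "limitin nd.mtopology u w sequentially"
    unfolding nd.limitin_metric
  proof (intro conjI allI impI w_pts)
    fix e :: real assume "e > 0"
    then obtain N where "\<forall>n\<ge>N. nrm A (u n \<ominus> w) \<le> e / 2" using tail[of "e/2"] by auto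
    then have "\<forall>n\<ge>N. u n \<in> pts A \<and> ndist V A (u n) w < e"
      using \<open>e > 0\<close> u w_pts by (force simp: ndist_def)
    then show "\<forall>\<^sub>F n in sequentially. u n \<in> pts A \<and> ndist V A (u n) w < e"
      by (auto simp: eventually_sequentially)
  qed
  then show "\<exists>w. limitin nd.mtopology u w sequentially" by blast
qed

lemma banach_in: "banach_in V A"
  unfolding banach_in_def using normed_in mcomplete by simp

text \<open>The embedding is 1-Lipschitz: truncation only decreases the \<open>L\<^sub>1\<close>
  integral, which the norm dominates.\<close>

lemma cont_embedded: "cont_embedded V td.mtopology A"
proof -
  have le: "trunc_dist u v \<le> ndist V A u v" if "u \<in> pts A" "v \<in> pts A" for u v
  proof -
    note c = that[THEN pts_carrier]
    note [measurable] = rep_measurable[OF c(1)] rep_measurable[OF c(2)]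
      rep_measurable[OF V.M.minus_closed[OF c]]
    have "trunc_dist u v \<le> (\<integral>x. norm (rep (u \<ominus> v) x) \<partial>Q)"
      unfolding trunc_dist_def
    proof (rule integral_mono_AE)
      show "integrable Q (\<lambda>x. norm (rep (u \<ominus> v) x))"
        by (intro integrable_norm integrable_rep pts_diff that)
      show "AE x in Q. min 1 (norm (rep u x - rep v x)) \<le> norm (rep (u \<ominus> v) x)"
        using rep_diff[OF c] by eventually_elim simp
    qed auto
    also have "\<dots> \<le> ndist V A u v"
      using integral_rep_le[OF pts_diff[OF that]] that by (simp add: ndist_def)
    finally show ?thesis .
  qed
  show ?thesis
    unfolding cont_embedded_def nd.metric_continuous_map[OF trunc_dist_metric]
  proof (intro conjI ballI allI impI)
    show "id ` pts A \<subseteq> carrier V" using pts_carrier by auto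
    fix u and e :: real assume "u \<in> pts A" "0 < e"
    then show "\<exists>d>0. \<forall>x. x \<in> pts A \<and> ndist V A u x < d \<longrightarrow> trunc_dist (id u) (id x) < e"
      using le by (intro exI[of _ e]) (auto intro: le_less_trans)
  qed
qed

end

section \<open>Couples and operators between gauge spaces\<close>

lemma banach_couple_if_gauge_spaces:
  assumes 0: "gauge_space Q V rep Adm0 A0" and 1: "gauge_space Q V rep Adm1 A1"
  shows "banach_couple \<lparr>amb = V, sp0 = A0, sp1 = A1\<rparr>"
proof -
  interpret A0: gauge_space Q V rep Adm0 A0 by (rule 0)
  interpret A1: gauge_space Q V rep Adm1 A1 by (rule 1)
  show ?thesis
    unfolding banach_couple_def
    using A0.banach_in A1.banach_in A0.hausdorff_tvs A0.cont_embedded A1.cont_embedded by auto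
qed

text \<open>The point \<open>z\<close> makes the set under the supremum non-empty; the real supremum
  of the empty set would carry no information.\<close>

lemma op_norm_leI:
  assumes "\<And>x. x \<in> pts A \<Longrightarrow> nrm B (T x) \<le> t * nrm A x"
    and "z \<in> pts A" "nrm A z \<le> 1" "0 \<le> t"
  shows "op_norm A B T \<le> t"
  unfolding op_norm_def
proof (rule cSup_least)
  show "{nrm B (T x) |x. x \<in> pts A \<and> nrm A x \<le> 1} \<noteq> {}" using assms by auto
  fix y assume "y \<in> {nrm B (T x) |x. x \<in> pts A \<and> nrm A x \<le> 1}"
  then obtain x where x: "y = nrm B (T x)" "x \<in> pts A" "nrm A x \<le> 1" by auto
  have "t * nrm A x \<le> t * 1" using x(3) \<open>0 \<le> t\<close> by (rule mult_left_mono)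
  with assms(1)[OF x(2)] x(1) show "y \<le> t" by simp
qed

text \<open>A norm need not itself be an admissible bound. Between \<open>nrm A u\<close> and
  \<open>d / t\<close> there is room for an admissible \<open>c\<close>, which is why
  \<open>adm\<close> may leave the strict gap \<open>t * c < d\<close>.\<close>

lemma gauge_space_op_bound:
  assumes A: "gauge_space Q V rep AdmA A" and B: "gauge_space R W rep' AdmB B"
    and T: "\<And>u. u \<in> carrier V \<Longrightarrow> T u \<in> carrier W" and t: "0 < t"
    and adm: "\<And>u c d. u \<in> carrier V \<Longrightarrow> AdmA (rep u) c \<Longrightarrow> 0 < c \<Longrightarrow> t * c < d \<Longrightarrow> AdmB (rep' (T u)) d"
  shows "bounded_op A B T" "op_norm A B T \<le> t"
proof -
  interpret A: gauge_space Q V rep AdmA A by (rule A)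
  interpret B: gauge_space R W rep' AdmB B by (rule B)
  have *: "T u \<in> pts B \<and> nrm B (T u) \<le> t * nrm A u" if u: "u \<in> pts A" for u
  proof -
    have "AdmB (rep' (T u)) d" if d: "t * nrm A u < d" for d
    proof -
      have "nrm A u < d / t" using d t by (simp add: field_simps)
      then obtain c where c: "nrm A u < c" "c < d / t" using dense by blast
      show ?thesis
        by (rule adm[OF A.pts_carrier[OF u] A.adm_if_nrm_less[OF u c(1)]])
          (use c(1) A.nrm_nonneg[OF u] c(2) t in \<open>auto simp: field_simps\<close>)
    qed
    then show ?thesis
      using B.pts_nrm_leI[OF T[OF A.pts_carrier[OF u]], of "t * nrm A u"] t A.nrm_nonneg[OF u]
      by auto
  qed
  show "bounded_op A B T" unfolding bounded_op_def using * by blast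
  show "op_norm A B T \<le> t"
    by (rule op_norm_leI[where z = "\<zero>\<^bsub>V\<^esub>"]) (use * t A.pts_zero A.nrm_zero in auto)
qed

section \<open>Tuples\<close>

lemma Inf_eq_gauge:
  fixes m :: real
  assumes "0 \<le> m" "\<And>d. m < d \<Longrightarrow> P d" "\<And>c. 0 < c \<Longrightarrow> P c \<Longrightarrow> m \<le> c"
  shows "Inf {c. 0 < c \<and> P c} = m"
proof (rule antisym)
  show "Inf {c. 0 < c \<and> P c} \<le> m"
    by (rule dense_ge, rule cInf_lower) (use assms in \<open>auto intro!: bdd_belowI[of _ 0]\<close>)
  have "m + 1 \<in> {c. 0 < c \<and> P c}" using assms by simp
  then have "{c. 0 < c \<and> P c} \<noteq> {}" by blast
  then show "m \<le> Inf {c. 0 < c \<and> P c}"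
    by (rule cInf_greatest) (use assms in auto)
qed

lemma Tuple_in_carrier_iff:
  "Tuple xs \<in> carrier (tuple_module N V) \<longleftrightarrow> length xs = N \<and> set xs \<subseteq> carrier V"
  by (auto simp: tuple_module_def)

lemma in_carrier_tupleE:
  assumes "u \<in> carrier (tuple_module N V)"
  obtains xs where "u = Tuple xs" "length xs = N" "set xs \<subseteq> carrier V"
  using assms by (auto simp: tuple_module_def)

lemma tuple_add: "Tuple xs \<oplus>\<^bsub>tuple_module N V\<^esub> Tuple ys = Tuple (map2 (add V) xs ys)"
  by (simp add: tuple_module_def)

lemma tuple_smult: "c \<odot>\<^bsub>tuple_module N V\<^esub> Tuple xs = Tuple (map (module.smult V c) xs)"
  by (simp add: tuple_module_def)

text \<open>A tuple becomes a function of an index and a point. The uniform distribution charges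
  every index, so a property holds almost everywhere on the product iff it does in each coordinate.
  Discrete measures make every function measurable, in particular one assembled from
  coordinates.\<close>

lemma L0_model_tuple:
  fixes p :: "'a pmf" and V :: "('k::{real_normed_field, euclidean_space}, ('x, 'p, 'k) point) module"
  assumes V: "L0_model (measure_pmf p) V rep" and N: "1 \<le> N"
  shows "L0_model (measure_pmf (pair_pmf (pmf_of_set {..<N}) p)) (tuple_module N V)
    (\<lambda>u (j, x). rep (coords u ! j) x)"
proof -
  interpret V: L0_model "measure_pmf p" V rep by (rule V)
  have set: "set_pmf (pair_pmf (pmf_of_set {..<N}) p) = {..<N} \<times> set_pmf p"
    using N by (simp add: set_pmf_of_set lessThan_empty_iff)
  have nth: "coords u ! j \<in> carrier V" if "u \<in> carrier (tuple_module N V)" "j < N" for u j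
    using that by (auto simp: tuple_module_def)
  have len: "length (coords u) = N" if "u \<in> carrier (tuple_module N V)" for u
    using that by (auto simp: tuple_module_def)
  show ?thesis
  proof
    fix u v assume u: "u \<in> carrier (tuple_module N V)" and v: "v \<in> carrier (tuple_module N V)"
    show "u \<oplus>\<^bsub>tuple_module N V\<^esub> v \<in> carrier (tuple_module N V)"
    proof -
      obtain xs ys where "u = Tuple xs" "length xs = N" "set xs \<subseteq> carrier V"
        "v = Tuple ys" "length ys = N" "set ys \<subseteq> carrier V"
        using u v by (elim in_carrier_tupleE)
      moreover have "set (map2 (add V) xs ys) \<subseteq> carrier V"
        if "set xs \<subseteq> carrier V" "set ys \<subseteq> carrier V" for xs ys
        using that by (auto intro!: V.add_carrier dest: set_zip_leftD set_zip_rightD)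
      ultimately show ?thesis by (simp add: tuple_add Tuple_in_carrier_iff)
    qed
    show "AE z in measure_pmf (pair_pmf (pmf_of_set {..<N}) p).
        (case z of (j, x) \<Rightarrow> rep (coords (u \<oplus>\<^bsub>tuple_module N V\<^esub> v) ! j) x) =
        (case z of (j, x) \<Rightarrow> rep (coords u ! j) x) + (case z of (j, x) \<Rightarrow> rep (coords v ! j) x)"
      using V.rep_add[OF nth[OF u] nth[OF v]] len[OF u] len[OF v]
      unfolding AE_measure_pmf_iff set by (auto simp: tuple_module_def)
    assume *: "AE z in measure_pmf (pair_pmf (pmf_of_set {..<N}) p).
        (case z of (j, x) \<Rightarrow> rep (coords u ! j) x) = (case z of (j, x) \<Rightarrow> rep (coords v ! j) x)"
    have "coords u = coords v"
    proof (rule nth_equalityI)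
      fix j assume "j < length (coords u)"
      then have j: "j < N" by (simp add: len[OF u])
      show "coords u ! j = coords v ! j"
        by (rule V.rep_inj[OF nth[OF u j] nth[OF v j]])
          (use * j in \<open>unfold AE_measure_pmf_iff set, auto\<close>)
    qed (simp add: len[OF u] len[OF v])
    moreover have "u = Tuple (coords u)" "v = Tuple (coords v)"
      by (rule in_carrier_tupleE[OF u], simp) (rule in_carrier_tupleE[OF v], simp)
    ultimately show "u = v" by metis
  next
    fix u and c :: 'k assume u: "u \<in> carrier (tuple_module N V)"
    show "c \<odot>\<^bsub>tuple_module N V\<^esub> u \<in> carrier (tuple_module N V)"
      by (rule in_carrier_tupleE[OF u])
        (auto simp: tuple_smult Tuple_in_carrier_iff intro!: V.smult_carrier)
    show "AE z in measure_pmf (pair_pmf (pmf_of_set {..<N}) p).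
        (case z of (j, x) \<Rightarrow> rep (coords (c \<odot>\<^bsub>tuple_module N V\<^esub> u) ! j) x) =
        c * (case z of (j, x) \<Rightarrow> rep (coords u ! j) x)"
      using V.rep_smult[OF nth[OF u]] len[OF u]
      unfolding AE_measure_pmf_iff set by (auto simp: tuple_module_def)
  next
    show "\<zero>\<^bsub>tuple_module N V\<^esub> \<in> carrier (tuple_module N V)"
      using V.zero_carrier by (auto simp: tuple_module_def)
    show "AE z in measure_pmf (pair_pmf (pmf_of_set {..<N}) p).
        (case z of (j, x) \<Rightarrow> rep (coords \<zero>\<^bsub>tuple_module N V\<^esub> ! j) x) = 0"
      using V.rep_zero unfolding AE_measure_pmf_iff set by (auto simp: tuple_module_def)
  next
    fix f :: "nat \<times> 'a \<Rightarrow> 'k"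
    have "\<exists>g. \<forall>j. g j \<in> carrier V \<and> (AE x in measure_pmf p. rep (g j) x = f (j, x))"
      using V.rep_surj by (intro choice) (auto simp: Bex_def)
    then obtain g where g: "\<And>j. g j \<in> carrier V" "\<And>j. AE x in measure_pmf p. rep (g j) x = f (j, x)"
      by blast
    show "\<exists>u\<in>carrier (tuple_module N V). AE z in measure_pmf (pair_pmf (pmf_of_set {..<N}) p).
        (case z of (j, x) \<Rightarrow> rep (coords u ! j) x) = f z"
    proof
      show "Tuple (map g [0..<N]) \<in> carrier (tuple_module N V)"
        using g(1) by (auto simp: Tuple_in_carrier_iff)
      show "AE z in measure_pmf (pair_pmf (pmf_of_set {..<N}) p).
          (case z of (j, x) \<Rightarrow> rep (coords (Tuple (map g [0..<N])) ! j) x) = f z"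
        using g(2) unfolding AE_measure_pmf_iff set by auto
    qed
  qed simp
qed

text \<open>The product integral averages over the index, and an average does not exceed the largest
  coordinate; so the \<open>L\<^sub>1\<close> domination survives without any factor depending on
  \<open>N\<close>.\<close>

lemma gauge_tuple:
  fixes p :: "'a pmf" and Adm :: "('a \<Rightarrow> 'k::{real_normed_field, euclidean_space}) \<Rightarrow> real \<Rightarrow> bool"
  assumes "gauge (measure_pmf p) Adm" and N: "1 \<le> (N::nat)"
  shows "gauge (measure_pmf (pair_pmf (pmf_of_set {..<N}) p)) (\<lambda>f c. \<forall>j<N. Adm (\<lambda>x. f (j, x)) c)"
proof -
  interpret gauge "measure_pmf p" Adm by fact
  have set: "set_pmf (pmf_of_set {..<N}) = {..<N}"
    using N by (simp add: set_pmf_of_set lessThan_empty_iff)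
  show ?thesis
  proof
    fix f :: "nat \<times> 'a \<Rightarrow> 'k" and c :: real
    assume f: "\<forall>j<N. Adm (\<lambda>x. f (j, x)) c" and c: "0 < c"
    have "(\<integral>\<^sup>+z. ennreal (norm (f z)) \<partial>measure_pmf (pair_pmf (pmf_of_set {..<N}) p))
        = (\<integral>\<^sup>+j. \<integral>\<^sup>+x. ennreal (norm (f (j, x))) \<partial>measure_pmf p \<partial>measure_pmf (pmf_of_set {..<N}))"
      by (rule nn_integral_pair_pmf')
    also have "\<dots> \<le> (\<integral>\<^sup>+j. ennreal c \<partial>measure_pmf (pmf_of_set {..<N}))"
      by (rule nn_integral_mono_AE)
        (use f c in \<open>auto simp: AE_measure_pmf_iff set intro!: adm_L1\<close>)
    also have "\<dots> = ennreal c" by simp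
    finally show "(\<integral>\<^sup>+z. ennreal (norm (f z)) \<partial>measure_pmf (pair_pmf (pmf_of_set {..<N}) p)) \<le> ennreal c" .
  next
    fix h :: "nat \<Rightarrow> nat \<times> 'a \<Rightarrow> 'k" and g c
    assume lim: "AE z in measure_pmf (pair_pmf (pmf_of_set {..<N}) p). (\<lambda>n. h n z) \<longlonglongrightarrow> g z"
      and h: "\<And>n. \<forall>j<N. Adm (\<lambda>x. h n (j, x)) c" and "0 < c"
    show "\<forall>j<N. Adm (\<lambda>x. g (j, x)) c"
    proof (intro allI impI)
      fix j assume "j < N"
      show "Adm (\<lambda>x. g (j, x)) c"
        by (rule adm_Fatou[where h = "\<lambda>n x. h n (j, x)" and g = "\<lambda>x. g (j, x)"])
          (use lim h \<open>0 < c\<close> \<open>j < N\<close> in \<open>auto simp: AE_measure_pmf_iff set\<close>)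
    qed
  next
    fix f :: "nat \<times> 'a \<Rightarrow> 'k" and c d :: real
    assume "\<forall>j<N. Adm (\<lambda>x. f (j, x)) c" "0 < c" "c \<le> d"
    then show "\<forall>j<N. Adm (\<lambda>x. f (j, x)) d" using adm_mono by blast
  qed (simp_all add: adm_zero adm_smult adm_add)
qed

lemma gauge_space_linf:
  fixes p :: "'a pmf" and V :: "('k::{real_normed_field, euclidean_space}, ('x, 'p, 'k) point) module"
  assumes A: "gauge_space (measure_pmf p) V rep Adm A" and N: "1 \<le> N"
  shows "gauge_space (measure_pmf (pair_pmf (pmf_of_set {..<N}) p)) (tuple_module N V)
    (\<lambda>u (j, x). rep (coords u ! j) x) (\<lambda>f c. \<forall>j<N. Adm (\<lambda>x. f (j, x)) c) (linf_space N A)"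
proof -
  interpret A: gauge_space "measure_pmf p" V rep Adm A by (rule A)
  have adm: "Adm (rep (xs ! j)) d"
    if "length xs = N" "set xs \<subseteq> pts A" "j < N" "(MAX x\<in>set xs. nrm A x) < d" for xs j d
  proof (rule A.adm_if_nrm_less)
    show "xs ! j \<in> pts A" using that by auto
    have "nrm A (xs ! j) \<le> (MAX x\<in>set xs. nrm A x)" using that by (intro Max_ge) auto
    with that(4) show "nrm A (xs ! j) < d" by linarith
  qed
  show ?thesis
  proof (intro gauge_space.intro L0_model_tuple gauge_tuple gauge_space_axioms.intro N)
    show "L0_model (measure_pmf p) V rep" by (rule A.L0_model_axioms)
    show "gauge (measure_pmf p) Adm" by (rule A.gauge_axioms)
    show "pts (linf_space N A) = {u \<in> carrier (tuple_module N V). \<exists>c>0. \<forall>j<N.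
        Adm (\<lambda>x. case (j, x) of (j, x) \<Rightarrow> rep (coords u ! j) x) c}"
    proof (intro Set.set_eqI iffI)
      fix u assume "u \<in> pts (linf_space N A)"
      then obtain xs where u: "u = Tuple xs" and xs: "length xs = N" "set xs \<subseteq> pts A"
        by (auto simp: linf_space_def)
      \<comment> \<open>The witness has to be positive and strictly above every coordinate norm,
        since only strict upper bounds are known to be admissible.\<close>
      have "\<forall>j<N. Adm (rep (xs ! j)) (max 1 (1 + (MAX x\<in>set xs. nrm A x)))"
        using adm[OF xs] by auto
      then have "\<exists>c>0. \<forall>j<N. Adm (rep (xs ! j)) c"
        by (intro exI[of _ "max 1 (1 + (MAX x\<in>set xs. nrm A x))"]) auto
      then show "u \<in> {u \<in> carrier (tuple_module N V). \<exists>c>0. \<forall>j<N.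
          Adm (\<lambda>x. case (j, x) of (j, x) \<Rightarrow> rep (coords u ! j) x) c}"
        using xs A.pts_carrier by (auto simp: u tuple_module_def)
    next
      fix u assume "u \<in> {u \<in> carrier (tuple_module N V). \<exists>c>0. \<forall>j<N.
          Adm (\<lambda>x. case (j, x) of (j, x) \<Rightarrow> rep (coords u ! j) x) c}"
      then obtain xs c where u: "u = Tuple xs" and xs: "length xs = N" "set xs \<subseteq> carrier V"
        and c: "0 < c" "\<forall>j<N. Adm (rep (xs ! j)) c"
        by (auto simp: tuple_module_def)
      have "x \<in> pts A" if x: "x \<in> set xs" for x
      proof -
        obtain j where "j < N" "x = xs ! j" using x xs(1) by (auto simp: in_set_conv_nth)
        then show ?thesis using xs(2) c x by (auto simp: A.pts_eq)
      qed
      then have "set xs \<subseteq> pts A" by blast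
      then show "u \<in> pts (linf_space N A)"
        by (simp add: u linf_space_def xs(1))
    qed
    fix u assume "u \<in> pts (linf_space N A)"
    then obtain xs where u: "u = Tuple xs" and xs: "length xs = N" "set xs \<subseteq> pts A"
      by (auto simp: linf_space_def)
    have ne: "set xs \<noteq> {}" using xs N by auto
    have "Inf {c. 0 < c \<and> (\<forall>j<N. Adm (rep (xs ! j)) c)} = (MAX x\<in>set xs. nrm A x)"
    proof (rule Inf_eq_gauge)
      have "xs ! 0 \<in> set xs" using xs N by simp
      moreover from this have "xs ! 0 \<in> pts A" using xs by blast
      ultimately show "0 \<le> (MAX x\<in>set xs. nrm A x)"
        using A.nrm_nonneg[of "xs ! 0"] by (intro Max_ge_iff[THEN iffD2]) auto
      fix c :: real assume "0 < c" and c: "\<forall>j<N. Adm (rep (xs ! j)) c"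
      show "(MAX x\<in>set xs. nrm A x) \<le> c"
      proof (rule Max.boundedI)
        fix y assume "y \<in> nrm A ` set xs"
        then obtain j where "j < N" "y = nrm A (xs ! j)" using xs by (auto simp: in_set_conv_nth)
        then show "y \<le> c"
          using c \<open>0 < c\<close> xs nth_mem[of j xs] by (auto intro!: A.pts_nrm_le_if_adm(2) A.pts_carrier)
      qed (use ne in auto)
    qed (use adm[OF xs] in auto)
    then show "nrm (linf_space N A) u = Inf {c. 0 < c \<and> (\<forall>j<N.
        Adm (\<lambda>x. case (j, x) of (j, x) \<Rightarrow> rep (coords u ! j) x) c)}"
      by (simp add: u linf_space_def)
  qed
qed

section \<open>Sequence spaces\<close>

lemma L0_model_seq:
  assumes "set_pmf p = UNIV"
  shows "L0_model (measure_pmf p) (seq_module :: ('k::{real_normed_field, euclidean_space}, ('x, 'p, 'k) point) module) entries"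
proof
  fix f :: "nat \<Rightarrow> 'k"
  show "\<exists>u\<in>carrier (seq_module :: ('k, ('x, 'p, 'k) point) module).
      AE x in measure_pmf p. entries u x = f x"
    by (rule bexI[of _ "Sequence f"]) (auto simp: seq_module_def)
qed (use assms in \<open>auto simp: seq_module_def AE_measure_pmf_iff fun_eq_iff\<close>)

text \<open>Each \<open>\<Phi> m\<close> is continuous under pointwise convergence, which full
  support extracts from convergence almost everywhere; a bound on all of them therefore passes to
  the limit, although their supremum is only lower semicontinuous. \<open>norm_le\<close> bounds all
  entries by \<open>c\<close>, and a probability measure keeps the \<open>L\<^sub>1\<close> integral
  below that.\<close>

lemma gauge_pointwise:
  fixes p :: "nat pmf" and \<Phi> :: "nat \<Rightarrow> (nat \<Rightarrow> 'k::{real_normed_field, euclidean_space}) \<Rightarrow> real"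
  assumes p: "set_pmf p = UNIV"
    and smult: "\<And>m a f. \<Phi> m (\<lambda>x. a * f x) = norm a * \<Phi> m f"
    and add: "\<And>m f g. \<Phi> m (\<lambda>x. f x + g x) \<le> \<Phi> m f + \<Phi> m g"
    and norm_le: "\<And>n f. norm (f n) \<le> \<Phi> (Suc n) f"
    and cont: "\<And>m h g. (\<And>x. (\<lambda>n. h n x) \<longlonglongrightarrow> g x) \<Longrightarrow> (\<lambda>n. \<Phi> m (h n)) \<longlonglongrightarrow> \<Phi> m g"
  shows "gauge (measure_pmf p) (\<lambda>f c. \<forall>m. \<Phi> m f \<le> c)"
proof
  fix c :: real assume "0 < c"
  then show "\<forall>m. \<Phi> m (\<lambda>_. 0) \<le> c" using smult[of _ 0 "\<lambda>_. 0"] by simp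
next
  fix f :: "nat \<Rightarrow> 'k" and c d :: real assume *: "\<forall>m. \<Phi> m f \<le> c" "c \<le> d"
  then show "\<forall>m. \<Phi> m f \<le> d"
    using order_trans[OF *(1)[THEN spec] *(2)] by blast
next
  fix f :: "nat \<Rightarrow> 'k" and c and a :: 'k assume "\<forall>m. \<Phi> m f \<le> c"
  then show "\<forall>m. \<Phi> m (\<lambda>x. a * f x) \<le> norm a * c"
    by (auto simp: smult intro: mult_left_mono)
next
  fix f g :: "nat \<Rightarrow> 'k" and c d assume "\<forall>m. \<Phi> m f \<le> c" "\<forall>m. \<Phi> m g \<le> d"
  then show "\<forall>m. \<Phi> m (\<lambda>x. f x + g x) \<le> c + d"
    by (intro allI order_trans[OF add] add_mono) auto
next
  fix f :: "nat \<Rightarrow> 'k" and c :: real assume "\<forall>m. \<Phi> m f \<le> c"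
  then have "norm (f n) \<le> c" for n by (intro order_trans[OF norm_le]) auto
  then have "(\<integral>\<^sup>+x. ennreal (norm (f x)) \<partial>measure_pmf p) \<le> (\<integral>\<^sup>+x. ennreal c \<partial>measure_pmf p)"
    by (intro nn_integral_mono ennreal_leI)
  then show "(\<integral>\<^sup>+x. ennreal (norm (f x)) \<partial>measure_pmf p) \<le> ennreal c" by simp
next
  fix h :: "nat \<Rightarrow> nat \<Rightarrow> 'k" and g and c :: real
  assume "AE x in measure_pmf p. (\<lambda>n. h n x) \<longlonglongrightarrow> g x" and h: "\<And>n. \<forall>m. \<Phi> m (h n) \<le> c"
  then have "(\<lambda>n. \<Phi> m (h n)) \<longlonglongrightarrow> \<Phi> m g" for m
    by (intro cont) (auto simp: AE_measure_pmf_iff p)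
  then show "\<forall>m. \<Phi> m g \<le> c"
    using h by (intro allI LIMSEQ_le_const2[where X = "\<lambda>n. \<Phi> _ (h n)"]) auto
qed

text \<open>Norms of finite sections: each involves finitely many entries and so is continuous under
  pointwise convergence, and their supremum is the norm of the sequence, with no summability to be
  checked beforehand.\<close>

definition lp_partial :: "real \<Rightarrow> nat \<Rightarrow> (nat \<Rightarrow> 'k::real_normed_field) \<Rightarrow> real" where
  "lp_partial p m f = (\<Sum>n<m. norm (f n) powr p) powr (1 / p)"

lemma lp_partial_1: "lp_partial 1 m f = (\<Sum>n<m. norm (f n))"
  by (simp add: lp_partial_def sum_nonneg)

lemma lp_partial_2: "lp_partial 2 m f = L2_set (\<lambda>n. norm (f n)) {..<m}"
  by (simp add: lp_partial_def L2_set_def powr_half_sqrt sum_nonneg)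

lemma gauge_lp_1: "set_pmf q = UNIV \<Longrightarrow>
    gauge (measure_pmf q) (\<lambda>f::nat \<Rightarrow> 'k::{real_normed_field, euclidean_space}. \<lambda>c. \<forall>m. lp_partial 1 m f \<le> c)"
proof (rule gauge_pointwise)
  fix m and f g :: "nat \<Rightarrow> 'k"
  show "lp_partial 1 m (\<lambda>x. f x + g x) \<le> lp_partial 1 m f + lp_partial 1 m g"
    unfolding lp_partial_1 sum.distrib[symmetric] by (intro sum_mono norm_triangle_ineq)
next
  fix m and h :: "nat \<Rightarrow> nat \<Rightarrow> 'k" and g assume "\<And>x. (\<lambda>n. h n x) \<longlonglongrightarrow> g x"
  then show "(\<lambda>n. lp_partial 1 m (h n)) \<longlonglongrightarrow> lp_partial 1 m g"
    unfolding lp_partial_1 by (intro tendsto_intros)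
qed (simp_all add: lp_partial_1 norm_mult sum_distrib_left sum_nonneg)

lemma gauge_lp_2: "set_pmf q = UNIV \<Longrightarrow>
    gauge (measure_pmf q) (\<lambda>f::nat \<Rightarrow> 'k::{real_normed_field, euclidean_space}. \<lambda>c. \<forall>m. lp_partial 2 m f \<le> c)"
proof (rule gauge_pointwise)
  fix m and f g :: "nat \<Rightarrow> 'k"
  have "lp_partial 2 m (\<lambda>x. f x + g x) \<le> L2_set (\<lambda>n. norm (f n) + norm (g n)) {..<m}"
    unfolding lp_partial_2 by (intro L2_set_mono norm_triangle_ineq) auto
  also have "\<dots> \<le> lp_partial 2 m f + lp_partial 2 m g"
    unfolding lp_partial_2 by (rule L2_set_triangle_ineq)
  finally show "lp_partial 2 m (\<lambda>x. f x + g x) \<le> lp_partial 2 m f + lp_partial 2 m g" .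
next
  fix n and f :: "nat \<Rightarrow> 'k"
  show "norm (f n) \<le> lp_partial 2 (Suc n) f"
    unfolding lp_partial_2 by (rule member_le_L2_set) auto
next
  fix m a and f :: "nat \<Rightarrow> 'k"
  show "lp_partial 2 m (\<lambda>x. a * f x) = norm a * lp_partial 2 m f"
    by (simp add: lp_partial_2 norm_mult L2_set_right_distrib)
next
  fix m and h :: "nat \<Rightarrow> nat \<Rightarrow> 'k" and g assume "\<And>x. (\<lambda>n. h n x) \<longlonglongrightarrow> g x"
  then show "(\<lambda>n. lp_partial 2 m (h n)) \<longlonglongrightarrow> lp_partial 2 m g"
    unfolding lp_partial_2 L2_set_def by (intro tendsto_intros)
qed

lemma gauge_space_lp:
  fixes q :: "nat pmf"
  assumes q: "set_pmf q = UNIV" and p: "0 < p"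
    and gauge: "gauge (measure_pmf q) (\<lambda>f::nat \<Rightarrow> 'k::{real_normed_field, euclidean_space}. \<lambda>c. \<forall>m. lp_partial p m f \<le> c)"
  shows "gauge_space (measure_pmf q) (seq_module :: ('k, ('x, 'p, 'k) point) module) entries
    (\<lambda>f c. \<forall>m. lp_partial p m f \<le> c) (lp_space p)"
proof (intro gauge_space.intro L0_model_seq gauge gauge_space_axioms.intro q)
  have suminf: "lp_partial p m f \<le> (\<Sum>n. norm (f n) powr p) powr (1 / p)"
    if "summable (\<lambda>n. norm (f n) powr p)" for f :: "nat \<Rightarrow> 'k" and m
    unfolding lp_partial_def using that p
    by (intro powr_mono2 sum_le_suminf) (auto simp: sum_nonneg)
  have partial: "(\<Sum>n<m. norm (f n) powr p) \<le> c powr p"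
    if "\<forall>m. lp_partial p m f \<le> c" for f :: "nat \<Rightarrow> 'k" and m c
  proof -
    have "lp_partial p m f powr p \<le> c powr p"
      using that p by (intro powr_mono2) (auto simp: lp_partial_def)
    moreover have "0 \<le> (\<Sum>n<m. norm (f n) powr p)" by (intro sum_nonneg) auto
    ultimately show ?thesis using p by (simp add: lp_partial_def powr_powr)
  qed
  show "pts (lp_space p) = {u \<in> carrier (seq_module :: ('k, ('x, 'p, 'k) point) module).
      \<exists>c>0. \<forall>m. lp_partial p m (entries u) \<le> c}"
  proof (intro Set.set_eqI iffI)
    fix u :: "('x, 'p, 'k) point" assume "u \<in> pts (lp_space p)"
    then obtain f where u: "u = Sequence f" and f: "summable (\<lambda>n. norm (f n) powr p)"
      by (auto simp: lp_space_def)
    have "lp_partial p m f \<le> (\<Sum>n. norm (f n) powr p) powr (1 / p) + 1" for m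
      using suminf[OF f, of m] by simp
    moreover have "0 < (\<Sum>n. norm (f n) powr p) powr (1 / p) + 1" by (simp add: add_nonneg_pos)
    ultimately have "\<exists>c>0. \<forall>m. lp_partial p m f \<le> c" by blast
    then show "u \<in> {u \<in> carrier seq_module. \<exists>c>0. \<forall>m. lp_partial p m (entries u) \<le> c}"
      by (simp add: u seq_module_def)
  next
    fix u :: "('x, 'p, 'k) point"
    assume "u \<in> {u \<in> carrier seq_module. \<exists>c>0. \<forall>m. lp_partial p m (entries u) \<le> c}"
    then obtain f c where u: "u = Sequence f" and f: "\<forall>m. lp_partial p m f \<le> c"
      by (auto simp: seq_module_def)
    have "summable (\<lambda>n. norm (f n) powr p)"
      by (rule summableI_nonneg_bounded) (use partial[OF f] in auto)
    then show "u \<in> pts (lp_space p)" by (simp add: u lp_space_def)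
  qed
  fix u :: "('x, 'p, 'k) point" assume "u \<in> pts (lp_space p)"
  then obtain f where u: "u = Sequence f" and f: "summable (\<lambda>n. norm (f n) powr p)"
    by (auto simp: lp_space_def)
  have "Inf {c. 0 < c \<and> (\<forall>m. lp_partial p m f \<le> c)} = (\<Sum>n. norm (f n) powr p) powr (1 / p)"
  proof (rule Inf_eq_gauge)
    fix c assume "0 < c" and c: "\<forall>m. lp_partial p m f \<le> c"
    have "(\<Sum>n. norm (f n) powr p) \<le> c powr p"
      by (rule suminf_le_const[OF f partial[OF c]])
    then have "(\<Sum>n. norm (f n) powr p) powr (1 / p) \<le> (c powr p) powr (1 / p)"
      using p f by (intro powr_mono2 suminf_nonneg) auto
    then show "(\<Sum>n. norm (f n) powr p) powr (1 / p) \<le> c"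
      using \<open>0 < c\<close> p by (simp add: powr_powr)
  next
    fix d assume "(\<Sum>n. norm (f n) powr p) powr (1 / p) < d"
    then show "\<forall>m. lp_partial p m f \<le> d"
      using suminf[OF f] by (intro allI) (rule order_trans[OF _ less_imp_le])
  qed simp
  then show "nrm (lp_space p) u = Inf {c. 0 < c \<and> (\<forall>m. lp_partial p m (entries u) \<le> c)}"
    by (simp add: u lp_space_def)
qed

section \<open>Random variables\<close>

lemma rv_rep_rv_class:
  assumes "f \<in> borel_measurable M"
  shows rv_rep_measurable: "rv_rep (rv_class M f :: ('x, 'a, 'k::real_normed_field) point) \<in> borel_measurable M"
    and rv_rep_AE: "AE x in M. rv_rep (rv_class M f :: ('x, 'a, 'k) point) x = f x"
proof -
  have "(SOME g. g \<in> representatives (rv_class M f :: ('x, 'a, 'k) point))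
      \<in> representatives (rv_class M f :: ('x, 'a, 'k) point)"
    by (rule someI[where x = f]) (simp add: rv_class_def assms)
  then show "rv_rep (rv_class M f :: ('x, 'a, 'k) point) \<in> borel_measurable M"
    "AE x in M. rv_rep (rv_class M f :: ('x, 'a, 'k) point) x = f x"
    by (simp_all add: rv_rep_def rv_class_def)
qed

lemma rv_class_cong:
  assumes "AE x in M. f x = g x"
  shows "rv_class M f = rv_class M g"
proof -
  have "(AE x in M. h x = f x) \<longleftrightarrow> (AE x in M. h x = g x)" for h
  proof
    assume "AE x in M. h x = f x" then show "AE x in M. h x = g x" using assms by eventually_elim simp
  next
    assume "AE x in M. h x = g x" then show "AE x in M. h x = f x" using assms by eventually_elim simp
  qed
  then show ?thesis by (simp add: rv_class_def)
qed

lemma in_carrier_L0E: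
  assumes "u \<in> carrier (L0_module M)"
  obtains f where "f \<in> borel_measurable M" "u = rv_class M f"
  using assms by (auto simp: L0_module_def)

lemma rv_class_in_carrier: "f \<in> borel_measurable M \<Longrightarrow> rv_class M f \<in> carrier (L0_module M)"
  by (simp add: L0_module_def)

lemma rv_rep_measurable_carrier:
  assumes "u \<in> carrier (L0_module M)"
  shows "rv_rep u \<in> borel_measurable M"
  by (rule in_carrier_L0E[OF assms]) (simp add: rv_rep_measurable)

lemma rv_class_rv_rep:
  assumes "u \<in> carrier (L0_module M)"
  shows "rv_class M (rv_rep u) = u"
proof (rule in_carrier_L0E[OF assms])
  fix f assume "f \<in> borel_measurable M" "u = rv_class M f"
  then show ?thesis by (simp add: rv_class_cong[OF rv_rep_AE])
qed

text \<open>The spaces of random variables are defined through some representative of a class, the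
  gauges through the chosen one. Invariance of \<open>R\<close> under almost everywhere equality
  makes the two descriptions agree.\<close>

lemma rv_class_image_eq:
  fixes R :: "('a \<Rightarrow> 'k::real_normed_field) \<Rightarrow> bool"
  assumes "\<And>f g. f \<in> borel_measurable M \<Longrightarrow> g \<in> borel_measurable M \<Longrightarrow> AE x in M. g x = f x \<Longrightarrow> R f \<Longrightarrow> R g"
  shows "(rv_class M ` {f \<in> borel_measurable M. R f} :: ('x, 'a, 'k) point set) = {u \<in> carrier (L0_module M). R (rv_rep u)}"
proof (intro Set.set_eqI iffI)
  fix u :: "('x, 'a, 'k) point" assume "u \<in> rv_class M ` {f \<in> borel_measurable M. R f}"
  then obtain f where f: "f \<in> borel_measurable M" "R f" and u: "u = rv_class M f" by blast
  have "R (rv_rep u)"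
    unfolding u by (rule assms[OF f(1) rv_rep_measurable[OF f(1)] rv_rep_AE[OF f(1)] f(2)])
  then show "u \<in> {u \<in> carrier (L0_module M). R (rv_rep u)}"
    using rv_class_in_carrier[OF f(1)] by (simp add: u)
next
  fix u :: "('x, 'a, 'k) point" assume "u \<in> {u \<in> carrier (L0_module M). R (rv_rep u)}"
  then have "u = rv_class M (rv_rep u)" "rv_rep u \<in> {f \<in> borel_measurable M. R f}"
    using rv_class_rv_rep[of u M] rv_rep_measurable_carrier[of u M] by auto
  then show "u \<in> rv_class M ` {f \<in> borel_measurable M. R f}" by (rule image_eqI)
qed

lemma rv_class_add:
  fixes f g :: "'p \<Rightarrow> 'k::{real_normed_field, euclidean_space}"
  assumes "f \<in> borel_measurable M" "g \<in> borel_measurable M"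
  shows "(rv_class M f :: ('x, 'p, 'k) point) \<oplus>\<^bsub>L0_module M\<^esub> rv_class M g = rv_class M (\<lambda>x. f x + g x)"
proof -
  have "AE x in M. rv_rep (rv_class M f :: ('x, 'p, 'k) point) x + rv_rep (rv_class M g :: ('x, 'p, 'k) point) x
      = f x + g x"
    using rv_rep_AE[OF assms(1), where 'x = 'x] rv_rep_AE[OF assms(2), where 'x = 'x] by eventually_elim simp
  from rv_class_cong[OF this] show ?thesis by (simp add: L0_module_def)
qed

lemma rv_class_smult:
  fixes f :: "'p \<Rightarrow> 'k::{real_normed_field, euclidean_space}"
  assumes "f \<in> borel_measurable M"
  shows "c \<odot>\<^bsub>L0_module M\<^esub> (rv_class M f :: ('x, 'p, 'k) point) = rv_class M (\<lambda>x. c * f x)"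
proof -
  have "AE x in M. c * rv_rep (rv_class M f :: ('x, 'p, 'k) point) x = c * f x"
    using rv_rep_AE[OF assms, where 'x = 'x] by eventually_elim simp
  from rv_class_cong[OF this] show ?thesis by (simp add: L0_module_def)
qed

lemma (in prob_space) L0_model_L0_module:
  "L0_model M (L0_module M :: ('k::{real_normed_field, euclidean_space}, ('x, 'a, 'k) point) module) rv_rep"
proof -
  let ?V = "L0_module M :: ('k, ('x, 'a, 'k) point) module"
  have add: "u \<oplus>\<^bsub>?V\<^esub> v = rv_class M (\<lambda>x. rv_rep u x + rv_rep v x)" for u v
    by (simp add: L0_module_def)
  have smult: "c \<odot>\<^bsub>?V\<^esub> u = rv_class M (\<lambda>x. c * rv_rep u x)" for c u
    by (simp add: L0_module_def)
  have zero: "\<zero>\<^bsub>?V\<^esub> = rv_class M (\<lambda>_. 0)"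
    by (simp add: L0_module_def)
  show ?thesis
  proof
    fix u assume "u \<in> carrier ?V"
    then show u [measurable]: "rv_rep u \<in> borel_measurable M" by (rule rv_rep_measurable_carrier)
    fix c :: 'k
    show "c \<odot>\<^bsub>?V\<^esub> u \<in> carrier ?V" unfolding smult by (rule rv_class_in_carrier) simp
    show "AE x in M. rv_rep (c \<odot>\<^bsub>?V\<^esub> u) x = c * rv_rep u x" unfolding smult by (rule rv_rep_AE) simp
    fix v assume "v \<in> carrier ?V"
    then have v [measurable]: "rv_rep v \<in> borel_measurable M" by (rule rv_rep_measurable_carrier)
    show "u \<oplus>\<^bsub>?V\<^esub> v \<in> carrier ?V" unfolding add by (rule rv_class_in_carrier) simp
    show "AE x in M. rv_rep (u \<oplus>\<^bsub>?V\<^esub> v) x = rv_rep u x + rv_rep v x"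
      unfolding add by (rule rv_rep_AE) simp
  next
    fix u v assume uv: "u \<in> carrier ?V" "v \<in> carrier ?V" and "AE x in M. rv_rep u x = rv_rep v x"
    then have "(rv_class M (rv_rep u) :: ('x, 'a, 'k) point) = rv_class M (rv_rep v)"
      by (intro rv_class_cong)
    then show "u = v" using uv by (simp add: rv_class_rv_rep)
  next
    fix f :: "'a \<Rightarrow> 'k" assume "f \<in> borel_measurable M"
    then show "\<exists>u\<in>carrier ?V. AE x in M. rv_rep u x = f x"
      by (intro bexI[of _ "rv_class M f"] rv_rep_AE rv_class_in_carrier)
  next
    show "\<zero>\<^bsub>?V\<^esub> \<in> carrier ?V" unfolding zero by (rule rv_class_in_carrier) simp
    show "AE x in M. rv_rep \<zero>\<^bsub>?V\<^esub> x = 0" unfolding zero by (rule rv_rep_AE) simp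
  qed
qed

section \<open>Bounded functions and the exponential Orlicz space\<close>

lemma (in prob_space) gauge_Linfty:
  "gauge M (\<lambda>(f :: 'a \<Rightarrow> 'k::{real_normed_field, euclidean_space}) c. AE x in M. norm (f x) \<le> c)"
proof
  fix f :: "'a \<Rightarrow> 'k" and c d :: real
  assume "AE x in M. norm (f x) \<le> c" "c \<le> d"
  then show "AE x in M. norm (f x) \<le> d" by auto
next
  fix f :: "'a \<Rightarrow> 'k" and c and a :: 'k assume "AE x in M. norm (f x) \<le> c"
  then show "AE x in M. norm (a * f x) \<le> norm a * c"
    by eventually_elim (simp add: norm_mult mult_left_mono)
next
  fix f g :: "'a \<Rightarrow> 'k" and c d assume "AE x in M. norm (f x) \<le> c" "AE x in M. norm (g x) \<le> d"
  then show "AE x in M. norm (f x + g x) \<le> c + d"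
    by eventually_elim (rule norm_triangle_mono)
next
  fix f :: "'a \<Rightarrow> 'k" and c :: real assume "AE x in M. norm (f x) \<le> c"
  then have "(\<integral>\<^sup>+x. ennreal (norm (f x)) \<partial>M) \<le> (\<integral>\<^sup>+x. ennreal c \<partial>M)"
    by (intro nn_integral_mono_AE) (auto intro: ennreal_leI)
  then show "(\<integral>\<^sup>+x. ennreal (norm (f x)) \<partial>M) \<le> ennreal c" by (simp add: emeasure_space_1)
next
  fix h :: "nat \<Rightarrow> 'a \<Rightarrow> 'k" and g and c :: real
  assume lim: "AE x in M. (\<lambda>n. h n x) \<longlonglongrightarrow> g x" and h: "\<And>n. AE x in M. norm (h n x) \<le> c"
  have "AE x in M. \<forall>n. norm (h n x) \<le> c" using h by (simp add: AE_all_countable)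
  with lim show "AE x in M. norm (g x) \<le> c"
  proof eventually_elim
    case (elim x)
    then show ?case by (intro LIMSEQ_le_const2[OF tendsto_norm]) auto
  qed
qed simp

lemma (in prob_space) Linfty_norm_properties:
  fixes f :: "'a \<Rightarrow> 'k::{real_normed_field, euclidean_space}"
  assumes [measurable]: "f \<in> borel_measurable M"
  shows Linfty_norm_nonneg: "0 \<le> Linfty_norm M f"
    and Linfty_norm_le_iff: "Linfty_norm M f \<le> ereal c \<longleftrightarrow> (AE x in M. norm (f x) \<le> c)"
proof -
  have "esssup M (\<lambda>_. 0 :: ereal) \<le> Linfty_norm M f"
    unfolding Linfty_norm_def by (rule esssup_mono) auto
  \<comment> \<open>The essential supremum of the constant 0 is 0 because the space has positive
    mass.\<close>
  then show "0 \<le> Linfty_norm M f" by (simp add: esssup_const emeasure_space_1)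
  show "Linfty_norm M f \<le> ereal c \<longleftrightarrow> (AE x in M. norm (f x) \<le> c)"
  proof
    assume *: "Linfty_norm M f \<le> ereal c"
    have "AE x in M. ereal (norm (f x)) \<le> Linfty_norm M f"
      unfolding Linfty_norm_def by (rule esssup_AE)
    then show "AE x in M. norm (f x) \<le> c"
    proof eventually_elim
      case (elim x)
      then have "ereal (norm (f x)) \<le> ereal c" using * by (rule order_trans)
      then show ?case by simp
    qed
  next
    assume "AE x in M. norm (f x) \<le> c"
    then show "Linfty_norm M f \<le> ereal c"
      unfolding Linfty_norm_def by (intro esssup_I) auto
  qed
qed

lemma (in prob_space) gauge_space_Linfty:
  "gauge_space M (L0_module M) rv_rep (\<lambda>f c. AE x in M. norm (f x) \<le> c)
    (Linfty_space M :: ('x, 'a, 'k::{real_normed_field, euclidean_space}) point nspace)"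
proof (intro gauge_space.intro L0_model_L0_module gauge_Linfty gauge_space_axioms.intro)
  have fin: "Linfty_norm M f < \<infinity> \<longleftrightarrow> (\<exists>c>0. AE x in M. norm (f x) \<le> c)"
    if f: "f \<in> borel_measurable M" for f :: "'a \<Rightarrow> 'k"
  proof
    assume "Linfty_norm M f < \<infinity>"
    then obtain r where r: "Linfty_norm M f = ereal r" "0 \<le> r"
      using \<open>Linfty_norm M f < \<infinity>\<close> Linfty_norm_nonneg[OF f] by (cases "Linfty_norm M f") auto
    have "AE x in M. norm (f x) \<le> r + 1"
      using Linfty_norm_le_iff[OF f, of "r + 1"] r by simp
    then show "\<exists>c>0. AE x in M. norm (f x) \<le> c" using r(2) by (intro exI[of _ "r + 1"]) auto
  next
    assume "\<exists>c>0. AE x in M. norm (f x) \<le> c"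
    then obtain c where "AE x in M. norm (f x) \<le> c" by blast
    then have "Linfty_norm M f \<le> ereal c" using Linfty_norm_le_iff[OF f] by simp
    then show "Linfty_norm M f < \<infinity>" by (rule le_less_trans) simp
  qed
  have "pts (Linfty_space M :: ('x, 'a, 'k) point nspace)
      = {u \<in> carrier (L0_module M). Linfty_norm M (rv_rep u) < \<infinity>}"
    unfolding Linfty_space_def nspace.simps
  proof (rule rv_class_image_eq)
    fix f g :: "'a \<Rightarrow> 'k"
    assume fg: "f \<in> borel_measurable M" "g \<in> borel_measurable M" "AE x in M. g x = f x"
      and "Linfty_norm M f < \<infinity>"
    then obtain c where c: "0 < c" "AE x in M. norm (f x) \<le> c" using fin by blast
    from c(2) fg(3) have "AE x in M. norm (g x) \<le> c" by eventually_elim simp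
    then show "Linfty_norm M g < \<infinity>" using c(1) fin[OF fg(2)] by blast
  qed
  also have "\<dots> = {u \<in> carrier (L0_module M). \<exists>c>0. AE x in M. norm (rv_rep u x) \<le> c}"
    using fin rv_rep_measurable_carrier by blast
  finally show pts: "pts (Linfty_space M :: ('x, 'a, 'k) point nspace)
      = {u \<in> carrier (L0_module M). \<exists>c>0. AE x in M. norm (rv_rep u x) \<le> c}" .
  fix u :: "('x, 'a, 'k) point" assume "u \<in> pts (Linfty_space M)"
  then have u: "rv_rep u \<in> borel_measurable M" and "Linfty_norm M (rv_rep u) < \<infinity>"
    unfolding pts using fin rv_rep_measurable_carrier by blast+
  then obtain r where r: "Linfty_norm M (rv_rep u) = ereal r" "0 \<le> r"
    using Linfty_norm_nonneg[OF u] by (cases "Linfty_norm M (rv_rep u)") auto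
  have "Inf {c. 0 < c \<and> (AE x in M. norm (rv_rep u x) \<le> c)} = r"
    by (rule Inf_eq_gauge) (use r in \<open>simp_all flip: Linfty_norm_le_iff[OF u]\<close>)
  then show "nrm (Linfty_space M) u = Inf {c. 0 < c \<and> (AE x in M. norm (rv_rep u x) \<le> c)}"
    by (simp add: Linfty_space_def r)
qed

text \<open>Total mass one turns the bound 1 for \<open>exp - 1\<close> into the bound 2 for
  \<open>exp\<close>, the form that suits convexity and exponential moments.\<close>

lemma (in prob_space) phi2_admissible_iff:
  assumes [measurable]: "f \<in> borel_measurable M"
  shows "c \<in> phi2_admissible M f \<longleftrightarrow>
    0 < c \<and> (\<integral>\<^sup>+x. ennreal (exp ((norm (f x))\<^sup>2 / c\<^sup>2)) \<partial>M) \<le> 2"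
proof -
  have "(\<integral>\<^sup>+x. ennreal (exp ((norm (f x))\<^sup>2 / c\<^sup>2)) \<partial>M)
      = (\<integral>\<^sup>+x. ennreal (exp ((norm (f x))\<^sup>2 / c\<^sup>2) - 1) + 1 \<partial>M)"
    by (intro nn_integral_cong) (simp flip: ennreal_1 ennreal_plus)
  also have "\<dots> = (\<integral>\<^sup>+x. ennreal (exp ((norm (f x))\<^sup>2 / c\<^sup>2) - 1) \<partial>M) + 1"
    by (subst nn_integral_add) (auto simp: emeasure_space_1)
  finally have eq: "(\<integral>\<^sup>+x. ennreal (exp ((norm (f x))\<^sup>2 / c\<^sup>2)) \<partial>M)
      = 1 + (\<integral>\<^sup>+x. ennreal (exp ((norm (f x))\<^sup>2 / c\<^sup>2) - 1) \<partial>M)"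
    by (simp add: add.commute)
  have "(2::ennreal) = 1 + 1" by simp
  then show ?thesis
    unfolding phi2_admissible_def eq by (simp only: ennreal_add_left_cancel_le) simp
qed

text \<open>The usual convexity argument for the triangle inequality of a Luxemburg norm:
  \<open>(a + b) / (c + d)\<close> is the mean of \<open>a / c\<close> and \<open>b / d\<close> with
  weights \<open>c / (c + d)\<close> and \<open>d / (c + d)\<close>, and both the square and
  \<open>exp\<close> are convex.\<close>

lemma exp_square_convex:
  fixes a b c d :: real
  assumes "0 \<le> a" "0 \<le> b" "0 < c" "0 < d"
  shows "exp ((a + b)\<^sup>2 / (c + d)\<^sup>2)
    \<le> c / (c + d) * exp (a\<^sup>2 / c\<^sup>2) + d / (c + d) * exp (b\<^sup>2 / d\<^sup>2)"
proof -
  define t x y where "t = c / (c + d)" and "x = a / c" and "y = b / d"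
  have t: "0 \<le> t" "t \<le> 1" "d / (c + d) = 1 - t"
    using assms by (auto simp: t_def field_simps)
  have "t * x + d / (c + d) * y = (a + b) / (c + d)"
    using assms by (simp add: t_def x_def y_def add_divide_distrib)
  then have eq: "(a + b) / (c + d) = t * x + (1 - t) * y" by (simp add: t(3))
  have "t * x\<^sup>2 + (1 - t) * y\<^sup>2 - (t * x + (1 - t) * y)\<^sup>2 = t * (1 - t) * (x - y)\<^sup>2"
    by (simp add: power2_eq_square algebra_simps)
  moreover have "0 \<le> t * (1 - t) * (x - y)\<^sup>2" using t(1,2) by simp
  ultimately have "((a + b) / (c + d))\<^sup>2 \<le> t * x\<^sup>2 + (1 - t) * y\<^sup>2"
    unfolding eq by linarith
  then have "exp (((a + b) / (c + d))\<^sup>2) \<le> exp (t * x\<^sup>2 + (1 - t) * y\<^sup>2)" by simp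
  also have "\<dots> \<le> t * exp (x\<^sup>2) + (1 - t) * exp (y\<^sup>2)"
    using convex_onD[OF convex_on_exp[of 1], of "1 - t" "x\<^sup>2" "y\<^sup>2"] t(1,2) by simp
  finally show ?thesis unfolding t(3) by (simp add: t_def x_def y_def power_divide)
qed

lemma (in prob_space) gauge_Lphi2:
  "gauge M (\<lambda>(f :: 'a \<Rightarrow> 'k::{real_normed_field, euclidean_space}) c. c \<in> phi2_admissible M f)"
proof
  fix c :: real assume "0 < c"
  then show "c \<in> phi2_admissible M (\<lambda>_. 0 :: 'k)" by (simp add: phi2_admissible_def)
next
  fix f :: "'a \<Rightarrow> 'k" and c d :: real
  assume f: "c \<in> phi2_admissible M f" and cd: "0 < c" "c \<le> d"
  have "(\<integral>\<^sup>+x. ennreal (exp ((norm (f x))\<^sup>2 / d\<^sup>2) - 1) \<partial>M)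
      \<le> (\<integral>\<^sup>+x. ennreal (exp ((norm (f x))\<^sup>2 / c\<^sup>2) - 1) \<partial>M)"
    using cd by (intro nn_integral_mono ennreal_leI) (auto intro!: divide_left_mono power_mono)
  also have "\<dots> \<le> 1" using f by (simp add: phi2_admissible_def)
  finally show "d \<in> phi2_admissible M f" using cd by (simp add: phi2_admissible_def)
next
  fix f :: "'a \<Rightarrow> 'k" and c and a :: 'k
  assume "c \<in> phi2_admissible M f" "a \<noteq> 0"
  then show "norm a * c \<in> phi2_admissible M (\<lambda>x. a * f x)"
    by (simp add: phi2_admissible_def norm_mult power_mult_distrib)
next
  fix f g :: "'a \<Rightarrow> 'k" and c d :: real
  assume [measurable]: "f \<in> borel_measurable M" "g \<in> borel_measurable M"
    and f: "c \<in> phi2_admissible M f" and g: "d \<in> phi2_admissible M g" and cd: "0 < c" "0 < d"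
  define s where "s = c / (c + d)"
  define t where "t = d / (c + d)"
  have st: "0 \<le> s" "0 \<le> t" "s + t = 1" using cd by (auto simp: s_def t_def simp flip: add_divide_distrib)
  have "(\<integral>\<^sup>+x. ennreal (exp ((norm (f x + g x))\<^sup>2 / (c + d)\<^sup>2)) \<partial>M)
      \<le> (\<integral>\<^sup>+x. ennreal s * ennreal (exp ((norm (f x))\<^sup>2 / c\<^sup>2))
            + ennreal t * ennreal (exp ((norm (g x))\<^sup>2 / d\<^sup>2)) \<partial>M)"
  proof (rule nn_integral_mono)
    fix x
    have "exp ((norm (f x + g x))\<^sup>2 / (c + d)\<^sup>2) \<le> exp ((norm (f x) + norm (g x))\<^sup>2 / (c + d)\<^sup>2)"
      by (simp add: divide_right_mono power_mono norm_triangle_ineq)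
    also have "\<dots> \<le> s * exp ((norm (f x))\<^sup>2 / c\<^sup>2) + t * exp ((norm (g x))\<^sup>2 / d\<^sup>2)"
      unfolding s_def t_def by (rule exp_square_convex) (use cd in auto)
    finally show "ennreal (exp ((norm (f x + g x))\<^sup>2 / (c + d)\<^sup>2))
        \<le> ennreal s * ennreal (exp ((norm (f x))\<^sup>2 / c\<^sup>2))
          + ennreal t * ennreal (exp ((norm (g x))\<^sup>2 / d\<^sup>2))"
      using st by (simp flip: ennreal_mult ennreal_plus)
  qed
  also have "\<dots> = ennreal s * (\<integral>\<^sup>+x. ennreal (exp ((norm (f x))\<^sup>2 / c\<^sup>2)) \<partial>M)
      + ennreal t * (\<integral>\<^sup>+x. ennreal (exp ((norm (g x))\<^sup>2 / d\<^sup>2)) \<partial>M)"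
    by (simp add: nn_integral_add nn_integral_cmult)
  also have "\<dots> \<le> ennreal s * 2 + ennreal t * 2"
    using f g by (intro add_mono mult_left_mono) (auto simp: phi2_admissible_iff)
  also have "\<dots> = (ennreal s + ennreal t) * 2" by (simp add: distrib_right)
  also have "\<dots> = 2" using st by (simp flip: ennreal_plus)
  finally show "c + d \<in> phi2_admissible M (\<lambda>x. f x + g x)"
    using cd by (simp add: phi2_admissible_iff)
next
  fix f :: "'a \<Rightarrow> 'k" and c :: real
  assume [measurable]: "f \<in> borel_measurable M" and f: "c \<in> phi2_admissible M f" and c: "0 < c"
  have "(\<integral>\<^sup>+x. ennreal (norm (f x)) \<partial>M)
      \<le> (\<integral>\<^sup>+x. ennreal (c / 2) * ennreal (exp ((norm (f x))\<^sup>2 / c\<^sup>2)) \<partial>M)"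
  proof (rule nn_integral_mono)
    fix x
    \<comment> \<open>With \<open>y = norm (f x) / c\<close>, the chain
      \<open>2 * y \<le> 1 + y\<^sup>2 \<le> exp (y\<^sup>2)\<close> has just the factor 2 that the
      admissible value 2 of the integral uses up, so the \<open>L\<^sub>1\<close> bound is
      \<open>c\<close> itself.\<close>
    have "2 * (norm (f x) / c) \<le> 1 + (norm (f x) / c)\<^sup>2"
      using sum_squares_bound[of 1 "norm (f x) / c"] by simp
    also have "\<dots> \<le> exp ((norm (f x) / c)\<^sup>2)" by (rule exp_ge_add_one_self)
    finally have "norm (f x) \<le> c / 2 * exp ((norm (f x))\<^sup>2 / c\<^sup>2)"
      using c by (simp add: field_simps)
    then show "ennreal (norm (f x)) \<le> ennreal (c / 2) * ennreal (exp ((norm (f x))\<^sup>2 / c\<^sup>2))"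
      using c by (simp flip: ennreal_mult)
  qed
  also have "\<dots> = ennreal (c / 2) * (\<integral>\<^sup>+x. ennreal (exp ((norm (f x))\<^sup>2 / c\<^sup>2)) \<partial>M)"
    by (simp add: nn_integral_cmult)
  also have "\<dots> \<le> ennreal (c / 2) * ennreal 2"
    using f by (intro mult_left_mono) (auto simp: phi2_admissible_iff)
  also have "\<dots> = ennreal (c / 2 * 2)"
    by (rule ennreal_mult[symmetric]) (use c in auto)
  also have "c / 2 * 2 = c" by simp
  finally show "(\<integral>\<^sup>+x. ennreal (norm (f x)) \<partial>M) \<le> ennreal c" .
next
  fix h :: "nat \<Rightarrow> 'a \<Rightarrow> 'k" and g and c :: real
  assume [measurable]: "\<And>n. h n \<in> borel_measurable M" "g \<in> borel_measurable M"
    and lim: "AE x in M. (\<lambda>n. h n x) \<longlonglongrightarrow> g x" and h: "\<And>n. c \<in> phi2_admissible M (h n)" and c: "0 < c"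
  have "(\<integral>\<^sup>+x. ennreal (exp ((norm (g x))\<^sup>2 / c\<^sup>2)) \<partial>M)
      = (\<integral>\<^sup>+x. liminf (\<lambda>n. ennreal (exp ((norm (h n x))\<^sup>2 / c\<^sup>2))) \<partial>M)"
  proof (rule nn_integral_cong_AE)
    show "AE x in M. ennreal (exp ((norm (g x))\<^sup>2 / c\<^sup>2))
        = liminf (\<lambda>n. ennreal (exp ((norm (h n x))\<^sup>2 / c\<^sup>2)))"
      using lim
    proof eventually_elim
      case (elim x)
      have "(\<lambda>n. ennreal (exp ((norm (h n x))\<^sup>2 / c\<^sup>2))) \<longlonglongrightarrow> ennreal (exp ((norm (g x))\<^sup>2 / c\<^sup>2))"
        using c by (intro tendsto_ennrealI tendsto_intros elim) auto
      then show ?case by (intro lim_imp_Liminf[symmetric]) auto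
    qed
  qed
  also have "\<dots> \<le> liminf (\<lambda>n. \<integral>\<^sup>+x. ennreal (exp ((norm (h n x))\<^sup>2 / c\<^sup>2)) \<partial>M)"
    by (rule nn_integral_liminf) simp
  also have "\<dots> \<le> 2"
    using h by (intro Liminf_le) (auto simp: phi2_admissible_iff)
  finally show "c \<in> phi2_admissible M g" using c by (simp add: phi2_admissible_iff)
qed

lemma (in prob_space) gauge_space_Lphi2:
  "gauge_space M (L0_module M) rv_rep (\<lambda>f c. c \<in> phi2_admissible M f)
    (Lphi2_space M :: ('x, 'a, 'k::{real_normed_field, euclidean_space}) point nspace)"
proof (intro gauge_space.intro L0_model_L0_module gauge_Lphi2 gauge_space_axioms.intro)
  have pos: "0 < c" if "c \<in> phi2_admissible M f" for c and f :: "'a \<Rightarrow> 'k"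
    using that by (simp add: phi2_admissible_def)
  have "pts (Lphi2_space M :: ('x, 'a, 'k) point nspace)
      = {u \<in> carrier (L0_module M). phi2_admissible M (rv_rep u) \<noteq> {}}"
    unfolding Lphi2_space_def nspace.simps
  proof (rule rv_class_image_eq)
    fix f g :: "'a \<Rightarrow> 'k"
    assume fg: "f \<in> borel_measurable M" "g \<in> borel_measurable M" "AE x in M. g x = f x"
      and "phi2_admissible M f \<noteq> {}"
    then obtain c where c: "c \<in> phi2_admissible M f" by blast
    have "AE x in M. f x = g x" using fg(3) by eventually_elim simp
    from gauge.adm_cong[OF gauge_Lphi2 fg(1,2) this c pos[OF c]]
    show "phi2_admissible M g \<noteq> {}" by blast
  qed
  then show "pts (Lphi2_space M :: ('x, 'a, 'k) point nspace)
      = {u \<in> carrier (L0_module M). \<exists>c>0. c \<in> phi2_admissible M (rv_rep u)}"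
    using pos by blast
  fix u :: "('x, 'a, 'k) point"
  have "{c. 0 < c \<and> c \<in> phi2_admissible M (rv_rep u)} = phi2_admissible M (rv_rep u)"
    using pos by blast
  then show "nrm (Lphi2_space M) u = Inf {c. 0 < c \<and> c \<in> phi2_admissible M (rv_rep u)}"
    by (simp add: Lphi2_space_def)
qed

section \<open>Subgaussian maximal inequalities\<close>

lemma nn_integral_normal_density:
  assumes "0 < \<sigma>"
  shows "(\<integral>\<^sup>+x. ennreal (normal_density \<mu> \<sigma> x) \<partial>lborel) = 1"
  using assms by (subst nn_integral_eq_integral) auto

text \<open>Completing the square: the factor \<open>exp (c * g)\<close> shifts the mean of the
  density to \<open>c\<close>, at the price of the constant
  \<open>exp (c\<^sup>2 / 2)\<close>.\<close>

lemma nn_integral_exp_std_normal: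
  "(\<integral>\<^sup>+g. ennreal (std_normal_density g * exp (c * g)) \<partial>lborel) = ennreal (exp (c\<^sup>2 / 2))"
proof -
  have "std_normal_density g * exp (c * g) = exp (c\<^sup>2 / 2) * normal_density c 1 g" for g
    by (simp add: normal_density_def power2_eq_square field_simps flip: exp_add)
  then have "(\<integral>\<^sup>+g. ennreal (std_normal_density g * exp (c * g)) \<partial>lborel)
      = (\<integral>\<^sup>+g. ennreal (exp (c\<^sup>2 / 2)) * ennreal (normal_density c 1 g) \<partial>lborel)"
    by (simp add: ennreal_mult)
  also have "\<dots> = ennreal (exp (c\<^sup>2 / 2))"
    by (subst nn_integral_cmult) (auto simp: nn_integral_normal_density)
  finally show ?thesis .
qed

text \<open>Since \<open>1 / 2 - 3 / 8 = 1 / (2 * 2\<^sup>2)\<close>, the integrand is an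
  unnormalised Gaussian of standard deviation 2, whose mass is 2. This is the origin of
  \<open>8 / 3\<close>.\<close>

lemma nn_integral_exp_square_std_normal:
  "(\<integral>\<^sup>+g. ennreal (std_normal_density g * exp (3 / 8 * g\<^sup>2)) \<partial>lborel) = 2"
proof -
  have "std_normal_density g * exp (3 / 8 * g\<^sup>2) = 2 * normal_density 0 2 g" for g
  proof -
    have "sqrt (2 * pi * 2\<^sup>2) = sqrt (2 * pi) * 2" by (simp only: real_sqrt_mult real_sqrt_abs abs_numeral)
    then show ?thesis by (simp add: normal_density_def field_simps flip: exp_add)
  qed
  then have "(\<integral>\<^sup>+g. ennreal (std_normal_density g * exp (3 / 8 * g\<^sup>2)) \<partial>lborel)
      = (\<integral>\<^sup>+g. 2 * ennreal (normal_density 0 2 g) \<partial>lborel)"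
    by (simp add: ennreal_mult)
  also have "\<dots> = 2"
    by (subst nn_integral_cmult) (auto simp: nn_integral_normal_density)
  finally show ?thesis .
qed

text \<open>Writing \<open>exp (v\<^sup>2 / 2)\<close> as the exponential moment of \<open>v\<close> times an independent standard Gaussian
  turns the subgaussian bound into a Gaussian integral, which equals 2 for the factor \<open>3 / 8\<close>.\<close>

lemma (in prob_space) nn_integral_exp_square_subgaussian:
  fixes v :: "'a \<Rightarrow> real"
  assumes [measurable]: "v \<in> borel_measurable M" and \<tau>: "0 < \<tau>"
    and sub: "\<And>t. (\<integral>\<^sup>+x. ennreal (exp (t * v x)) \<partial>M) \<le> ennreal (exp (\<tau> * t\<^sup>2 / 2))"
  shows "(\<integral>\<^sup>+x. ennreal (exp (3 / 8 * (v x)\<^sup>2 / \<tau>)) \<partial>M) \<le> 2"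
proof -
  interpret pair_sigma_finite M lborel ..
  \<comment> \<open>\<open>b\<close> is chosen so that \<open>(b * v)\<^sup>2 / 2\<close> is the
    exponent wanted; the subgaussian bound then leaves
    \<open>\<tau> * (b * g)\<^sup>2 / 2 = 3 / 8 * g\<^sup>2\<close>, free of
    \<open>\<tau>\<close>.\<close>
  define b where "b = sqrt (3 / (4 * \<tau>))"
  have b: "b\<^sup>2 = 3 / (4 * \<tau>)" using \<tau> by (simp add: b_def)
  have "(\<integral>\<^sup>+x. ennreal (exp (3 / 8 * (v x)\<^sup>2 / \<tau>)) \<partial>M)
      = (\<integral>\<^sup>+x. (\<integral>\<^sup>+g. ennreal (std_normal_density g * exp (b * v x * g)) \<partial>lborel) \<partial>M)"
    unfolding nn_integral_exp_std_normal by (simp add: power_mult_distrib b field_simps)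
  also have "\<dots> = (\<integral>\<^sup>+g. (\<integral>\<^sup>+x. ennreal (std_normal_density g * exp (b * v x * g)) \<partial>M) \<partial>lborel)"
    by (rule Fubini'[symmetric]) measurable
  also have "\<dots> = (\<integral>\<^sup>+g. ennreal (std_normal_density g) * (\<integral>\<^sup>+x. ennreal (exp ((b * g) * v x)) \<partial>M) \<partial>lborel)"
    by (subst nn_integral_cmult[symmetric]) (auto simp: ennreal_mult mult_ac)
  also have "\<dots> \<le> (\<integral>\<^sup>+g. ennreal (std_normal_density g) * ennreal (exp (\<tau> * (b * g)\<^sup>2 / 2)) \<partial>lborel)"
    by (intro nn_integral_mono mult_left_mono sub) auto
  also have "\<dots> = (\<integral>\<^sup>+g. ennreal (std_normal_density g * exp (3 / 8 * g\<^sup>2)) \<partial>lborel)"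
    using \<tau> by (simp add: ennreal_mult power_mult_distrib b field_simps)
  also have "\<dots> = 2" by (rule nn_integral_exp_square_std_normal)
  finally show ?thesis .
qed

lemma sum_ennreal_mult:
  assumes "\<And>i. i \<in> I \<Longrightarrow> 0 \<le> w i" "\<And>i. i \<in> I \<Longrightarrow> 0 \<le> e i"
  shows "(\<Sum>i\<in>I. ennreal (w i) * ennreal (e i)) = ennreal (\<Sum>i\<in>I. w i * e i)"
proof -
  have "(\<Sum>i\<in>I. ennreal (w i) * ennreal (e i)) = (\<Sum>i\<in>I. ennreal (w i * e i))"
    by (intro sum.cong refl ennreal_mult[symmetric] assms)
  also have "\<dots> = ennreal (\<Sum>i\<in>I. w i * e i)"
    by (rule sum_ennreal) (simp add: assms)
  finally show ?thesis .
qed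

text \<open>The coordinates of \<open>f\<close> need not be independent, so their exponentials are
  not multiplied but averaged, by convexity of \<open>exp\<close>. The weights
  \<open>\<tau> b / \<rho>\<close> are such that each coordinate meets the exponent normalised by
  its own proxy.\<close>

lemma (in prob_space) nn_integral_exp_norm_square_subgaussian:
  fixes f :: "'a \<Rightarrow> 'k::euclidean_space"
  assumes [measurable]: "f \<in> borel_measurable M"
    and \<sigma>: "\<And>b. b \<in> Basis \<Longrightarrow> 0 \<le> \<sigma> b"
    and sub: "\<And>b t. b \<in> Basis \<Longrightarrow>
      (\<integral>\<^sup>+x. ennreal (exp (t * (f x \<bullet> b))) \<partial>M) \<le> ennreal (exp (\<sigma> b * t\<^sup>2 / 2))"
    and \<rho>: "(\<Sum>b\<in>Basis. \<sigma> b) < \<rho>"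
  shows "(\<integral>\<^sup>+x. ennreal (exp (3 / 8 * (norm (f x))\<^sup>2 / \<rho>)) \<partial>M) \<le> 2"
proof -
  \<comment> \<open>Some \<open>\<sigma> b\<close> may vanish, while \<open>\<tau> b\<close> appears
    as a denominator. Spreading the slack below \<open>\<rho>\<close> evenly makes every
    \<open>\<tau> b\<close> positive and their sum exactly \<open>\<rho>\<close>.\<close>
  define \<tau> where "\<tau> b = \<sigma> b + (\<rho> - (\<Sum>b\<in>Basis. \<sigma> b)) / DIM('k)" for b
  have \<tau>: "0 < \<tau> b" if "b \<in> Basis" for b
    using \<sigma>[OF that] \<rho> by (simp add: \<tau>_def add_nonneg_pos)
  have sum_\<tau>: "(\<Sum>b\<in>Basis. \<tau> b) = \<rho>" by (simp add: \<tau>_def sum.distrib)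
  have "0 < \<rho>" using \<rho> sum_nonneg[of Basis \<sigma>] \<sigma> by simp
  have weights: "(\<Sum>b\<in>Basis. \<tau> b / \<rho>) = 1"
    using \<open>0 < \<rho>\<close> by (simp add: sum_\<tau> flip: sum_divide_distrib)
  have "(\<integral>\<^sup>+x. ennreal (exp (3 / 8 * (norm (f x))\<^sup>2 / \<rho>)) \<partial>M)
      \<le> (\<integral>\<^sup>+x. (\<Sum>b\<in>Basis. ennreal (\<tau> b / \<rho>) * ennreal (exp (3 / 8 * (f x \<bullet> b)\<^sup>2 / \<tau> b))) \<partial>M)"
  proof (rule nn_integral_mono)
    fix x
    have "3 / 8 * (norm (f x))\<^sup>2 / \<rho> = (\<Sum>b\<in>Basis. 3 / 8 * (f x \<bullet> b)\<^sup>2 / \<rho>)"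
      unfolding power2_norm_eq_inner euclidean_inner[of "f x" "f x"]
      by (simp add: power2_eq_square sum_distrib_left sum_divide_distrib)
    also have "\<dots> = (\<Sum>b\<in>Basis. \<tau> b / \<rho> * (3 / 8 * (f x \<bullet> b)\<^sup>2 / \<tau> b))"
      using \<tau> by (intro sum.cong) (auto simp: less_imp_neq[symmetric])
    finally have "exp (3 / 8 * (norm (f x))\<^sup>2 / \<rho>)
        = exp (\<Sum>b\<in>Basis. \<tau> b / \<rho> * (3 / 8 * (f x \<bullet> b)\<^sup>2 / \<tau> b))" by simp
    also have "\<dots> \<le> (\<Sum>b\<in>Basis. \<tau> b / \<rho> * exp (3 / 8 * (f x \<bullet> b)\<^sup>2 / \<tau> b))"
      using convex_on_sum[OF _ _ convex_on_exp[of 1] weights, of "\<lambda>b. 3 / 8 * (f x \<bullet> b)\<^sup>2 / \<tau> b"]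
        \<tau> \<open>0 < \<rho>\<close> by (simp add: less_imp_le)
    finally have "ennreal (exp (3 / 8 * (norm (f x))\<^sup>2 / \<rho>))
        \<le> ennreal (\<Sum>b\<in>Basis. \<tau> b / \<rho> * exp (3 / 8 * (f x \<bullet> b)\<^sup>2 / \<tau> b))"
      by (rule ennreal_leI)
    then show "ennreal (exp (3 / 8 * (norm (f x))\<^sup>2 / \<rho>))
        \<le> (\<Sum>b\<in>Basis. ennreal (\<tau> b / \<rho>) * ennreal (exp (3 / 8 * (f x \<bullet> b)\<^sup>2 / \<tau> b)))"
      by (subst sum_ennreal_mult) (use \<tau> \<open>0 < \<rho>\<close> in \<open>auto intro: less_imp_le\<close>)
  qed
  also have "\<dots> = (\<Sum>b\<in>Basis. ennreal (\<tau> b / \<rho>) * (\<integral>\<^sup>+x. ennreal (exp (3 / 8 * (f x \<bullet> b)\<^sup>2 / \<tau> b)) \<partial>M))"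
    by (simp add: nn_integral_sum nn_integral_cmult)
  also have "\<dots> \<le> (\<Sum>b\<in>Basis. ennreal (\<tau> b / \<rho>) * 2)"
  proof (intro sum_mono mult_left_mono nn_integral_exp_square_subgaussian)
    fix b :: 'k and t assume b: "b \<in> Basis"
    have "\<sigma> b * t\<^sup>2 / 2 \<le> \<tau> b * t\<^sup>2 / 2"
      using \<rho> by (intro divide_right_mono mult_right_mono) (auto simp: \<tau>_def)
    then show "(\<integral>\<^sup>+x. ennreal (exp (t * (f x \<bullet> b))) \<partial>M) \<le> ennreal (exp (\<tau> b * t\<^sup>2 / 2))"
      by (intro order_trans[OF sub[OF b]] ennreal_leI) simp
  qed (auto simp: \<tau>)
  also have "\<dots> = (\<Sum>b\<in>Basis. ennreal (\<tau> b / \<rho>)) * 2"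
    by (rule sum_distrib_right[symmetric])
  also have "(\<Sum>b\<in>Basis. ennreal (\<tau> b / \<rho>)) = 1"
    using \<tau> \<open>0 < \<rho>\<close> weights by (subst sum_ennreal) (auto intro: less_imp_le)
  finally show ?thesis by simp
qed

text \<open>The tangent to the concave function \<open>y \<mapsto> y powr (1 / L)\<close> at \<open>y = 2 * N\<close>, where its value is 2.\<close>

lemma exp_divide_le_tangent:
  fixes y L :: real
  assumes "1 \<le> N" and L_eq: "L = 1 + log 2 (real N)"
  shows "exp (y / L) \<le> 2 * (1 - 1 / L) + 1 / (L * N) * exp y"
proof -
  have N: "0 < real N" using assms(1) by simp
  have L: "1 \<le> L" using assms(1) by (simp add: L_eq)
  \<comment> \<open>\<open>L\<close> is the exponent whose root takes \<open>2 * N\<close> to 2;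
    this forces the binary logarithm.\<close>
  have L2: "L * ln 2 = ln (2 * real N)"
    using N by (simp add: L_eq ln_mult log_def distrib_right)
  have "exp (y / L - ln 2) = exp ((1 - 1 / L) * 0 + 1 / L * (y - L * ln 2))"
    using L by (simp add: right_diff_distrib)
  also have "\<dots> \<le> (1 - 1 / L) * exp 0 + 1 / L * exp (y - L * ln 2)"
    using convex_onD[OF convex_on_exp[of 1], of "1 / L" 0 "y - L * ln 2"] L by simp
  also have "exp (y - L * ln 2) = exp y / (2 * real N)"
    using N by (simp add: L2 exp_diff)
  finally have "exp (y / L) \<le> 2 * ((1 - 1 / L) * exp 0 + 1 / L * (exp y / (2 * real N)))"
    by (simp add: exp_diff)
  also have "\<dots> = 2 * (1 - 1 / L) + 1 / (L * N) * exp y"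
    using N by (simp add: distrib_left)
  finally show ?thesis .
qed

text \<open>The largest exponential is below the sum of all, whose integral is at most
  \<open>2 * N\<close>, and the power \<open>1 / L\<close> should bring this down to 2 by Jensen's
  inequality. The tangent replaces the power by an affine function, which is integrated term by
  term. \<open>g\<close> is only dominated pointwise by one of the \<open>f j\<close>, since it will
  be a value of the linearised operator and not itself a maximum.\<close>

lemma (in prob_space) max_subgaussian_phi2_admissible:
  fixes f :: "nat \<Rightarrow> 'a \<Rightarrow> 'k::{real_normed_field, euclidean_space}"
  assumes N: "1 \<le> N"
    and [measurable]: "\<And>j. f j \<in> borel_measurable M" "g \<in> borel_measurable M"
    and \<sigma>: "\<And>j b. j < N \<Longrightarrow> b \<in> Basis \<Longrightarrow> 0 \<le> \<sigma> j b"
    and sub: "\<And>j b t. j < N \<Longrightarrow> b \<in> Basis \<Longrightarrow>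
      (\<integral>\<^sup>+x. ennreal (exp (t * (f j x \<bullet> b))) \<partial>M) \<le> ennreal (exp (\<sigma> j b * t\<^sup>2 / 2))"
    and \<rho>: "\<And>j. j < N \<Longrightarrow> (\<Sum>b\<in>Basis. \<sigma> j b) \<le> \<rho>"
    and d: "0 < d" "8 / 3 * (1 + log 2 N) * \<rho> < d\<^sup>2"
    and g: "\<And>x. \<exists>j<N. norm (g x) \<le> norm (f j x)"
  shows "d \<in> phi2_admissible M g"
proof -
  define L where "L = 1 + log 2 (real N)"
  have L: "1 \<le> L" using N by (simp add: L_def)
  \<comment> \<open>With this \<open>r\<close>, \<open>(norm (f j x))\<^sup>2 / d\<^sup>2\<close> is
    \<open>1 / L\<close> times the exponent of the preceding estimate, and the hypothesis on
    \<open>d\<close> says that \<open>\<rho> < r\<close>.\<close>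
  define r where "r = 3 / 8 * d\<^sup>2 / L"
  have r: "0 < r" "\<rho> < r" using L d by (auto simp: r_def field_simps simp flip: L_def)
  have scale: "(norm (f j x))\<^sup>2 / d\<^sup>2 = 3 / 8 * (norm (f j x))\<^sup>2 / r / L" for j x
    using L d(1) by (simp add: r_def field_simps)
  \<comment> \<open>\<open>c\<close> and \<open>w\<close> are the coefficients of the tangent, which
    takes the value 2 at \<open>2 * N\<close>.\<close>
  define c where "c = 2 * (1 - 1 / L)"
  define w where "w = 1 / (L * N)"
  have cw: "0 \<le> c" "0 \<le> w" "c + w * (2 * real N) = 2"
    using L N by (auto simp: c_def w_def field_simps)
  define H where "H j x = exp (3 / 8 * (norm (f j x))\<^sup>2 / r)" for j x
  have [measurable]: "H j \<in> borel_measurable M" for j unfolding H_def by measurable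
  have "(\<integral>\<^sup>+x. ennreal (exp ((norm (g x))\<^sup>2 / d\<^sup>2)) \<partial>M)
      \<le> (\<integral>\<^sup>+x. ennreal c + ennreal w * (\<Sum>j<N. ennreal (H j x)) \<partial>M)"
  proof (rule nn_integral_mono)
    fix x
    obtain j where j: "j < N" "norm (g x) \<le> norm (f j x)" using g by blast
    have "exp ((norm (g x))\<^sup>2 / d\<^sup>2) \<le> exp ((norm (f j x))\<^sup>2 / d\<^sup>2)"
      using j(2) by (simp add: divide_right_mono power_mono)
    also have "\<dots> \<le> c + w * H j x"
      unfolding scale c_def w_def H_def by (rule exp_divide_le_tangent[OF N L_def])
    also have "\<dots> \<le> c + w * (\<Sum>j<N. H j x)"
      using j(1) cw(2) by (intro add_left_mono mult_left_mono member_le_sum) (auto simp: H_def)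
    finally have "ennreal (exp ((norm (g x))\<^sup>2 / d\<^sup>2)) \<le> ennreal (c + w * (\<Sum>j<N. H j x))"
      by (rule ennreal_leI)
    also have "\<dots> = ennreal c + ennreal w * ennreal (\<Sum>j<N. H j x)"
      using cw by (simp add: ennreal_plus ennreal_mult sum_nonneg H_def)
    also have "ennreal (\<Sum>j<N. H j x) = (\<Sum>j<N. ennreal (H j x))"
      by (rule sum_ennreal[symmetric]) (simp add: H_def)
    finally show "ennreal (exp ((norm (g x))\<^sup>2 / d\<^sup>2)) \<le> ennreal c + ennreal w * (\<Sum>j<N. ennreal (H j x))" .
  qed
  also have "\<dots> = ennreal c + ennreal w * (\<Sum>j<N. \<integral>\<^sup>+x. ennreal (H j x) \<partial>M)"
    by (simp add: nn_integral_add nn_integral_cmult nn_integral_sum emeasure_space_1 del: sum_ennreal)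
  also have "\<dots> \<le> ennreal c + ennreal w * (\<Sum>j<N. ennreal 2)"
  proof (intro add_left_mono mult_left_mono sum_mono)
    fix j assume "j \<in> {..<N}"
    then show "(\<integral>\<^sup>+x. ennreal (H j x) \<partial>M) \<le> ennreal 2"
      using nn_integral_exp_norm_square_subgaussian[of "f j" "\<sigma> j" r] \<sigma> sub \<rho>[of j] r(2)
      by (simp add: H_def)
  qed simp
  also have "(\<Sum>j<N. ennreal 2) = ennreal (2 * real N)"
    by (subst sum_ennreal) (auto simp: mult.commute)
  also have "ennreal c + ennreal w * ennreal (2 * real N) = ennreal (c + w * (2 * real N))"
    using cw(1,2) by (subst ennreal_mult[symmetric], simp, simp, subst ennreal_plus[symmetric]) auto
  also have "\<dots> = 2" by (simp add: cw(3))
  finally show ?thesis using d(1) by (simp add: phi2_admissible_iff)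
qed

section \<open>Sums of independent variables\<close>

text \<open>Independence factorises the exponential moment, so the variance proxies of the summands
  add up. The direction \<open>b\<close> is fixed, which lets the proxies depend on it.\<close>

lemma (in prob_space) nn_integral_exp_inner_sum_le:
  fixes \<gamma> :: "nat \<Rightarrow> 'a \<Rightarrow> 'k::{real_normed_field, euclidean_space}"
  assumes indep: "indep_vars (\<lambda>_. borel) \<gamma> UNIV"
    and sub: "\<And>i. i < K \<Longrightarrow>
      (\<integral>\<^sup>+x. ennreal (exp (t * ((\<gamma> i x * a i) \<bullet> b))) \<partial>M) \<le> ennreal (exp (\<sigma> i * t\<^sup>2 / 2))"
  shows "(\<integral>\<^sup>+x. ennreal (exp (t * ((\<Sum>i<K. \<gamma> i x * a i) \<bullet> b))) \<partial>M)
    \<le> ennreal (exp ((\<Sum>i<K. \<sigma> i) * t\<^sup>2 / 2))"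
proof -
  have "indep_vars (\<lambda>_. borel) (\<lambda>i x. ennreal (exp (t * ((\<gamma> i x * a i) \<bullet> b)))) UNIV"
    by (rule indep_vars_compose2[OF indep]) measurable
  then have "indep_vars (\<lambda>_. borel) (\<lambda>i x. ennreal (exp (t * ((\<gamma> i x * a i) \<bullet> b)))) {..<K}"
    by (rule indep_vars_subset) simp
  then have "(\<integral>\<^sup>+x. (\<Prod>i<K. ennreal (exp (t * ((\<gamma> i x * a i) \<bullet> b)))) \<partial>M)
      = (\<Prod>i<K. \<integral>\<^sup>+x. ennreal (exp (t * ((\<gamma> i x * a i) \<bullet> b))) \<partial>M)"
    by (intro indep_vars_nn_integral) auto
  also have "\<dots> \<le> (\<Prod>i<K. ennreal (exp (\<sigma> i * t\<^sup>2 / 2)))"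
    by (intro prod_mono_ennreal) (use sub in auto)
  finally show ?thesis
    by (simp add: prod_ennreal inner_sum_left sum_distrib_left sum_distrib_right sum_divide_distrib
        flip: exp_sum)
qed

text \<open>Multiplication by \<open>c\<close> scales every norm by \<open>norm c\<close>;
  polarisation carries this over to inner products.\<close>

lemma inner_mult_mult_same:
  fixes c x y :: "'k::{real_normed_field, real_inner}"
  shows "(c * x) \<bullet> (c * y) = (norm c)\<^sup>2 * (x \<bullet> y)"
  unfolding dot_norm distrib_left[symmetric] norm_mult power_mult_distrib
  by (simp add: algebra_simps)

text \<open>The infimum \<open>sg M f\<close> is itself admissible: the bound holds for every larger
  \<open>s\<close> and is continuous in \<open>s\<close>, so it survives the limit from the
  right.\<close>

lemma (in prob_space) nn_integral_exp_re_part_sg: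
  fixes f :: "'a \<Rightarrow> 'k::{real_normed_field, euclidean_space}"
  assumes "subgaussian M f"
  shows "(\<integral>\<^sup>+x. ennreal (exp (re_part (z * f x))) \<partial>M) \<le> ennreal (exp ((sg M f)\<^sup>2 * (norm z)\<^sup>2 / 2))"
proof (rule tendsto_lowerbound)
  have "((\<lambda>s. ennreal (exp (s\<^sup>2 * (norm z)\<^sup>2 / 2))) \<longlongrightarrow> ennreal (exp ((sg M f)\<^sup>2 * (norm z)\<^sup>2 / 2)))
      (at_right (sg M f))"
    by (intro tendsto_ennrealI tendsto_intros) auto
  then show "((\<lambda>s. ennreal (exp (s\<^sup>2 * (norm z)\<^sup>2 / 2))) \<longlongrightarrow> ennreal (exp ((sg M f)\<^sup>2 * (norm z)\<^sup>2 / 2)))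
      (at_right (sg M f))" .
  have "(\<integral>\<^sup>+x. ennreal (exp (re_part (z * f x))) \<partial>M) \<le> ennreal (exp (s\<^sup>2 * (norm z)\<^sup>2 / 2))"
    if s: "sg M f < s" for s
  proof -
    have "sg_admissible M f \<noteq> {}" using assms by (simp add: subgaussian_def)
    then obtain r where r: "r \<in> sg_admissible M f" "r < s"
      using s cInf_lessD[of "sg_admissible M f" s] by (auto simp: sg_def)
    then have "(\<integral>\<^sup>+x. ennreal (exp (re_part (z * f x))) \<partial>M) \<le> ennreal (exp (r\<^sup>2 * (norm z)\<^sup>2 / 2))"
      by (simp add: sg_admissible_def)
    also have "\<dots> \<le> ennreal (exp (s\<^sup>2 * (norm z)\<^sup>2 / 2))"
      using r by (intro ennreal_leI) (auto simp: sg_admissible_def intro!: divide_right_mono mult_right_mono power_mono)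
    finally show ?thesis .
  qed
  then show "\<forall>\<^sub>F s in at_right (sg M f).
      (\<integral>\<^sup>+x. ennreal (exp (re_part (z * f x))) \<partial>M) \<le> ennreal (exp (s\<^sup>2 * (norm z)\<^sup>2 / 2))"
    by (auto simp: eventually_at_filter)
qed simp

lemma (in prob_space) nn_integral_exp_inner_subgaussian:
  fixes f :: "'a \<Rightarrow> 'k::{real_normed_field, euclidean_space}"
  assumes "subgaussian M f" "sg M f \<le> s" "b \<in> Basis"
  shows "(\<integral>\<^sup>+x. ennreal (exp (t * ((f x * a) \<bullet> b))) \<partial>M) \<le> ennreal (exp ((s\<^sup>2 * (norm a)\<^sup>2) * t\<^sup>2 / 2))"
proof -
  have b: "norm b = 1" "b \<noteq> 0" using assms(3) by (auto simp: nonzero_Basis)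
  have sg: "0 \<le> sg M f"
    unfolding sg_def using assms(1)
    by (intro cInf_greatest) (auto simp: subgaussian_def sg_admissible_def)
  \<comment> \<open>As \<open>norm b = 1\<close>, multiplication by \<open>inverse b\<close> is an
    isometry that takes \<open>b\<close> to 1, so the coordinate along \<open>b\<close> becomes a
    \<open>re_part\<close>.\<close>
  define z where "z = of_real t * inverse b * a"
  have "t * ((f x * a) \<bullet> b) = re_part (z * f x)" for x
  proof -
    have "(f x * a) \<bullet> b = (inverse b * (f x * a)) \<bullet> (inverse b * b)"
      unfolding inner_mult_mult_same using b by (simp add: norm_inverse)
    then show ?thesis
      using b by (simp add: z_def re_part_def mult_ac flip: scaleR_conv_of_real inner_scaleR_left)
  qed
  then have "(\<integral>\<^sup>+x. ennreal (exp (t * ((f x * a) \<bullet> b))) \<partial>M)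
      \<le> ennreal (exp ((sg M f)\<^sup>2 * (norm z)\<^sup>2 / 2))"
    using nn_integral_exp_re_part_sg[OF assms(1), of z] by simp
  also have "\<dots> \<le> ennreal (exp (s\<^sup>2 * (norm z)\<^sup>2 / 2))"
    using assms(2) sg by (intro ennreal_leI) (auto intro!: divide_right_mono mult_right_mono power_mono)
  also have "s\<^sup>2 * (norm z)\<^sup>2 = (s\<^sup>2 * (norm a)\<^sup>2) * t\<^sup>2"
    using b by (simp add: z_def norm_mult norm_inverse power_mult_distrib)
  finally show ?thesis .
qed

text \<open>The analytic inequality behind Hoeffding's lemma,
  \<open>- h * p + ln (1 + p * (exp h - 1)) \<le> h\<^sup>2 / 8\<close>, at \<open>h = 2 * y\<close>
  and \<open>p = 1 / 2\<close>, where the left-hand side is the logarithm of \<open>cosh y\<close>.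
  Evenness covers negative arguments.\<close>

lemma cosh_le_exp_square: "cosh (x::real) \<le> exp (x\<^sup>2 / 2)"
proof -
  have *: "cosh y \<le> exp (y\<^sup>2 / 2)" if "0 \<le> y" for y :: real
  proof -
    have "1 + 1 / 2 * (exp (2 * y) - 1) = 1 / 2 + 1 / 2 * exp (2 * y)" by (simp add: algebra_simps)
    also have "\<dots> > 0" by (simp add: add_pos_pos)
    finally have pos: "0 < 1 + 1 / 2 * (exp (2 * y) - 1)" .
    have "- (2 * y) * (1 / 2) + ln (1 + 1 / 2 * (exp (2 * y) - 1)) \<le> (2 * y)\<^sup>2 / 8"
      by (rule Hoeffdings_lemma_aux) (use that in auto)
    then have "exp (- y + ln (1 + 1 / 2 * (exp (2 * y) - 1))) \<le> exp (y\<^sup>2 / 2)"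
      by (simp add: power2_eq_square)
    also have "exp (- y + ln (1 + 1 / 2 * (exp (2 * y) - 1))) = cosh y"
      unfolding exp_add exp_ln[OF pos]
      by (simp add: cosh_field_def field_simps flip: exp_add)
    finally show ?thesis .
  qed
  show ?thesis using *[of x] *[of "- x"] by (cases "0 \<le> x") auto
qed

lemma (in prob_space) rademacher_AE:
  fixes \<epsilon> :: "'a \<Rightarrow> 'k::{real_normed_field, euclidean_space}"
  assumes "rademacher M \<epsilon>"
  shows "AE x in M. \<epsilon> x = 1 \<or> \<epsilon> x = -1"
proof -
  have [measurable]: "\<epsilon> \<in> borel_measurable M" using assms by (simp add: rademacher_def)
  have "prob ({x \<in> space M. \<epsilon> x = 1} \<union> {x \<in> space M. \<epsilon> x = -1})
      = prob {x \<in> space M. \<epsilon> x = 1} + prob {x \<in> space M. \<epsilon> x = -1}"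
    by (rule finite_measure_Union) auto
  also have "\<dots> = 1" using assms by (simp add: rademacher_def)
  also have "{x \<in> space M. \<epsilon> x = 1} \<union> {x \<in> space M. \<epsilon> x = -1}
      = {x \<in> space M. \<epsilon> x = 1 \<or> \<epsilon> x = -1}" by auto
  finally have "prob {x \<in> space M. \<epsilon> x = 1 \<or> \<epsilon> x = -1} = 1" .
  then show ?thesis by (subst (asm) prob_Collect_eq_1) auto
qed

text \<open>Real signs allow the directional proxy \<open>(a \<bullet> b)\<^sup>2\<close> instead of
  \<open>(norm a)\<^sup>2\<close>. Over an orthonormal basis these add up to
  \<open>(norm a)\<^sup>2\<close>, so no dimension enters the constant.\<close>

lemma (in prob_space) nn_integral_exp_inner_rademacher:
  fixes \<epsilon> :: "'a \<Rightarrow> 'k::{real_normed_field, euclidean_space}"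
  assumes "rademacher M \<epsilon>"
  shows "(\<integral>\<^sup>+x. ennreal (exp (t * ((\<epsilon> x * a) \<bullet> b))) \<partial>M) \<le> ennreal (exp ((a \<bullet> b)\<^sup>2 * t\<^sup>2 / 2))"
proof -
  have [measurable]: "\<epsilon> \<in> borel_measurable M" using assms by (simp add: rademacher_def)
  define u where "u = t * (a \<bullet> b)"
  define A where "A s = {x \<in> space M. \<epsilon> x = s}" for s
  have [measurable]: "A s \<in> sets M" for s by (simp add: A_def)
  have A: "emeasure M (A 1) = ennreal (1 / 2)" "emeasure M (A (-1)) = ennreal (1 / 2)"
    unfolding A_def emeasure_eq_measure using assms by (simp_all only: rademacher_def)
  have "(\<integral>\<^sup>+x. ennreal (exp (t * ((\<epsilon> x * a) \<bullet> b))) \<partial>M)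
      = (\<integral>\<^sup>+x. ennreal (exp u) * indicator (A 1) x + ennreal (exp (- u)) * indicator (A (-1)) x \<partial>M)"
  proof (rule nn_integral_cong_AE)
    show "AE x in M. ennreal (exp (t * ((\<epsilon> x * a) \<bullet> b)))
        = ennreal (exp u) * indicator (A 1) x + ennreal (exp (- u)) * indicator (A (-1)) x"
      using rademacher_AE[OF assms] AE_space
      by eventually_elim (auto simp: A_def u_def indicator_def)
  qed
  also have "\<dots> = ennreal (exp u) * ennreal (1 / 2) + ennreal (exp (- u)) * ennreal (1 / 2)"
    by (simp add: nn_integral_add nn_integral_cmult_indicator A)
  also have "\<dots> = ennreal (exp u * (1 / 2) + exp (- u) * (1 / 2))"
    by (simp only: ennreal_mult ennreal_plus exp_ge_zero zero_le_divide_1_iff zero_le_numeral mult_nonneg_nonneg)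
  also have "exp u * (1 / 2) + exp (- u) * (1 / 2) = cosh u"
    by (simp add: cosh_field_def add_divide_distrib)
  also have "ennreal (cosh u) \<le> ennreal (exp (u\<^sup>2 / 2))" by (intro ennreal_leI cosh_le_exp_square)
  also have "u\<^sup>2 = (a \<bullet> b)\<^sup>2 * t\<^sup>2" by (simp add: u_def power_mult_distrib)
  finally show ?thesis .
qed

section \<open>Interpolation\<close>

text \<open>The assumptions on \<open>A\<close> are stated as homogeneity and nonnegativity, so that
  \<open>linf_space_smult\<close> can supply them for tuples over \<open>F l1_l2\<close>.\<close>

lemma op_norm_bounds:
  assumes A: "\<And>c x. x \<in> pts A \<Longrightarrow> c \<odot>\<^bsub>V\<^esub> x \<in> pts A"
      "\<And>c x. x \<in> pts A \<Longrightarrow> nrm A (c \<odot>\<^bsub>V\<^esub> x) = norm (c::'k::real_normed_field) * nrm A x"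
      "\<And>x. x \<in> pts A \<Longrightarrow> 0 \<le> nrm A x"
    and B: "normed_in W B"
    and T: "bounded_op A B T" "\<And>c x. x \<in> pts A \<Longrightarrow> T (c \<odot>\<^bsub>V\<^esub> x) = c \<odot>\<^bsub>W\<^esub> T x"
    and x: "x \<in> pts A"
  shows op_norm_nonneg: "0 \<le> op_norm A B T"
    and nrm_le_op_norm: "nrm B (T x) \<le> op_norm A B T * nrm A x"
proof -
  obtain c where c: "\<And>x. x \<in> pts A \<Longrightarrow> nrm B (T x) \<le> c * nrm A x"
    and TB: "\<And>x. x \<in> pts A \<Longrightarrow> T x \<in> pts B"
    using T(1) by (auto simp: bounded_op_def)
  have B_nrm: "\<And>c y. y \<in> pts B \<Longrightarrow> nrm B (c \<odot>\<^bsub>W\<^esub> y) = norm c * nrm B y"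
      "\<And>y. y \<in> pts B \<Longrightarrow> 0 \<le> nrm B y"
    using B by (auto simp: normed_in_def)
  have bdd: "bdd_above {nrm B (T x) |x. x \<in> pts A \<and> nrm A x \<le> 1}"
  proof (rule bdd_aboveI)
    fix y assume "y \<in> {nrm B (T x) |x. x \<in> pts A \<and> nrm A x \<le> 1}"
    then obtain x where x: "y = nrm B (T x)" "x \<in> pts A" "nrm A x \<le> 1" by auto
    have "c * nrm A x \<le> \<bar>c\<bar> * nrm A x" using A(3)[OF x(2)] by (intro mult_right_mono) auto
    also have "\<dots> \<le> \<bar>c\<bar> * 1" using x(3) by (intro mult_left_mono) auto
    finally show "y \<le> \<bar>c\<bar>" using c[OF x(2)] x(1) by simp
  qed
  have le: "nrm B (T y) \<le> op_norm A B T" if "y \<in> pts A" "nrm A y \<le> 1" for y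
    unfolding op_norm_def by (rule cSup_upper[OF _ bdd]) (use that in auto)
  \<comment> \<open>The multiple of \<open>x\<close> by 0 lies in the unit ball, so a nonnegative
    number occurs under the supremum.\<close>
  have "0 \<le> nrm B (T (0 \<odot>\<^bsub>V\<^esub> x))" by (intro B_nrm TB A(1) x)
  also have "\<dots> \<le> op_norm A B T" by (rule le) (use A x in auto)
  finally show "0 \<le> op_norm A B T" .
  show "nrm B (T x) \<le> op_norm A B T * nrm A x"
  proof (cases "nrm A x = 0")
    case True
    then show ?thesis using c[OF x] by simp
  next
    case False
    define r :: 'k where "r = of_real (inverse (nrm A x))"
    have pos: "0 < nrm A x" using A(3)[OF x] False by simp
    have r: "norm r = inverse (nrm A x)" using pos by (simp add: r_def norm_inverse)
    have "inverse (nrm A x) * nrm B (T x) = nrm B (T (r \<odot>\<^bsub>V\<^esub> x))"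
      by (simp add: T(2)[OF x] B_nrm(1)[OF TB[OF x]] r)
    also have "\<dots> \<le> op_norm A B T" using pos by (intro le A(1) x) (simp add: A(2)[OF x] r)
    finally show ?thesis using pos by (simp add: field_simps)
  qed
qed

lemma normed_in_smult:
  assumes "normed_in V A" "x \<in> pts A"
  shows "c \<odot>\<^bsub>V\<^esub> x \<in> pts A" "nrm A (c \<odot>\<^bsub>V\<^esub> x) = norm (c::'k::real_normed_field) * nrm A x" "0 \<le> nrm A x"
  using assms submodule.smult_closed[of "pts A" "ring_of_type_algebra :: 'k ring" V c x]
  by (auto simp: normed_in_def ring_of_type_algebra_def)

lemma Tuple_in_linf_space_iff:
  "Tuple xs \<in> pts (linf_space N A) \<longleftrightarrow> length xs = N \<and> set xs \<subseteq> pts A"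
  by (auto simp: linf_space_def)

lemma linf_space_smult:
  assumes A: "normed_in V A" and N: "1 \<le> N" and u: "u \<in> pts (linf_space N A)"
  shows "c \<odot>\<^bsub>tuple_module N V\<^esub> u \<in> pts (linf_space N A)"
    "nrm (linf_space N A) (c \<odot>\<^bsub>tuple_module N V\<^esub> u) = norm (c::'k::real_normed_field) * nrm (linf_space N A) u"
    "0 \<le> nrm (linf_space N A) u"
proof -
  obtain xs where xs: "u = Tuple xs" "length xs = N" "set xs \<subseteq> pts A"
    using u by (auto simp: linf_space_def)
  have ne: "set xs \<noteq> {}" using xs N by auto
  have in_A: "x \<in> pts A" if "x \<in> set xs" for x using that xs by blast
  show "c \<odot>\<^bsub>tuple_module N V\<^esub> u \<in> pts (linf_space N A)"
    using xs normed_in_smult(1)[OF A] by (auto simp: tuple_smult Tuple_in_linf_space_iff)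
  have "nrm (linf_space N A) (c \<odot>\<^bsub>tuple_module N V\<^esub> u) = Max ((\<lambda>x. norm c * nrm A x) ` set xs)"
    using normed_in_smult(2)[OF A in_A, of _ c] by (simp add: xs(1) tuple_smult linf_space_def image_image)
  also have "\<dots> = norm c * Max (nrm A ` set xs)"
    using mono_Max_commute[of "\<lambda>r. norm c * r" "nrm A ` set xs"] ne
    by (simp add: monoI mult_left_mono image_image)
  finally show "nrm (linf_space N A) (c \<odot>\<^bsub>tuple_module N V\<^esub> u) = norm c * nrm (linf_space N A) u"
    by (simp add: xs(1) linf_space_def)
  define x where "x = hd xs"
  have x: "x \<in> set xs" using ne by (simp add: x_def)
  have "0 \<le> nrm A x" by (rule normed_in_smult(3)[OF A in_A[OF x]])
  also have "\<dots> \<le> Max (nrm A ` set xs)" using x by (intro Max_ge) auto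
  finally show "0 \<le> nrm (linf_space N A) u" by (simp add: xs(1) linf_space_def)
qed

text \<open>For an operator that is additive on the whole ambient space, a decomposition of a point
  of the sum space is mapped summand by summand.\<close>

lemma couple_opI:
  assumes "\<And>x. x \<in> pts (sp0 A) \<Longrightarrow> x \<in> carrier (amb A)" "\<And>x. x \<in> pts (sp1 A) \<Longrightarrow> x \<in> carrier (amb A)"
    and add_closed: "\<And>x y. x \<in> carrier (amb A) \<Longrightarrow> y \<in> carrier (amb A) \<Longrightarrow> x \<oplus>\<^bsub>amb A\<^esub> y \<in> carrier (amb A)"
    and add: "\<And>x y. x \<in> carrier (amb A) \<Longrightarrow> y \<in> carrier (amb A) \<Longrightarrow> T (x \<oplus>\<^bsub>amb A\<^esub> y) = T x \<oplus>\<^bsub>amb B\<^esub> T y"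
    and smult: "\<And>c x. x \<in> carrier (amb A) \<Longrightarrow> T (c \<odot>\<^bsub>amb A\<^esub> x) = c \<odot>\<^bsub>amb B\<^esub> T x"
    and T: "bounded_op (sp0 A) (sp0 B) T" "bounded_op (sp1 A) (sp1 B) T"
  shows "couple_op A B T"
proof -
  have sum: "x \<in> carrier (amb A)" if "x \<in> pts (sum_space A)" for x
    using that assms(1,2) add_closed by (auto simp: sum_space_def)
  have "T x \<in> pts (sum_space B)" if "x \<in> pts (sum_space A)" for x
  proof -
    obtain y z where x: "x = y \<oplus>\<^bsub>amb A\<^esub> z" and yz: "y \<in> pts (sp0 A)" "z \<in> pts (sp1 A)"
      using \<open>x \<in> pts (sum_space A)\<close> by (auto simp: sum_space_def)
    have "T y \<in> pts (sp0 B)" "T z \<in> pts (sp1 B)" using T yz by (auto simp: bounded_op_def)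
    moreover have "T x = T y \<oplus>\<^bsub>amb B\<^esub> T z" unfolding x using assms(1,2) yz by (intro add)
    ultimately show ?thesis by (auto simp: sum_space_def)
  qed
  then show ?thesis
    unfolding couple_op_def linear_op_def using sum add smult T by auto
qed

lemma
  assumes F: "exact_interpolation_functor F" and A: "banach_couple A"
  shows exact_functor_normed_in: "normed_in (amb A) (F A)"
    and exact_functor_inter: "x \<in> pts (sp0 A) \<Longrightarrow> x \<in> pts (sp1 A) \<Longrightarrow> x \<in> pts (F A)"
proof -
  have "banach_in (amb A) (F A) \<and> bounded_op (inter_space A) (F A) id"
    using assms by (simp add: exact_interpolation_functor_def)
  then show "normed_in (amb A) (F A)"
    and "x \<in> pts (sp0 A) \<Longrightarrow> x \<in> pts (sp1 A) \<Longrightarrow> x \<in> pts (F A)"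
    by (auto simp: banach_in_def bounded_op_def inter_space_def)
qed

lemma exact_functor_bounded_op:
  assumes "exact_interpolation_functor F" "banach_couple A" "banach_couple B" "couple_op A B T"
  shows "bounded_op (F A) (F B) T"
  using assms by (simp add: exact_interpolation_functor_def)

lemma op_norm_le_fundamental_function:
  assumes F: "exact_interpolation_functor F" and "banach_couple A" "banach_couple B" "couple_op A B T"
    and "op_norm (sp0 A) (sp0 B) T \<le> s" "op_norm (sp1 A) (sp1 B) T \<le> t"
  shows "op_norm (F A) (F B) T \<le> fundamental_function F s t"
  unfolding fundamental_function_def
proof (rule cSup_upper)
  show "bdd_above {op_norm (F A) (F B) T |A B T. banach_couple A \<and> banach_couple B \<and> couple_op A B T \<and>
      op_norm (sp0 A) (sp0 B) T \<le> s \<and> op_norm (sp1 A) (sp1 B) T \<le> t}"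
  proof (rule bdd_aboveI)
    fix y assume "y \<in> {op_norm (F A) (F B) T |A B T. banach_couple A \<and> banach_couple B \<and> couple_op A B T \<and>
      op_norm (sp0 A) (sp0 B) T \<le> s \<and> op_norm (sp1 A) (sp1 B) T \<le> t}"
    then obtain A B T where y: "y = op_norm (F A) (F B) T" and AB: "banach_couple A" "banach_couple B"
      "couple_op A B T" and le: "op_norm (sp0 A) (sp0 B) T \<le> s" "op_norm (sp1 A) (sp1 B) T \<le> t" by auto
    have "y \<le> max (op_norm (sp0 A) (sp0 B) T) (op_norm (sp1 A) (sp1 B) T)"
      using F AB unfolding exact_interpolation_functor_def y by blast
    with le show "y \<le> max s t" by (simp add: max_def split: if_splits)
  qed
qed (use assms in blast)

text \<open>The maximum is linearised by averaging the phases over the set of maximising indices.\<close>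

lemma max_norm_linearization:
  fixes f :: "nat \<Rightarrow> 'a \<Rightarrow> 'k::{real_normed_field, euclidean_space}"
  assumes [measurable]: "\<And>j. f j \<in> borel_measurable M" and N: "1 \<le> N"
  obtains w :: "nat \<Rightarrow> 'a \<Rightarrow> 'k" where "\<And>j. w j \<in> borel_measurable M"
    "\<And>x. (\<Sum>j<N. norm (w j x)) \<le> 1"
    "\<And>x. (\<Sum>j<N. w j x * f j x) = of_real (MAX j\<in>{..<N}. norm (f j x))"
proof
  define m where "m x = (MAX j\<in>{..<N}. norm (f j x))" for x
  \<comment> \<open>\<open>c x\<close> counts the maximising indices. Averaging over all of them,
    instead of selecting one, gives an explicit and hence measurable formula.\<close>
  define c where "c x = (\<Sum>j<N. if norm (f j x) = m x then 1 else 0 :: real)" for x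
  \<comment> \<open>Where all \<open>f j x\<close> vanish, division by zero gives 0, so
    \<open>w\<close> vanishes there and the identity reads \<open>0 = 0\<close>.\<close>
  define w :: "nat \<Rightarrow> 'a \<Rightarrow> 'k" where
    "w j x = (if norm (f j x) = m x then of_real (m x / c x) / f j x else 0)" for j x
  have ne: "{..<N} \<noteq> {}" using N by (auto simp: lessThan_empty_iff)
  have [measurable]: "m \<in> borel_measurable M"
    unfolding m_def using ne by (intro borel_measurable_Max) auto
  have [measurable]: "c \<in> borel_measurable M" unfolding c_def by measurable
  show "w j \<in> borel_measurable M" for j unfolding w_def by measurable
  have c: "1 \<le> c x" for x
  proof -
    have "m x \<in> (\<lambda>j. norm (f j x)) ` {..<N}" unfolding m_def using ne by (intro Max_in) auto
    then obtain j where "j < N" "norm (f j x) = m x" by auto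
    then have "(if norm (f j x) = m x then 1 else 0 :: real) \<le> c x"
      unfolding c_def by (intro member_le_sum) auto
    then show ?thesis using \<open>norm (f j x) = m x\<close> by simp
  qed
  show "(\<Sum>j<N. norm (w j x)) \<le> 1" for x
  proof -
    have "(\<Sum>j<N. norm (w j x)) \<le> (\<Sum>j<N. (if norm (f j x) = m x then 1 else 0) / c x)"
    proof (rule sum_mono)
      fix j
      show "norm (w j x) \<le> (if norm (f j x) = m x then 1 else 0) / c x"
      proof (cases "norm (f j x) = m x \<and> f j x \<noteq> 0")
        case True
        then have "0 < m x" using zero_less_norm_iff[of "f j x"] by simp
        with True show ?thesis using c[of x] by (simp add: w_def norm_divide norm_mult)
      next
        case False
        then show ?thesis using c[of x] by (auto simp: w_def)
      qed
    qed
    also have "\<dots> = 1" using c[of x] by (simp add: c_def flip: sum_divide_distrib)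
    finally show ?thesis .
  qed
  show "(\<Sum>j<N. w j x * f j x) = of_real (MAX j\<in>{..<N}. norm (f j x))" for x
  proof -
    have "w j x * f j x = of_real ((if norm (f j x) = m x then 1 else 0) * (m x / c x))" for j
      by (cases "f j x = 0") (auto simp: w_def)
    then have "(\<Sum>j<N. w j x * f j x)
        = of_real (\<Sum>j<N. (if norm (f j x) = m x then 1 else 0) * (m x / c x))"
      by (simp only: of_real_sum)
    also have "(\<Sum>j<N. (if norm (f j x) = m x then 1 else 0) * (m x / c x)) = c x * (m x / c x)"
      unfolding c_def by (simp only: sum_distrib_right)
    also have "c x * (m x / c x) = m x" using c[of x] by simp
    finally show ?thesis by (simp add: m_def)
  qed
qed

lemma lp_partial_sum_le:
  fixes g :: "nat \<Rightarrow> 'k::real_normed_field"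
  assumes "\<And>i. norm (g i) \<le> C" "\<forall>m. lp_partial 1 m a \<le> c" "0 \<le> C"
  shows "norm (\<Sum>i<K. g i * a i) \<le> C * c"
proof -
  have "norm (\<Sum>i<K. g i * a i) \<le> (\<Sum>i<K. C * norm (a i))"
    by (rule sum_norm_le) (simp add: norm_mult mult_right_mono assms)
  also have "\<dots> = C * lp_partial 1 K a" by (simp add: lp_partial_1 sum_distrib_left)
  also have "\<dots> \<le> C * c" using assms by (intro mult_left_mono) auto
  finally show ?thesis .
qed

lemma finite_sequence_in_lp:
  "0 < p \<Longrightarrow> Sequence (\<lambda>i. if i < K then a i else 0) \<in> pts (lp_space p)"
  by (auto simp: lp_space_def intro!: imageI summable_finite[of "{..<K}"] split: if_splits)

section \<open>The interpolated operator\<close>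

text \<open>The distribution of the variables enters through the two endpoint estimates
  \<open>Linf\<close> and \<open>Lphi\<close>, with a common constant \<open>C\<close>.
  \<open>Lphi\<close> ranges over all arrays \<open>y\<close> because the operator has to be bounded
  on every tuple and not just on the columns of \<open>a\<close>; its \<open>g\<close> stands for
  the unscaled value of the operator.\<close>

lemma (in prob_space) max_sum_interpolation_bound:
  fixes \<gamma> :: "nat \<Rightarrow> 'a \<Rightarrow> 'k::{real_normed_field, euclidean_space}" and a :: "nat \<Rightarrow> nat \<Rightarrow> 'k"
    and F :: "('k, ('x, 'a, 'k) point) couple \<Rightarrow> ('x, 'a, 'k) point nspace"
  assumes [measurable]: "\<And>i. \<gamma> i \<in> borel_measurable M"
    and F: "exact_interpolation_functor F" and \<delta>: "infty_property F \<delta>"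
    and N: "1 \<le> N" and C: "0 < C" and t: "0 < t"
    and Linf: "\<And>i. AE x in M. norm (\<gamma> i x) \<le> C"
    and Lphi: "\<And>(y :: nat \<Rightarrow> nat \<Rightarrow> 'k) r d (g :: 'a \<Rightarrow> 'k). (\<And>j. j < N \<Longrightarrow> L2_set (\<lambda>i. norm (y j i)) {..<K} \<le> r) \<Longrightarrow> 0 < r \<Longrightarrow>
      C * t * r < d \<Longrightarrow> g \<in> borel_measurable M \<Longrightarrow>
      (\<And>x. \<exists>j<N. norm (g x) \<le> norm (\<Sum>i<K. \<gamma> i x * y j i)) \<Longrightarrow> d \<in> phi2_admissible M g"
  defines "S \<equiv> rv_class M (\<lambda>x. of_real (MAX j\<in>{..<N}. norm (\<Sum>i<K. \<gamma> i x * a i j)))"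
    and "col \<equiv> \<lambda>j. Sequence (\<lambda>i. if i < K then a i j else 0)"
  shows "S \<in> pts (F (Linfty_Lphi2 M)) \<and> nrm (F (Linfty_Lphi2 M)) S
    \<le> \<delta> * C * fundamental_function F 1 t * (MAX j\<in>{..<N}. nrm (F l1_l2) (col j))"
proof -
  define q :: "nat pmf" where "q = geometric_pmf (1 / 2)"
  have q: "set_pmf q = UNIV" by (simp add: q_def set_pmf_geometric)
  let ?V = "seq_module :: ('k, ('x, 'a, 'k) point) module"
  let ?E = "l1_l2 :: ('k, ('x, 'a, 'k) point) couple"
  let ?L = "Linfty_Lphi2 M :: ('k, ('x, 'a, 'k) point) couple"
  let ?W = "L0_module M :: ('k, ('x, 'a, 'k) point) module"
  let ?EN = "linf_couple N ?E"
  have l1: "gauge_space (measure_pmf q) ?V entries (\<lambda>f c. \<forall>m. lp_partial 1 m f \<le> c) (lp_space 1)"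
    by (rule gauge_space_lp[OF q _ gauge_lp_1[OF q]]) simp
  have l2: "gauge_space (measure_pmf q) ?V entries (\<lambda>f c. \<forall>m. lp_partial 2 m f \<le> c) (lp_space 2)"
    by (rule gauge_space_lp[OF q _ gauge_lp_2[OF q]]) simp
  note linf1 = gauge_space_linf[OF l1 N] and linf2 = gauge_space_linf[OF l2 N]
  interpret EN0: gauge_space "measure_pmf (pair_pmf (pmf_of_set {..<N}) q)" "tuple_module N ?V"
    "\<lambda>u (j, x). entries (coords u ! j) x" "\<lambda>f c. \<forall>j<N. \<forall>m. lp_partial 1 m (\<lambda>x. f (j, x)) \<le> c"
    "linf_space N (lp_space 1)" by (rule linf1)
  interpret EN1: gauge_space "measure_pmf (pair_pmf (pmf_of_set {..<N}) q)" "tuple_module N ?V"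
    "\<lambda>u (j, x). entries (coords u ! j) x" "\<lambda>f c. \<forall>j<N. \<forall>m. lp_partial 2 m (\<lambda>x. f (j, x)) \<le> c"
    "linf_space N (lp_space 2)" by (rule linf2)
  have E: "banach_couple ?E"
    unfolding l1_l2_def by (rule banach_couple_if_gauge_spaces[OF l1 l2])
  have EN: "banach_couple ?EN"
    unfolding linf_couple_def l1_l2_def couple.simps by (rule banach_couple_if_gauge_spaces[OF linf1 linf2])
  have L: "banach_couple ?L"
    unfolding Linfty_Lphi2_def by (rule banach_couple_if_gauge_spaces[OF gauge_space_Linfty gauge_space_Lphi2])

  define f where "f j x = (\<Sum>i<K. \<gamma> i x * a i j)" for j x
  have f_measurable: "f j \<in> borel_measurable M" for j unfolding f_def by measurable
  \<comment> \<open>The weights are computed from the given matrix and kept fixed from here on,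
    which is what makes \<open>T\<close> linear in the tuple \<open>u\<close>.\<close>
  obtain w :: "nat \<Rightarrow> 'a \<Rightarrow> 'k" where [measurable]: "\<And>j. w j \<in> borel_measurable M"
    and w_le: "\<And>x. (\<Sum>j<N. norm (w j x)) \<le> 1"
    and w_f: "\<And>x. (\<Sum>j<N. w j x * f j x) = of_real (MAX j\<in>{..<N}. norm (f j x))"
    by (rule max_norm_linearization[OF f_measurable N], rule that, assumption+)
  define s where "s u j x = (\<Sum>i<K. \<gamma> i x * entries (coords u ! j) i)" for u :: "('x, 'a, 'k) point" and j x
  have [measurable]: "s u j \<in> borel_measurable M" for u j unfolding s_def by measurable
  define G where "G u x = (\<Sum>j<N. w j x * s u j x)" for u x
  have G_measurable [measurable]: "G u \<in> borel_measurable M" for u unfolding G_def by measurable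
  \<comment> \<open>The weights have total modulus at most 1, so for any tuple, and not only for the
    columns, \<open>G u\<close> stays below the largest sum. This keeps \<open>N\<close> out of the
    bound at the \<open>L\<^sub>\<infinity>\<close> endpoint.\<close>
  have G_le: "norm (G u x) \<le> B" if "\<And>j. j < N \<Longrightarrow> norm (s u j x) \<le> B" "0 \<le> B" for u x B
  proof -
    have "norm (G u x) \<le> (\<Sum>j<N. norm (w j x) * B)"
      unfolding G_def using that by (intro sum_norm_le) (auto simp: norm_mult intro!: mult_left_mono)
    also have "\<dots> \<le> 1 * B"
      unfolding sum_distrib_right[symmetric] using w_le that(2) by (rule mult_right_mono)
    finally show ?thesis by simp
  qed
  \<comment> \<open>Division by \<open>C\<close> brings the endpoint norms to at most 1 and
    \<open>t\<close>, the arguments of the fundamental function; \<open>C\<close> is restored at the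
    end.\<close>
  define T :: "('x, 'a, 'k) point \<Rightarrow> ('x, 'a, 'k) point" where
    "T u = rv_class M (\<lambda>x. of_real (1 / C) * G u x)" for u
  have T_carrier: "T u \<in> carrier ?W" for u
    unfolding T_def by (rule rv_class_in_carrier) simp
  have rep_T: "AE x in M. rv_rep (T u) x = of_real (1 / C) * G u x" for u
    unfolding T_def by (rule rv_rep_AE) simp

  have adm0: "AE x in M. norm (rv_rep (T u) x) \<le> d"
    if "u \<in> carrier (tuple_module N ?V)"
      "\<forall>j<N. \<forall>m. lp_partial 1 m (\<lambda>x. case (j, x) of (j, x) \<Rightarrow> entries (coords u ! j) x) \<le> c"
      "0 < c" "1 * c < d" for u c d
  proof -
    have c: "\<forall>m. lp_partial 1 m (entries (coords u ! j)) \<le> c" if "j < N" for j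
      using that \<open>\<forall>j<N. _\<close> by simp
    have "AE x in M. \<forall>i. norm (\<gamma> i x) \<le> C" using Linf by (simp add: AE_all_countable)
    with rep_T[of u] show "AE x in M. norm (rv_rep (T u) x) \<le> d"
    proof eventually_elim
      case (elim x)
      have "norm (G u x) \<le> C * c"
        using elim(2) c C \<open>0 < c\<close> unfolding s_def
        by (intro G_le[unfolded s_def] lp_partial_sum_le) auto
      also have "\<dots> \<le> C * d" using C \<open>1 * c < d\<close> by simp
      finally show ?case
        unfolding elim(1) using C by (simp add: norm_mult norm_divide field_simps)
    qed
  qed
  have "bounded_op (linf_space N (lp_space 1)) (Linfty_space M) T"
    by (rule gauge_space_op_bound(1)[OF linf1 gauge_space_Linfty T_carrier], rule zero_less_one, erule (3) adm0)
  moreover have "op_norm (linf_space N (lp_space 1)) (Linfty_space M) T \<le> 1"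
    by (rule gauge_space_op_bound(2)[OF linf1 gauge_space_Linfty T_carrier], rule zero_less_one, erule (3) adm0)
  ultimately have T0: "bounded_op (sp0 ?EN) (sp0 ?L) T" "op_norm (sp0 ?EN) (sp0 ?L) T \<le> 1"
    by (simp_all add: linf_couple_def l1_l2_def Linfty_Lphi2_def)

  have adm1: "d \<in> phi2_admissible M (rv_rep (T u))"
    if "u \<in> carrier (tuple_module N ?V)"
      and u: "\<forall>j<N. \<forall>m. lp_partial 2 m (\<lambda>x. case (j, x) of (j, x) \<Rightarrow> entries (coords u ! j) x) \<le> c"
      and cd: "0 < c" "t * c < d" for u c d
  proof -
    interpret P: gauge M "\<lambda>(f :: 'a \<Rightarrow> 'k) c. c \<in> phi2_admissible M f" by (rule gauge_Lphi2)
    have d: "0 < d" using cd t by (meson less_trans mult_pos_pos)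
    have L2: "L2_set (\<lambda>i. norm (entries (coords u ! j) i)) {..<K} \<le> c" if "j < N" for j
      using u that by (simp add: lp_partial_2)
    have ex: "\<exists>j<N. norm (G u x) \<le> norm (\<Sum>i<K. \<gamma> i x * entries (coords u ! j) i)" for x
    proof -
      have "{..<N} \<noteq> {}" using N by (auto simp: lessThan_empty_iff)
      then have "(MAX k\<in>{..<N}. norm (s u k x)) \<in> (\<lambda>k. norm (s u k x)) ` {..<N}"
        by (intro Max_in) auto
      then obtain j where j: "j < N" "(MAX k\<in>{..<N}. norm (s u k x)) = norm (s u j x)" by auto
      have "norm (s u k x) \<le> norm (s u j x)" if "k < N" for k
        unfolding j(2)[symmetric] using that by (intro Max_ge) auto
      then have "norm (G u x) \<le> norm (s u j x)" by (intro G_le) auto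
      with j(1) show ?thesis by (auto simp: s_def)
    qed
    have "C * t * c < C * d" using cd C by simp
    have "C * d \<in> phi2_admissible M (G u)"
      by (rule Lphi[OF _ cd(1)]) (erule L2, rule \<open>C * t * c < C * d\<close>, rule G_measurable, rule ex)
    then have "norm (of_real (1 / C) :: 'k) * (C * d) \<in> phi2_admissible M (\<lambda>x. of_real (1 / C) * G u x)"
      by (rule P.adm_smult) (use C d in auto)
    then have "d \<in> phi2_admissible M (\<lambda>x. of_real (1 / C) * G u x)"
      using C by (simp add: norm_divide)
    then show "d \<in> phi2_admissible M (rv_rep (T u))"
      by (rule P.adm_cong[rotated 3])
        (use rep_T[of u] d T_carrier[of u] in \<open>auto intro: rv_rep_measurable_carrier\<close>)
  qed
  have "bounded_op (linf_space N (lp_space 2)) (Lphi2_space M) T"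
    by (rule gauge_space_op_bound(1)[OF linf2 gauge_space_Lphi2 T_carrier t]) (erule (3) adm1)
  moreover have "op_norm (linf_space N (lp_space 2)) (Lphi2_space M) T \<le> t"
    by (rule gauge_space_op_bound(2)[OF linf2 gauge_space_Lphi2 T_carrier t]) (erule (3) adm1)
  ultimately have T1: "bounded_op (sp1 ?EN) (sp1 ?L) T" "op_norm (sp1 ?EN) (sp1 ?L) T \<le> t"
    by (simp_all add: linf_couple_def l1_l2_def Linfty_Lphi2_def)

  have coords_nth: "length (coords u) = N" if "u \<in> carrier (tuple_module N ?V)" for u
    using that by (rule in_carrier_tupleE) simp
  have T_add: "T (u \<oplus>\<^bsub>tuple_module N ?V\<^esub> v) = T u \<oplus>\<^bsub>?W\<^esub> T v"
    if "u \<in> carrier (tuple_module N ?V)" "v \<in> carrier (tuple_module N ?V)" for u v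
  proof -
    have "s (u \<oplus>\<^bsub>tuple_module N ?V\<^esub> v) j x = s u j x + s v j x" if "j < N" for j x
      using coords_nth[OF \<open>u \<in> _\<close>] coords_nth[OF \<open>v \<in> _\<close>] that
      by (simp add: s_def tuple_module_def seq_module_def distrib_left sum.distrib)
    then have "G (u \<oplus>\<^bsub>tuple_module N ?V\<^esub> v) x = G u x + G v x" for x
      by (simp add: G_def distrib_left sum.distrib)
    then show ?thesis unfolding T_def by (subst rv_class_add) (auto simp: distrib_left)
  qed
  have T_smult: "T (c \<odot>\<^bsub>tuple_module N ?V\<^esub> u) = c \<odot>\<^bsub>?W\<^esub> T u"
    if "u \<in> carrier (tuple_module N ?V)" for c u
  proof -
    have "s (c \<odot>\<^bsub>tuple_module N ?V\<^esub> u) j x = c * s u j x" if "j < N" for j x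
      using coords_nth[OF \<open>u \<in> _\<close>] that
      by (simp add: s_def tuple_module_def seq_module_def sum_distrib_left mult.left_commute)
    then have "G (c \<odot>\<^bsub>tuple_module N ?V\<^esub> u) x = c * G u x" for x
      by (simp add: G_def sum_distrib_left mult.left_commute)
    then show ?thesis unfolding T_def by (subst rv_class_smult) (auto simp: mult.left_commute)
  qed
  have amb: "amb ?EN = tuple_module N ?V" "amb ?L = ?W" "amb ?E = ?V"
      "sp0 ?EN = linf_space N (lp_space 1)" "sp1 ?EN = linf_space N (lp_space 2)"
    by (simp_all add: linf_couple_def l1_l2_def Linfty_Lphi2_def)
  have T: "couple_op ?EN ?L T"
  proof (rule couple_opI)
    show "\<And>x. x \<in> pts (sp0 ?EN) \<Longrightarrow> x \<in> carrier (amb ?EN)" unfolding amb by (rule EN0.pts_carrier)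
    show "\<And>x. x \<in> pts (sp1 ?EN) \<Longrightarrow> x \<in> carrier (amb ?EN)" unfolding amb by (rule EN1.pts_carrier)
    show "\<And>x y. x \<in> carrier (amb ?EN) \<Longrightarrow> y \<in> carrier (amb ?EN) \<Longrightarrow> x \<oplus>\<^bsub>amb ?EN\<^esub> y \<in> carrier (amb ?EN)"
      unfolding amb by (rule EN0.add_carrier)
  qed (use T_add T_smult T0(1) T1(1) in \<open>simp_all only: amb\<close>)

  have FE: "normed_in ?V (F ?E)" and FEN: "normed_in (tuple_module N ?V) (F ?EN)" and FL: "normed_in ?W (F ?L)"
    using exact_functor_normed_in[OF F E] exact_functor_normed_in[OF F EN] exact_functor_normed_in[OF F L]
    by (simp_all only: amb)
  have inter: "x \<in> pts (F ?E)" if "x \<in> pts (lp_space 1)" "x \<in> pts (lp_space 2)" for x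
    using exact_functor_inter[OF F E, of x] that by (simp add: l1_l2_def)
  have FT: "bounded_op (F ?EN) (F ?L) T"
    by (rule exact_functor_bounded_op[OF F EN L T])
  have F_carrier: "x \<in> carrier (tuple_module N ?V)" if "x \<in> pts (F ?EN)" for x
    using FEN that by (auto simp: normed_in_def submodule_def subgroup_def)

  define u where "u = Tuple (map col [0..<N])"
  have "col j \<in> pts (F ?E)" for j
    unfolding col_def by (intro inter finite_sequence_in_lp) auto
  then have u: "u \<in> pts (linf_space N (F ?E))" by (auto simp: u_def Tuple_in_linf_space_iff)
  have nrm_u: "nrm (linf_space N (F ?E)) u = (MAX j\<in>{..<N}. nrm (F ?E) (col j))"
    by (simp add: u_def linf_space_def image_image atLeast0LessThan)
  \<comment> \<open>This is the only use of the \<open>\<infinity>\<close>-property: it moves the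
    tuple of columns from tuples over \<open>F l1_l2\<close> into \<open>F\<close> of the couple of
    tuple spaces, where \<open>T\<close> can be interpolated.\<close>
  have id: "bounded_op (linf_space N (F ?E)) (F ?EN) id" "op_norm (linf_space N (F ?E)) (F ?EN) id \<le> \<delta>"
    using \<delta> E N by (auto simp: infty_property_def)
  have u': "u \<in> pts (F ?EN)" using id(1) u by (auto simp: bounded_op_def)
  have "nrm (F ?EN) (id u) \<le> op_norm (linf_space N (F ?E)) (F ?EN) id * nrm (linf_space N (F ?E)) u"
    by (rule nrm_le_op_norm[OF linf_space_smult[OF FE N] FEN id(1) _ u]) auto
  also have "\<dots> \<le> \<delta> * nrm (linf_space N (F ?E)) u"
    by (rule mult_right_mono[OF id(2) linf_space_smult(3)[OF FE N u]])
  finally have nu: "nrm (F ?EN) u \<le> \<delta> * (MAX j\<in>{..<N}. nrm (F ?E) (col j))" by (simp add: nrm_u)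
  note op = op_norm_bounds[OF normed_in_smult[OF FEN] FL FT T_smult[OF F_carrier] u']
  have \<phi>: "op_norm (F ?EN) (F ?L) T \<le> fundamental_function F 1 t"
    by (rule op_norm_le_fundamental_function[OF F EN L T T0(2) T1(2)])
  have "nrm (F ?L) (T u) \<le> op_norm (F ?EN) (F ?L) T * nrm (F ?EN) u" by (rule op(2))
  also have "\<dots> \<le> fundamental_function F 1 t * nrm (F ?EN) u"
    by (rule mult_right_mono[OF \<phi> normed_in_smult(3)[OF FEN u']])
  \<comment> \<open>The multiplier is nonnegative because it dominates the operator norm of
    \<open>T\<close>.\<close>
  also have "\<dots> \<le> fundamental_function F 1 t * (\<delta> * (MAX j\<in>{..<N}. nrm (F ?E) (col j)))"
    using nu op(1) \<phi> by (intro mult_left_mono) auto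
  finally have nTu: "nrm (F ?L) (T u) \<le> fundamental_function F 1 t * (\<delta> * (MAX j\<in>{..<N}. nrm (F ?E) (col j)))" .
  have Tu: "T u \<in> pts (F ?L)" using FT u' by (auto simp: bounded_op_def)
  \<comment> \<open>On the columns the fixed weights are the right ones, so \<open>G u\<close> is
    the maximal function itself.\<close>
  have "s u j x = f j x" if "j < N" for j x
    using that by (simp add: s_def f_def u_def col_def)
  then have "G u x = of_real (MAX j\<in>{..<N}. norm (f j x))" for x
    by (simp add: G_def w_f)
  then have S: "S = of_real C \<odot>\<^bsub>?W\<^esub> T u"
    unfolding T_def using C by (subst rv_class_smult) (simp_all add: S_def f_def)
  have "nrm (F ?L) S = C * nrm (F ?L) (T u)"
    unfolding S normed_in_smult(2)[OF FL Tu] using C by simp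
  also have "\<dots> \<le> C * (fundamental_function F 1 t * (\<delta> * (MAX j\<in>{..<N}. nrm (F ?E) (col j))))"
    using nTu C by (intro mult_left_mono) auto
  finally show ?thesis
    using normed_in_smult(1)[OF FL Tu] by (simp add: S mult_ac)
qed

text \<open>\<open>\<sigma> a b\<close> is a variance proxy of \<open>\<gamma> i * a\<close> in the
  direction \<open>b\<close>, and \<open>r\<close> compares its total over all directions with
  \<open>(norm a)\<^sup>2\<close>. As parameters they serve both constants:
  \<open>r = DIM('k) * s\<^sup>2\<close> in general and \<open>r = 1\<close> for Rademacher
  variables.\<close>

lemma (in prob_space) max_independent_subgaussian_phi2_admissible:
  fixes \<gamma> :: "nat \<Rightarrow> 'a \<Rightarrow> 'k::{real_normed_field, euclidean_space}"
  assumes N: "1 \<le> (N :: nat)" and indep: "indep_vars (\<lambda>_. borel) \<gamma> UNIV"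
    and g_measurable: "(g :: 'a \<Rightarrow> 'k) \<in> borel_measurable M"
    and \<sigma>: "\<And>a b. b \<in> Basis \<Longrightarrow> 0 \<le> \<sigma> a b"
    and sub: "\<And>i a b t. b \<in> Basis \<Longrightarrow>
      (\<integral>\<^sup>+x. ennreal (exp (t * ((\<gamma> i x * a) \<bullet> b))) \<partial>M) \<le> ennreal (exp (\<sigma> a b * t\<^sup>2 / 2))"
    and \<rho>: "\<And>a. (\<Sum>b\<in>Basis. \<sigma> a b) \<le> r * (norm a)\<^sup>2" "0 \<le> r"
    and c: "\<And>j. j < N \<Longrightarrow> L2_set (\<lambda>i. norm (a j i)) {..<K} \<le> c"
    and d: "0 < d" "8 / 3 * (1 + log 2 N) * (r * c\<^sup>2) < d\<^sup>2"
    and g: "\<And>x. \<exists>j<N. norm (g x) \<le> norm (\<Sum>i<K. \<gamma> i x * a j i)"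
  shows "d \<in> phi2_admissible M g"
proof -
  have [measurable]: "\<gamma> i \<in> borel_measurable M" for i
    using indep by (simp add: indep_vars_def)
  show ?thesis
  proof (rule max_subgaussian_phi2_admissible[OF N, where f = "\<lambda>j x. \<Sum>i<K. \<gamma> i x * a j i"
        and \<sigma> = "\<lambda>j b. \<Sum>i<K. \<sigma> (a j i) b" and \<rho> = "r * c\<^sup>2"])
    fix j b t assume j: "j < N" and b: "b \<in> (Basis :: 'k set)"
    show "0 \<le> (\<Sum>i<K. \<sigma> (a j i) b)" using \<sigma>[OF b] by (intro sum_nonneg)
    show "(\<integral>\<^sup>+x. ennreal (exp (t * ((\<Sum>i<K. \<gamma> i x * a j i) \<bullet> b))) \<partial>M)
        \<le> ennreal (exp ((\<Sum>i<K. \<sigma> (a j i) b) * t\<^sup>2 / 2))"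
      using sub[OF b] by (intro nn_integral_exp_inner_sum_le indep)
  next
    fix j assume j: "j < N"
    have "(\<Sum>b\<in>Basis. \<Sum>i<K. \<sigma> (a j i) b) = (\<Sum>i<K. \<Sum>b\<in>Basis. \<sigma> (a j i) b)"
      by (rule sum.swap)
    also have "\<dots> \<le> (\<Sum>i<K. r * (norm (a j i))\<^sup>2)" by (intro sum_mono \<rho>)
    also have "\<dots> = r * (L2_set (\<lambda>i. norm (a j i)) {..<K})\<^sup>2"
      by (simp add: L2_set_def sum_distrib_left sum_nonneg)
    also have "\<dots> \<le> r * c\<^sup>2"
      using c[OF j] \<rho>(2) by (intro mult_left_mono power_mono) (auto simp: L2_set_nonneg)
    finally show "(\<Sum>b\<in>Basis. \<Sum>i<K. \<sigma> (a j i) b) \<le> r * c\<^sup>2" .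
  qed (use d g g_measurable in simp_all)
qed

theorem theorem7p2:
  fixes s M :: real
  shows "(\<exists>C>0. \<forall>(P :: 'p measure)
              (\<gamma> :: nat \<Rightarrow> 'p \<Rightarrow> 'k::{real_normed_field, euclidean_space})
              (F :: ('k, ('x, 'p, 'k) point) couple \<Rightarrow> ('x, 'p, 'k) point nspace) \<delta>.
            prob_space P \<longrightarrow>
            prob_space.indep_vars P (\<lambda>_. borel) \<gamma> UNIV \<longrightarrow>
            (\<forall>i. subgaussian P (\<gamma> i)) \<longrightarrow>
            bdd_above (range (\<lambda>i. sg P (\<gamma> i))) \<longrightarrow> (SUP i. sg P (\<gamma> i)) = s \<longrightarrow>
            (SUP i. Linfty_norm P (\<gamma> i)) = ereal M \<longrightarrow>
            exact_interpolation_functor F \<longrightarrow> infty_property F \<delta> \<longrightarrow>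
            (\<forall>N\<ge>1. \<forall>K\<ge>1. \<forall>a :: nat \<Rightarrow> nat \<Rightarrow> 'k.
               let S = rv_class P (\<lambda>\<omega>. of_real (MAX j\<in>{..<N}. norm (\<Sum>i<K. \<gamma> i \<omega> * a i j)));
                   col = (\<lambda>j. Sequence (\<lambda>i. if i < K then a i j else 0))
               in S \<in> pts (F (Linfty_Lphi2 P)) \<and>
                  nrm (F (Linfty_Lphi2 P)) S
                    \<le> \<delta> * C * fundamental_function F 1 (sqrt (1 + ln (real N)))
                        * (MAX j\<in>{..<N}. nrm (F l1_l2) (col j)))) \<and>
         (\<forall>(P :: 'p measure) (\<epsilon> :: nat \<Rightarrow> 'p \<Rightarrow> 'k)
            (F :: ('k, ('x, 'p, 'k) point) couple \<Rightarrow> ('x, 'p, 'k) point nspace) \<delta>.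
            prob_space P \<longrightarrow>
            prob_space.indep_vars P (\<lambda>_. borel) \<epsilon> UNIV \<longrightarrow>
            (\<forall>i. rademacher P (\<epsilon> i)) \<longrightarrow>
            exact_interpolation_functor F \<longrightarrow> infty_property F \<delta> \<longrightarrow>
            (\<forall>N\<ge>1. \<forall>K\<ge>1. \<forall>a :: nat \<Rightarrow> nat \<Rightarrow> 'k.
               let S = rv_class P (\<lambda>\<omega>. of_real (MAX j\<in>{..<N}. norm (\<Sum>i<K. \<epsilon> i \<omega> * a i j)));
                   col = (\<lambda>j. Sequence (\<lambda>i. if i < K then a i j else 0))
               in S \<in> pts (F (Linfty_Lphi2 P)) \<and>
                  nrm (F (Linfty_Lphi2 P)) S
                    \<le> \<delta> * sqrt (8 / 3) * fundamental_function F 1 (sqrt (1 + log 2 (real N)))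
                        * (MAX j\<in>{..<N}. nrm (F l1_l2) (col j))))"
proof (intro conjI)
  \<comment> \<open>The factor \<open>8 / 3\<close> is the Gaussian one, the dimension pays for
    using the full proxy \<open>s\<^sup>2 * (norm a)\<^sup>2\<close> in each direction, and
    \<open>1 / ln 2\<close> for passing from \<open>1 + log 2 N\<close> to
    \<open>1 + ln N\<close>.\<close>
  define D where "D = 8 / 3 * real DIM('k) / ln 2"
  have D: "0 \<le> D" by (simp add: D_def)
  \<comment> \<open>\<open>M\<close> serves the \<open>L\<^sub>\<infinity>\<close> endpoint,
    \<open>sqrt D * \<bar>s\<bar>\<close> the Orlicz endpoint, and 1 makes \<open>C\<close>
    positive. The modulus is there because \<open>s\<close> is fixed before anything is known about
    its sign.\<close>
  define C where "C = max 1 (max M (sqrt D * \<bar>s\<bar>))"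
  have C: "1 \<le> C" "M \<le> C" "sqrt D * \<bar>s\<bar> \<le> C" by (auto simp: C_def)
  have C2: "D * s\<^sup>2 \<le> C\<^sup>2"
  proof -
    have "(sqrt D * \<bar>s\<bar>)\<^sup>2 \<le> C\<^sup>2" using C(3) D by (intro power_mono) auto
    then show ?thesis using D by (simp add: power_mult_distrib)
  qed
  show "\<exists>C>0. \<forall>(P :: 'p measure)
              (\<gamma> :: nat \<Rightarrow> 'p \<Rightarrow> 'k::{real_normed_field, euclidean_space})
              (F :: ('k, ('x, 'p, 'k) point) couple \<Rightarrow> ('x, 'p, 'k) point nspace) \<delta>.
            prob_space P \<longrightarrow>
            prob_space.indep_vars P (\<lambda>_. borel) \<gamma> UNIV \<longrightarrow>
            (\<forall>i. subgaussian P (\<gamma> i)) \<longrightarrow>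
            bdd_above (range (\<lambda>i. sg P (\<gamma> i))) \<longrightarrow> (SUP i. sg P (\<gamma> i)) = s \<longrightarrow>
            (SUP i. Linfty_norm P (\<gamma> i)) = ereal M \<longrightarrow>
            exact_interpolation_functor F \<longrightarrow> infty_property F \<delta> \<longrightarrow>
            (\<forall>N\<ge>1. \<forall>K\<ge>1. \<forall>a :: nat \<Rightarrow> nat \<Rightarrow> 'k.
               let S = rv_class P (\<lambda>\<omega>. of_real (MAX j\<in>{..<N}. norm (\<Sum>i<K. \<gamma> i \<omega> * a i j)));
                   col = (\<lambda>j. Sequence (\<lambda>i. if i < K then a i j else 0))
               in S \<in> pts (F (Linfty_Lphi2 P)) \<and>
                  nrm (F (Linfty_Lphi2 P)) S
                    \<le> \<delta> * C * fundamental_function F 1 (sqrt (1 + ln (real N)))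
                        * (MAX j\<in>{..<N}. nrm (F l1_l2) (col j)))"
  proof (intro exI[of _ C] conjI allI impI)
    show "0 < C" using C by simp
    fix P :: "'p measure" and \<gamma> :: "nat \<Rightarrow> 'p \<Rightarrow> 'k"
      and F :: "('k, ('x, 'p, 'k) point) couple \<Rightarrow> ('x, 'p, 'k) point nspace"
      and \<delta> and N K :: nat and a :: "nat \<Rightarrow> nat \<Rightarrow> 'k"
    assume "prob_space P" and indep: "prob_space.indep_vars P (\<lambda>_. borel) \<gamma> UNIV"
      and subg: "\<forall>i. subgaussian P (\<gamma> i)" and bdd: "bdd_above (range (\<lambda>i. sg P (\<gamma> i)))"
      and s: "(SUP i. sg P (\<gamma> i)) = s" and M: "(SUP i. Linfty_norm P (\<gamma> i)) = ereal M"
      and F: "exact_interpolation_functor F" and \<delta>: "infty_property F \<delta>"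
      and N: "1 \<le> N"
    interpret prob_space P by fact
    have \<gamma>: "\<gamma> i \<in> borel_measurable P" for i using subg by (simp add: subgaussian_def)
    have sg: "sg P (\<gamma> i) \<le> s" for i
      unfolding s[symmetric] by (rule cSUP_upper[OF UNIV_I bdd])
    have "0 \<le> ln (real N)" using N by simp
    then have t: "0 < sqrt (1 + ln (real N))" by simp
    have log: "1 + log 2 (real N) \<le> (1 + ln (real N)) / ln 2"
    proof -
      have "1 \<le> 1 / ln (2::real)" using ln_2_less_1 by simp
      then show ?thesis by (simp add: log_def add_divide_distrib)
    qed
    have bound: "AE x in P. norm (\<gamma> i x) \<le> C" for i
    proof -
      have "Linfty_norm P (\<gamma> i) \<le> (SUP i. Linfty_norm P (\<gamma> i))" by (rule SUP_upper) simp
      also have "\<dots> \<le> ereal C" unfolding M using C(2) by simp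
      finally show ?thesis using Linfty_norm_le_iff[OF \<gamma>] by blast
    qed
    show "let S = rv_class P (\<lambda>\<omega>. of_real (MAX j\<in>{..<N}. norm (\<Sum>i<K. \<gamma> i \<omega> * a i j)));
              col = (\<lambda>j. Sequence (\<lambda>i. if i < K then a i j else 0))
          in S \<in> pts (F (Linfty_Lphi2 P)) \<and>
             nrm (F (Linfty_Lphi2 P)) S
               \<le> \<delta> * C * fundamental_function F 1 (sqrt (1 + ln (real N)))
                   * (MAX j\<in>{..<N}. nrm (F l1_l2) (col j))"
      unfolding Let_def
    proof (rule max_sum_interpolation_bound[OF \<gamma> F \<delta> N _ t bound])
      show "0 < C" using C by simp
      fix b :: "nat \<Rightarrow> nat \<Rightarrow> 'k" and c d :: real and g :: "'p \<Rightarrow> 'k"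
      assume b: "\<And>j. j < N \<Longrightarrow> L2_set (\<lambda>i. norm (b j i)) {..<K} \<le> c" and c: "0 < c"
        and d: "C * sqrt (1 + ln (real N)) * c < d" and g: "g \<in> borel_measurable P"
          "\<And>x. \<exists>j<N. norm (g x) \<le> norm (\<Sum>i<K. \<gamma> i x * b j i)"
      have pos: "0 \<le> C * sqrt (1 + ln (real N)) * c" using C c t by (intro mult_nonneg_nonneg) auto
      have "8 / 3 * (1 + log 2 N) * (DIM('k) * s\<^sup>2 * c\<^sup>2)
          \<le> 8 / 3 * ((1 + ln (real N)) / ln 2) * (DIM('k) * s\<^sup>2 * c\<^sup>2)"
        using log by (intro mult_right_mono mult_left_mono) auto
      also have "\<dots> = D * s\<^sup>2 * ((1 + ln (real N)) * c\<^sup>2)" by (simp add: D_def)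
      also have "\<dots> \<le> C\<^sup>2 * ((1 + ln (real N)) * c\<^sup>2)"
        using C2 \<open>0 \<le> ln (real N)\<close> by (intro mult_right_mono) auto
      also have "\<dots> = (C * sqrt (1 + ln (real N)) * c)\<^sup>2"
        using \<open>0 \<le> ln (real N)\<close> by (simp add: power_mult_distrib)
      also have "\<dots> < d\<^sup>2" using d pos by (intro power_strict_mono) auto
      finally have d2: "8 / 3 * (1 + log 2 N) * (DIM('k) * s\<^sup>2 * c\<^sup>2) < d\<^sup>2" .
      show "d \<in> phi2_admissible P g"
        by (rule max_independent_subgaussian_phi2_admissible[OF N indep g(1),
              where \<sigma> = "\<lambda>a b. s\<^sup>2 * (norm a)\<^sup>2" and r = "DIM('k) * s\<^sup>2" and c = c and a = b])
          (use subg sg b g(2) d pos d2 in \<open>auto intro!: nn_integral_exp_inner_subgaussian\<close>)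
    qed
  qed
next
  show "\<forall>(P :: 'p measure) (\<epsilon> :: nat \<Rightarrow> 'p \<Rightarrow> 'k)
            (F :: ('k, ('x, 'p, 'k) point) couple \<Rightarrow> ('x, 'p, 'k) point nspace) \<delta>.
            prob_space P \<longrightarrow>
            prob_space.indep_vars P (\<lambda>_. borel) \<epsilon> UNIV \<longrightarrow>
            (\<forall>i. rademacher P (\<epsilon> i)) \<longrightarrow>
            exact_interpolation_functor F \<longrightarrow> infty_property F \<delta> \<longrightarrow>
            (\<forall>N\<ge>1. \<forall>K\<ge>1. \<forall>a :: nat \<Rightarrow> nat \<Rightarrow> 'k.
               let S = rv_class P (\<lambda>\<omega>. of_real (MAX j\<in>{..<N}. norm (\<Sum>i<K. \<epsilon> i \<omega> * a i j)));
                   col = (\<lambda>j. Sequence (\<lambda>i. if i < K then a i j else 0))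
               in S \<in> pts (F (Linfty_Lphi2 P)) \<and>
                  nrm (F (Linfty_Lphi2 P)) S
                    \<le> \<delta> * sqrt (8 / 3) * fundamental_function F 1 (sqrt (1 + log 2 (real N)))
                        * (MAX j\<in>{..<N}. nrm (F l1_l2) (col j)))"
  proof (intro allI impI)
    fix P :: "'p measure" and \<epsilon> :: "nat \<Rightarrow> 'p \<Rightarrow> 'k"
      and F :: "('k, ('x, 'p, 'k) point) couple \<Rightarrow> ('x, 'p, 'k) point nspace"
      and \<delta> and N K :: nat and a :: "nat \<Rightarrow> nat \<Rightarrow> 'k"
    assume "prob_space P" and indep: "prob_space.indep_vars P (\<lambda>_. borel) \<epsilon> UNIV"
      and rad: "\<forall>i. rademacher P (\<epsilon> i)"
      and F: "exact_interpolation_functor F" and \<delta>: "infty_property F \<delta>"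
      and N: "1 \<le> N"
    interpret prob_space P by fact
    have \<epsilon>: "\<epsilon> i \<in> borel_measurable P" for i using rad by (simp add: rademacher_def)
    have "0 \<le> log 2 (real N)" using N by simp
    then have t: "0 < sqrt (1 + log 2 (real N))" by simp
    \<comment> \<open>At this endpoint \<open>1 \<le> sqrt (8 / 3)\<close> suffices, so the constant
      is dictated by the Orlicz endpoint.\<close>
    have bound: "AE x in P. norm (\<epsilon> i x) \<le> sqrt (8 / 3)" for i
      using rademacher_AE[OF rad[THEN spec, of i]] by eventually_elim auto
    show "let S = rv_class P (\<lambda>\<omega>. of_real (MAX j\<in>{..<N}. norm (\<Sum>i<K. \<epsilon> i \<omega> * a i j)));
              col = (\<lambda>j. Sequence (\<lambda>i. if i < K then a i j else 0))
          in S \<in> pts (F (Linfty_Lphi2 P)) \<and>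
             nrm (F (Linfty_Lphi2 P)) S
               \<le> \<delta> * sqrt (8 / 3) * fundamental_function F 1 (sqrt (1 + log 2 (real N)))
                   * (MAX j\<in>{..<N}. nrm (F l1_l2) (col j))"
      unfolding Let_def
    proof (rule max_sum_interpolation_bound[OF \<epsilon> F \<delta> N _ t bound])
      fix b :: "nat \<Rightarrow> nat \<Rightarrow> 'k" and c d :: real and g :: "'p \<Rightarrow> 'k"
      assume b: "\<And>j. j < N \<Longrightarrow> L2_set (\<lambda>i. norm (b j i)) {..<K} \<le> c" and c: "0 < c"
        and d: "sqrt (8 / 3) * sqrt (1 + log 2 (real N)) * c < d" and g: "g \<in> borel_measurable P"
          "\<And>x. \<exists>j<N. norm (g x) \<le> norm (\<Sum>i<K. \<epsilon> i x * b j i)"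
      have pos: "0 \<le> sqrt (8 / 3) * sqrt (1 + log 2 (real N)) * c"
        using c t by (intro mult_nonneg_nonneg) auto
      have "8 / 3 * (1 + log 2 N) * (1 * c\<^sup>2) = (sqrt (8 / 3) * sqrt (1 + log 2 (real N)) * c)\<^sup>2"
        using \<open>0 \<le> log 2 (real N)\<close> by (simp add: power_mult_distrib)
      also have "\<dots> < d\<^sup>2" using d pos by (intro power_strict_mono) auto
      finally have d2: "8 / 3 * (1 + log 2 N) * (1 * c\<^sup>2) < d\<^sup>2" .
      \<comment> \<open>Parseval's identity: the directional proxies have total
        \<open>(norm x)\<^sup>2\<close>, whence \<open>r = 1\<close>.\<close>
      have norm_sum: "(\<Sum>b\<in>Basis. (x \<bullet> b)\<^sup>2) \<le> 1 * (norm x)\<^sup>2" for x :: 'k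
        unfolding power2_norm_eq_inner euclidean_inner[of x x] by (simp add: power2_eq_square)
      show "d \<in> phi2_admissible P g"
        by (rule max_independent_subgaussian_phi2_admissible[OF N indep g(1),
              where \<sigma> = "\<lambda>a b. (a \<bullet> b)\<^sup>2" and r = 1 and c = c and a = b])
          (use rad b g(2) d pos d2 norm_sum in \<open>auto intro!: nn_integral_exp_inner_rademacher\<close>)
    qed simp
  qed
qed

end
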